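(* Let $k\ge 1$ and let $Q_1,\dots,Q_k\in\mathbb{Z}[X]$ be $k$ pairwise coprime irreducible polynomials. Let $Q=Q_1\cdots Q_k$, let $g$ be its degree and $D$ its discriminant, and assume that $Q$ has no fixed prime divisor. Let $0<\alpha<1$, $0<\delta<1$, $A\ge 1$, $B\ge 1$, let $0<\epsilon\le \frac{\alpha}{50g(g+1/\delta)}$, and let $F\in\mathcal{M}_k(A,B,\epsilon)$ be multiplicative. Then, uniformly in $x\ge c_0\|Q\|^{\delta}$ and $x^{\alpha}<y\le x$, \[ \sum_{x<n\le x+y} F\big(|Q_1(n)|,\dots,|Q_k(n)|\big)\ll \Delta_D\, y\prod_{p\le x}\Big(1-\frac{\rho(p)}{p}\Big)\sum_{\substack{n_1\cdots n_k\le x\\ (n_1\cdots n_k,D)=1}} F(n_1,\dots,n_k)\frac{\rho_{Q_1}(n_1)\cdots\rho_{Q_k}(n_k)}{n_1\cdots n_k}, \] where \[ \Delta_D=\prod_{p\mid D}\bigg(1+\sum_{\substack{\nu_j\le \deg(Q_j)\\(1\le j\le k)}}F(p^{\nu_1},\dots,p^{\nu_k})\,\frac{\#\{n \bmod p^{\max_j(\nu_j)+1}: p^{\nu_j}\,\|\,Q_j(n)\ \forall j\}}{p^{\max_j(\nu_j)+1}}\bigg), \] and where $c_0$ and the implicit constant depend at most on $g,\alpha,\delta,A,B$.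
   Context: For $P\in\mathbb{Z}[X]$, $\rho_P(n)$ denotes the number of residues $m\bmod n$ with $n\mid P(m)$, and $\rho=\rho_Q$. $\|Q\|$ is the sum of the absolute values of the coefficients of $Q$. A prime $p$ is a fixed prime divisor of $Q$ if $p\mid Q(n)$ for all $n\in\mathbb{N}$. The notation $a\|b$ means $a\mid b$ and $\gcd(a,b/a)=1$. $\Omega(n)$ is the number of prime factors of $n$ counted with multiplicity. For constants $A\ge1$, $B\ge1$, $\epsilon>0$, $\mathcal{M}_k(A,B,\epsilon)$ is the class of non-negative functions $F$ of $k$ positive integer variables such that $F(a_1b_1,\dots,a_kb_k)\le \min\big(A^{\Omega(a_1\cdots a_k)},B(a_1\cdots a_k)^{\epsilon}\big)F(b_1,\dots,b_k)$ for all positive integers $a_i,b_j$ with $\gcd(a_1\cdots a_k,b_1\cdots b_k)=1$. A function $F$ of $k$ variables is multiplicative if $F(a_1b_1,\dots,a_kb_k)=F(a_1,\dots,a_k)F(b_1,\dots,b_k)$ whenever $\gcd(a_1\cdots a_k,b_1\cdots b_k)=1$. *)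

theory Defs
  imports
    Complex_Main
    "HOL-Computational_Algebra.Computational_Algebra"
    "Subresultants.Resultant_Prelim"
begin

(* A function of k positive integer variables is modelled as a function on lists of
   naturals; only its values on pos_tuples k are relevant.
   In particular nothing is known about F at a list containing 0, so zeros of the
   polynomials have to be left out of sums over values of F at polynomials. *)
definition pos_tuples :: "nat \<Rightarrow> nat list set" where
  "pos_tuples k = {ns. length ns = k \<and> (\<forall>n \<in> set ns. 0 < n)}"

definition bigomega :: "nat \<Rightarrow> nat" where
  "bigomega n = size (prime_factorization n)"

definition class_M :: "nat \<Rightarrow> real \<Rightarrow> real \<Rightarrow> real \<Rightarrow> (nat list \<Rightarrow> real) set" where
  "class_M k A B \<epsilon> = {F.
     (\<forall>ns \<in> pos_tuples k. 0 \<le> F ns) \<and>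
     (\<forall>a \<in> pos_tuples k. \<forall>b \<in> pos_tuples k. coprime (prod_list a) (prod_list b) \<longrightarrow>
        F (map2 (*) a b)
          \<le> min (A ^ bigomega (prod_list a)) (B * real (prod_list a) powr \<epsilon>) * F b)}"

definition multiplicative_fun :: "nat \<Rightarrow> (nat list \<Rightarrow> real) \<Rightarrow> bool" where
  "multiplicative_fun k F \<longleftrightarrow>
     (\<forall>a \<in> pos_tuples k. \<forall>b \<in> pos_tuples k. coprime (prod_list a) (prod_list b) \<longrightarrow>
        F (map2 (*) a b) = F a * F b)"

definition rho :: "int poly \<Rightarrow> nat \<Rightarrow> nat" where
  "rho P n = card {m \<in> {0..<n}. int n dvd poly P (int m)}"

definition poly_norm :: "int poly \<Rightarrow> int" where
  "poly_norm P = (\<Sum>c\<leftarrow>coeffs P. \<bar>c\<bar>)"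

definition fixed_prime_divisor :: "nat \<Rightarrow> int poly \<Rightarrow> bool" where
  "fixed_prime_divisor p P \<longleftrightarrow> prime p \<and> (\<forall>n::nat. int p dvd poly P (int n))"

definition poly_discriminant :: "int poly \<Rightarrow> int" where
  "poly_discriminant P =
     (-1) ^ (degree P * (degree P - 1) div 2) * (resultant P (pderiv P) div lead_coeff P)"

(* The integer division in poly_discriminant is exact. *)
lemma lead_coeff_dvd_resultant_pderiv:
  fixes P :: "int poly"
  assumes "degree P > 0"
  shows "lead_coeff P dvd resultant P (pderiv P)"
proof -
  let ?S = "sylvester_mat P (pderiv P)" and ?N = "degree P + degree (pderiv P)"
  have deg: "degree (pderiv P) = degree P - 1"
    by (rule degree_pderiv)
  have "resultant P (pderiv P) = (\<Sum>i<?N. ?S $$ (i, 0) * cofactor ?S i 0)"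
    unfolding resultant_def
    by (rule laplace_expansion_column) (use assms in \<open>auto simp: sylvester_carrier_mat\<close>)
  moreover have "lead_coeff P dvd ?S $$ (i, 0)" if "i < ?N" for i
  proof -
    have "coeff (pderiv P) (degree P - 1) = of_nat (degree P) * lead_coeff P"
      using assms by (simp add: coeff_pderiv)
    then have "lead_coeff P dvd coeff (pderiv P) i" if "i = degree P - 1"
      using that by simp
    moreover have "i = degree P - 1" if "Suc i \<le> degree P" "\<not> i < degree P - 1"
      using that by linarith
    ultimately show ?thesis
      using that assms deg by (auto simp: sylvester_index_mat)
  qed
  ultimately show ?thesis
    by (auto intro!: dvd_sum)
qed

(* Unitary divisibility a || b.  For a = p^e with e > 0 it says that p has multiplicity
   exactly e in b; for a = 1 it holds for every b. *)
definition exact_dvd :: "int \<Rightarrow> int \<Rightarrow> bool" where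
  "exact_dvd a b \<longleftrightarrow> a dvd b \<and> gcd a (b div a) = 1"

(* The factor Delta_D; the exponent tuple nu = (0,...,0) is included in the inner sum. *)
definition Delta_factor :: "int poly list \<Rightarrow> (nat list \<Rightarrow> real) \<Rightarrow> int \<Rightarrow> real" where
  "Delta_factor Qs F D =
     (\<Prod>p | prime p \<and> int p dvd D.
        1 + (\<Sum>\<nu> | length \<nu> = length Qs \<and> (\<forall>j < length Qs. \<nu> ! j \<le> degree (Qs ! j)).
              F (map (\<lambda>e. p ^ e) \<nu>) *
              real (card {n \<in> {0..<p ^ (Max (set \<nu>) + 1)}. \<forall>j < length Qs.
                      exact_dvd (int p ^ (\<nu> ! j)) (poly (Qs ! j) (int n))})
                / real (p ^ (Max (set \<nu>) + 1))))"

end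

theory Submission
  imports
    Defs
    "HOL-Library.FuncSet"
    "HOL-Number_Theory.Cong"
    "HOL-Real_Asymp.Real_Asymp"
    "Subresultants.Subresultant_Gcd"
begin

text \<open>The method of Erdos, Shiu and Nair-Tenenbaum. Put \<open>Z = x powr (\<alpha> / 10)\<close> and order the
  prime factors of \<open>\<bar>Q n\<bar>\<close> by size: let \<open>q\<close> be the first prime at which the part of \<open>\<bar>Q n\<bar>\<close>
  composed of smaller primes and \<open>q\<close> exceeds \<open>Z\<close>, and let \<open>a \<le> Z\<close> be the part composed of the
  primes below \<open>q\<close>. If \<open>q ^ r \<le> Z < q ^ (r + 1)\<close>, the cofactor has \<open>O(r + 1)\<close> prime factors, so
  \<open>F\<close> is at most \<open>A powr O(r + 1)\<close> times its value at \<open>a\<close>. For fixed \<open>a\<close> the Brun-Hooley sieve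
  counts the admissible \<open>n\<close>. For large \<open>r\<close> either \<open>a > sqrt Z\<close> although all its primes are at most
  \<open>Z powr (1 / r)\<close>, and Rankin's device saves a factor \<open>exp (- K r / 2)\<close> with \<open>K\<close> at our disposal, or
  \<open>Q n\<close> is divisible by a high power of a small prime or by a large number composed of bounded
  primes; the latter \<open>n\<close> are so rare that \<open>F \<le> B \<bar>Q n\<bar> powr \<epsilon>\<close> suffices.

  All local factors are compared by one inequality for sums over \<open>a \<le> Z\<close>. For a prime \<open>p\<close>
  dividing \<open>D\<close> the exponents exceeding the degrees are negligible, because \<open>p ^ (d + 1)\<close> divides a
  primitive polynomial of degree \<open>d\<close> on a set of density at most \<open>d / p\<^sup>2\<close>; for the other primes
  at most one of the polynomials vanishes at a given residue.\<close>

section \<open>Chebyshev and Mertens estimates\<close>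

text \<open>The constants may depend on \<open>g\<close>, \<alpha>, \<delta>, \<open>A\<close>,
  \<open>B\<close> only, while \<open>D\<close> and the coefficients of \<open>Q\<close> are
  arbitrary. So densities of prime powers are bounded by the degree alone, and \<open>D\<close> is
  felt only through \<open>Delta_factor\<close>. The main term is a sum cut at \<open>x\<close>, not
  an Euler product, so local factors cannot be divided out; they are exchanged prime by prime under
  a fixed cut (\<open>choice_sum_compare\<close>). The deviations stay bounded in total because each
  is of size \<open>\<beta> * ln p / p + 1 / p ^ 2\<close> with \<open>\<beta> * ln p\<close>
  bounded. The bound on \<epsilon> stems from the exceptional integers: \<open>|Q n|\<close> is at
  most \<open>Z powr C1\<close> with \<open>C1 = 10 * (g + 1 / \<delta>) / \<alpha>\<close>, and the
  hypothesis says \<open>\<epsilon> * C1 <= 1 / (5 * g)\<close>. Then \<open>F\<close> is at most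
  \<open>B * Z powr (1 / (5 * g))\<close> on a set of density about
  \<open>Z powr (- 2 / (5 * g))\<close>; the remaining saving \<open>Z powr (- 1 / (5 * g))\<close>
  outweighs the product over \<open>p <= x\<close>, which is why a lower bound for that product with
  an arbitrarily small exponent is proved.\<close>

definition primes_le :: "real \<Rightarrow> nat set" where
  "primes_le x = {p. prime p \<and> real p \<le> x}"

lemma finite_primes_le [simp]: "finite (primes_le x)"
proof -
  have "primes_le x \<subseteq> {..nat \<lfloor>x\<rfloor>}"
    by (auto simp: primes_le_def le_nat_floor)
  then show ?thesis by (rule finite_subset) simp
qed

lemma prime_of_primes_le: "p \<in> primes_le x \<Longrightarrow> prime p"
  by (simp add: primes_le_def)

lemma ln_prime_div_nonneg: "prime p \<Longrightarrow> 0 \<le> ln (real p) / real p"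
  using prime_ge_1_nat[of p] by simp

lemma primes_le_empty: "x < 2 \<Longrightarrow> primes_le x = {}"
  by (auto simp: primes_le_def dest: prime_ge_2_nat)

lemma prod_primes_dvd:
  fixes m :: nat
  assumes "finite P" "\<And>p. p \<in> P \<Longrightarrow> prime p" "\<And>p. p \<in> P \<Longrightarrow> p dvd m"
  shows "\<Prod>P dvd m"
  using assms
proof (induction P rule: finite_induct)
  case (insert p P)
  have "coprime p (\<Prod>P)"
    by (rule prod_coprime_right) (use insert in \<open>auto intro!: primes_coprime\<close>)
  then show ?case
    using insert by (auto intro!: divides_mult)
qed simp

text \<open>All these primes divide the central binomial coefficient, which is at most
  \<open>2 ^ (2 * n)\<close>.\<close>

lemma prod_primes_dyadic_le:
  "\<Prod>{p::nat. prime p \<and> n < p \<and> p \<le> 2 * n} \<le> 4 ^ n"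
proof -
  have fin: "finite {p::nat. prime p \<and> n < p \<and> p \<le> 2 * n}"
    by (rule finite_subset[of _ "{..2 * n}"]) auto
  have "p dvd (2 * n choose n)" if "prime p" "n < p" "p \<le> 2 * n" for p
  proof -
    have "fact n * fact n * (2 * n choose n) = (fact (2 * n) :: nat)"
      using binomial_fact_lemma[of n "2 * n"] by (simp add: mult_2)
    moreover have "p dvd fact (2 * n)" "\<not> p dvd fact n"
      using that by (auto simp: prime_dvd_fact_iff)
    ultimately show ?thesis
      using \<open>prime p\<close> by (metis prime_dvd_mult_iff)
  qed
  then have "\<Prod>{p::nat. prime p \<and> n < p \<and> p \<le> 2 * n} dvd (2 * n choose n)"
    by (intro prod_primes_dvd fin) auto
  then have "\<Prod>{p::nat. prime p \<and> n < p \<and> p \<le> 2 * n} \<le> (2 * n choose n)"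
    by (rule dvd_imp_le) (rule zero_less_binomial, rule le_add1[of n n, folded mult_2])
  also have "\<dots> \<le> 2 ^ (2 * n)"
    by (rule binomial_le_pow2)
  also have "\<dots> = (2 ^ 2) ^ n"
    by (rule power_mult)
  finally show ?thesis by (simp only: power2_eq_square) simp
qed

lemma sum_ln_prime_dyadic_le:
  assumes "n \<ge> 1"
  shows "(\<Sum>p | prime p \<and> n < p \<and> p \<le> 2 * n. ln (real p) / real p) \<le> 2 * ln 2"
proof -
  let ?P = "{p::nat. prime p \<and> n < p \<and> p \<le> 2 * n}"
  have fin: "finite ?P"
    by (rule finite_subset[of _ "{..2 * n}"]) auto
  have "(\<Sum>p\<in>?P. ln (real p) / real p) \<le> (\<Sum>p\<in>?P. ln (real p) / real n)"
    using assms by (intro sum_mono divide_left_mono) (auto intro!: ln_ge_zero)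
  also have "\<dots> = ln (real (\<Prod>?P)) / real n"
    by (subst of_nat_prod, subst ln_prod[OF fin]) (auto simp: prime_gt_0_nat sum_divide_distrib)
  also have "\<dots> \<le> ln (4 ^ n) / real n"
  proof (intro divide_right_mono)
    have "real (\<Prod>?P) \<le> real (4 ^ n)"
      by (rule of_nat_mono) (rule prod_primes_dyadic_le)
    moreover have "real (\<Prod>?P) > 0"
      using fin by (auto simp: of_nat_prod intro!: prod_pos prime_gt_0_nat)
    ultimately show "ln (real (\<Prod>?P)) \<le> ln (4 ^ n)"
      by (simp del: of_nat_prod)
  qed simp
  also have "\<dots> = 2 * ln 2"
    using assms ln_realpow[of 2 2] by (simp add: ln_realpow)
  finally show ?thesis .
qed

text \<open>Each dyadic block contributes a bounded amount: the upper half of Mertens' first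
  theorem, from which the later bounds for sums of \<open>1 / p\<close> are drawn.\<close>

lemma sum_ln_prime_pow2_le:
  "(\<Sum>p\<in>primes_le (2 ^ t). ln (real p) / real p) \<le> 2 * ln 2 * real t"
proof (induction t)
  case 0
  show ?case by (simp add: primes_le_empty)
next
  case (Suc t)
  let ?P = "{p::nat. prime p \<and> 2 ^ t < p \<and> p \<le> 2 * 2 ^ t}"
  have fin: "finite ?P"
    by (rule finite_subset[of _ "{..2 * 2 ^ t}"]) auto
  have pow: "real p \<le> 2 ^ n \<longleftrightarrow> p \<le> 2 ^ n" for p n
    using of_nat_le_iff[of p "2 ^ n", where ?'a = real] by simp
  have "2 ^ t \<le> (2 ^ Suc t :: nat)" by simp
  then have "primes_le (2 ^ Suc t) = primes_le (2 ^ t) \<union> ?P"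
    unfolding primes_le_def pow by (auto simp del: power_Suc) (auto simp: not_le)
  moreover have "primes_le (2 ^ t) \<inter> ?P = {}"
    unfolding primes_le_def pow by auto
  ultimately have "(\<Sum>p\<in>primes_le (2 ^ Suc t). ln (real p) / real p)
      = (\<Sum>p\<in>primes_le (2 ^ t). ln (real p) / real p) + (\<Sum>p\<in>?P. ln (real p) / real p)"
    using fin by (simp add: sum.union_disjoint)
  also have "\<dots> \<le> 2 * ln 2 * real t + 2 * ln 2"
    using sum_ln_prime_dyadic_le[of "2 ^ t"] Suc.IH by (intro add_mono) auto
  finally show ?case by (simp add: algebra_simps)
qed

lemma primes_le_mono: "x \<le> y \<Longrightarrow> primes_le x \<subseteq> primes_le y"
  by (auto simp: primes_le_def)

lemma sum_ln_prime_le: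
  assumes "x \<ge> 1"
  shows "(\<Sum>p\<in>primes_le x. ln (real p) / real p) \<le> 4 * ln x"
proof (cases "x < 2")
  case True
  then show ?thesis using assms by (simp add: primes_le_empty)
next
  case False
  define t where "t = nat \<lfloor>log 2 x\<rfloor>"
  have "log 2 x \<ge> 1"
    using False by simp
  then have t: "t \<ge> 1" "real t \<le> log 2 x" "log 2 x \<le> real (t + 1)"
    unfolding t_def by linarith+
  have "x = 2 powr log 2 x"
    using False by simp
  also have "\<dots> \<le> 2 powr real (t + 1)"
    using t by (intro powr_mono) auto
  finally have "x \<le> 2 ^ (t + 1)"
    by (simp only: powr_realpow)
  then have "(\<Sum>p\<in>primes_le x. ln (real p) / real p) \<le> (\<Sum>p\<in>primes_le (2 ^ (t + 1)). ln (real p) / real p)"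
    by (intro sum_mono2 primes_le_mono finite_primes_le ln_prime_div_nonneg)
       (auto dest: prime_of_primes_le)
  also have "\<dots> \<le> 2 * ln 2 * real (t + 1)"
    by (rule sum_ln_prime_pow2_le)
  also have "\<dots> \<le> 2 * ln 2 * (2 * log 2 x)"
    using t by (intro mult_left_mono) auto
  also have "\<dots> = 4 * ln x"
    by (simp add: log_def)
  finally show ?thesis .
qed

text \<open>Each term is weighted by \<open>ln p / ln z >= 1\<close>. The true order is logarithmic
  in \<open>ln x / ln z\<close>; the linear bound is enough because that ratio is either bounded, or
  a multiple of \<open>r + 1\<close> absorbed by \<open>U\<close>, or scaled down by a large
  \<open>t\<close>.\<close>

lemma sum_inverse_prime_le:
  assumes "z > 1" "x \<ge> 1"
  shows "(\<Sum>p | p \<in> primes_le x \<and> z < real p. 1 / real p) \<le> 4 * ln x / ln z"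
proof -
  have "(\<Sum>p | p \<in> primes_le x \<and> z < real p. 1 / real p)
      \<le> (\<Sum>p | p \<in> primes_le x \<and> z < real p. (ln (real p) / real p) / ln z)"
  proof (intro sum_mono)
    fix p assume "p \<in> {p \<in> primes_le x. z < real p}"
    then have "ln z \<le> ln (real p)" "real p > 0" "ln z > 0"
      using assms by auto
    then show "1 / real p \<le> ln (real p) / real p / ln z"
      by (simp add: field_simps)
  qed
  also have "\<dots> \<le> (\<Sum>p\<in>primes_le x. (ln (real p) / real p) / ln z)"
    using assms by (intro sum_mono2 finite_primes_le divide_nonneg_nonneg ln_prime_div_nonneg)
      (auto dest: prime_of_primes_le)
  also have "\<dots> = (\<Sum>p\<in>primes_le x. ln (real p) / real p) / ln z"
    by (simp add: sum_divide_distrib)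
  also have "\<dots> \<le> 4 * ln x / ln z"
    using assms by (intro divide_right_mono sum_ln_prime_le) auto
  finally show ?thesis .
qed

lemma sum_inverse_square_le:
  assumes "finite P" "\<And>p. p \<in> P \<Longrightarrow> p \<ge> 2"
  shows "(\<Sum>p\<in>P. 1 / (real p)\<^sup>2) \<le> 1"
proof -
  have *: "(\<Sum>n\<in>{2..N}. 1 / (real n)\<^sup>2) \<le> 1 - 1 / real N" if "N \<ge> 1" for N
    using that
  proof (induction N rule: dec_induct)
    case (step N)
    have "(\<Sum>n\<in>{2..Suc N}. 1 / (real n)\<^sup>2) = (\<Sum>n\<in>{2..N}. 1 / (real n)\<^sup>2) + 1 / (real (Suc N))\<^sup>2"
      using step by simp
    also have "\<dots> \<le> 1 - 1 / real N + 1 / (real (Suc N))\<^sup>2"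
      using step by simp
    also have "1 / (real (Suc N))\<^sup>2 \<le> 1 / (real N * real (Suc N))"
      using step by (intro divide_left_mono) (auto simp: power2_eq_square)
    also have "1 / (real N * real (Suc N)) = 1 / real N - 1 / real (Suc N)"
      using step by (simp add: divide_simps)
    finally show ?case by simp
  qed simp
  obtain N where N: "\<forall>p\<in>P. p \<le> N"
    using assms(1) finite_nat_set_iff_bounded_le by blast
  have "(\<Sum>p\<in>P. 1 / (real p)\<^sup>2) \<le> (\<Sum>n\<in>{2..Suc N}. 1 / (real n)\<^sup>2)"
    using N assms by (intro sum_mono2) fastforce+
  also have "\<dots> \<le> 1"
    by (rule order_trans[OF *]) auto
  finally show ?thesis .
qed

section \<open>The sieve of Brun and Hooley\<close>

definition trunc_sum :: "('a \<Rightarrow> real) \<Rightarrow> nat \<Rightarrow> 'a set \<Rightarrow> real" where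
  "trunc_sum u m P = (\<Sum>d | d \<subseteq> P \<and> card d \<le> m. \<Prod>p\<in>d. u p)"

lemma trunc_sum_0:
  assumes "finite P"
  shows "trunc_sum u 0 P = 1"
proof -
  have "{d. d \<subseteq> P \<and> card d \<le> 0} = {{}}"
    using assms by (auto dest: finite_subset)
  then show ?thesis by (simp add: trunc_sum_def)
qed

lemma trunc_sum_empty [simp]: "trunc_sum u m {} = 1"
proof -
  have *: "{d. d \<subseteq> {} \<and> card d \<le> m} = {{}}" by auto
  show ?thesis unfolding trunc_sum_def * by simp
qed

lemma trunc_sum_insert:
  assumes "finite P" "p \<notin> P"
  shows "trunc_sum u (Suc m) (insert p P) = trunc_sum u (Suc m) P + u p * trunc_sum u m P"
proof -
  let ?A = "{d. d \<subseteq> P \<and> card d \<le> Suc m}" and ?B = "{d. d \<subseteq> P \<and> card d \<le> m}"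
  have fin: "finite ?A" "finite ?B"
    using assms by (auto intro: finite_subset[of _ "Pow P"])
  have fd: "finite d" if "d \<subseteq> P" for d
    using that assms finite_subset by blast
  have "{d. d \<subseteq> insert p P \<and> card d \<le> Suc m} = ?A \<union> insert p ` ?B" (is "?L = _")
  proof (intro Set.set_eqI iffI)
    fix d assume d: "d \<in> ?L"
    show "d \<in> ?A \<union> insert p ` ?B"
    proof (cases "p \<in> d")
      case True
      then have "d - {p} \<in> ?B" "d = insert p (d - {p})"
        using d fd[of "d - {p}"] by (auto simp: card_Diff_singleton)
      then show ?thesis by blast
    qed (use d in auto)
  next
    fix d assume "d \<in> ?A \<union> insert p ` ?B"
    then show "d \<in> ?L"
      using fd assms by (auto simp: card_insert_if)
  qed
  moreover have "?A \<inter> insert p ` ?B = {}"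
    using assms by auto
  moreover have "inj_on (insert p) ?B"
    using assms by (auto simp: inj_on_def)
  ultimately have "trunc_sum u (Suc m) (insert p P)
      = trunc_sum u (Suc m) P + (\<Sum>d\<in>?B. \<Prod>q\<in>insert p d. u q)"
    using fin by (simp add: trunc_sum_def sum.union_disjoint sum.reindex o_def)
  also have "(\<Sum>d\<in>?B. \<Prod>q\<in>insert p d. u q) = (\<Sum>d\<in>?B. u p * (\<Prod>q\<in>d. u q))"
    using assms fd by (intro sum.cong refl prod.insert) auto
  finally show ?thesis
    by (simp add: trunc_sum_def sum_distrib_left)
qed

text \<open>Truncated inclusion-exclusion with Rankin's bound for the remainder: writing
  \<open>R m P\<close> for the signed remainder, adding a point \<open>p\<close> to \<open>P\<close> changes
  \<open>R (m + 1)\<close> by \<open>w p * R m\<close>.\<close>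

lemma bonferroni:
  fixes w :: "'a \<Rightarrow> real"
  assumes "finite P" "\<And>p. p \<in> P \<Longrightarrow> 0 \<le> w p" "\<And>p. p \<in> P \<Longrightarrow> w p \<le> 1"
  shows "0 \<le> (-1) ^ m * (trunc_sum (\<lambda>p. - w p) m P - (\<Prod>p\<in>P. 1 - w p))
    \<and> (-1) ^ m * (trunc_sum (\<lambda>p. - w p) m P - (\<Prod>p\<in>P. 1 - w p)) \<le> (1/2) ^ Suc m * (\<Prod>p\<in>P. 1 + 2 * w p)"
  using assms
proof (induction P arbitrary: m rule: finite_induct)
  case empty
  then show ?case by simp
next
  case (insert p P)
  let ?V = "\<lambda>P. \<Prod>p\<in>P. 1 - w p" and ?W = "\<lambda>P. \<Prod>p\<in>P. 1 + 2 * w p"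
  let ?R = "\<lambda>m P. (-1) ^ m * (trunc_sum (\<lambda>p. - w p) m P - ?V P)"
  have IH: "0 \<le> ?R m P \<and> ?R m P \<le> (1/2) ^ Suc m * ?W P" for m
    using insert by auto
  have wp: "0 \<le> w p" "w p \<le> 1" using insert by auto
  have V: "?V (insert p P) = (1 - w p) * ?V P" and W: "?W (insert p P) = (1 + 2 * w p) * ?W P"
    using insert by auto
  have V01: "0 \<le> ?V P" "?V P \<le> 1"
    using insert by (auto intro!: prod_nonneg prod_le_1)
  have W1: "1 \<le> ?W P"
    using insert by (intro prod_ge_1) auto
  show ?case
  proof (cases m)
    case 0
    have "?R 0 (insert p P) = ?R 0 P + w p * ?V P"
      using insert V by (simp add: trunc_sum_0 algebra_simps)
    moreover have "w p * ?V P \<le> w p * ?W P" "0 \<le> w p * ?V P"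
      using wp V01 W1 by (auto intro!: mult_left_mono)
    moreover have "(1/2) ^ Suc 0 * ?W (insert p P) = (1/2) ^ Suc 0 * ?W P + w p * ?W P"
      unfolding W by (simp add: algebra_simps)
    ultimately show ?thesis
      using IH[of 0] unfolding 0 by linarith
  next
    case (Suc n)
    have "?R (Suc n) (insert p P) = ?R (Suc n) P + w p * ?R n P"
      using insert V by (simp add: trunc_sum_insert algebra_simps)
    moreover have "w p * ?R n P \<le> w p * ((1/2) ^ Suc n * ?W P)" "0 \<le> w p * ?R n P"
      using mult_left_mono[OF conjunct2[OF IH[of n]] wp(1)] mult_nonneg_nonneg[OF wp(1) conjunct1[OF IH[of n]]]
      by auto
    moreover have "(1/2) ^ Suc (Suc n) * ?W (insert p P)
        = (1/2) ^ Suc (Suc n) * ?W P + w p * ((1/2) ^ Suc n * ?W P)"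
      unfolding W by (simp add: algebra_simps)
    ultimately show ?thesis
      using IH[of "Suc n"] unfolding Suc by linarith
  qed
qed

text \<open>Expanding the power produces every product of at most \<open>m\<close> distinct
  \<open>u p\<close>. This controls the number of moduli in the remainder of the sieve, weighted by
  their numbers of residues.\<close>

lemma trunc_sum_le_power:
  fixes u :: "'a \<Rightarrow> real"
  assumes "finite P" "\<And>p. p \<in> P \<Longrightarrow> 0 \<le> u p"
  shows "trunc_sum u m P \<le> (1 + sum u P) ^ m"
  using assms
proof (induction P arbitrary: m rule: finite_induct)
  case (insert p P)
  let ?s = "1 + sum u P"
  have s: "?s \<ge> 1" using insert by (auto intro!: sum_nonneg)
  have up: "u p \<ge> 0" using insert by auto
  show ?case
  proof (cases m)
    case (Suc n)
    have IH: "trunc_sum u i P \<le> ?s ^ i" for i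
      using insert by auto
    have "trunc_sum u m (insert p P) \<le> ?s ^ Suc n + u p * ?s ^ n"
      unfolding Suc trunc_sum_insert[OF insert.hyps(1,2)] by (intro add_mono mult_left_mono IH up)
    also have "\<dots> = (?s + u p) * ?s ^ n"
      by (simp add: algebra_simps)
    also have "\<dots> \<le> (?s + u p) * (?s + u p) ^ n"
      using s up by (intro mult_left_mono power_mono) auto
    finally show ?thesis
      using insert Suc by (simp add: algebra_simps)
  qed (use insert in \<open>simp add: trunc_sum_0\<close>)
qed simp

lemma trunc_sum_neg_le:
  fixes w :: "'a \<Rightarrow> real"
  assumes "finite P" "\<And>p. p \<in> P \<Longrightarrow> 0 \<le> w p" "\<And>p. p \<in> P \<Longrightarrow> w p \<le> 1"
  shows "trunc_sum (\<lambda>p. - w p) (2 * b) P \<le> (\<Prod>p\<in>P. 1 - w p) + (1/2) ^ Suc (2 * b) * (\<Prod>p\<in>P. 1 + 2 * w p)"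
    and "(\<Prod>p\<in>P. 1 - w p) \<le> trunc_sum (\<lambda>p. - w p) (2 * b) P"
  using bonferroni[of P w "2 * b"] assms by auto

text \<open>Inclusion-exclusion is truncated separately on each block \<open>P j\<close>.\<close>

lemma brun_hooley:
  fixes X :: "'n set" and P :: "nat \<Rightarrow> 'a set" and u w :: "'a \<Rightarrow> real"
  assumes X: "finite X" and P: "\<And>j. j < t \<Longrightarrow> finite (P j)"
    and disj: "\<And>i j. i < t \<Longrightarrow> j < t \<Longrightarrow> i \<noteq> j \<Longrightarrow> P i \<inter> P j = {}"
    and count: "\<And>E. E \<subseteq> (\<Union>j<t. P j) \<Longrightarrow>
        \<bar>real (card {n \<in> X. \<forall>p\<in>E. bad n p}) - M * (\<Prod>p\<in>E. w p)\<bar> \<le> c * (\<Prod>p\<in>E. u p)"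
  shows "real (card {n \<in> X. \<forall>p\<in>(\<Union>j<t. P j). \<not> bad n p})
    \<le> M * (\<Prod>j<t. trunc_sum (\<lambda>p. - w p) (2 * b j) (P j)) + c * (\<Prod>j<t. trunc_sum u (2 * b j) (P j))"
proof -
  define B where "B j = {d. d \<subseteq> P j \<and> card d \<le> 2 * b j}" for j
  \<comment> \<open>A small subset is chosen in every block and \<open>U h\<close> collects the
    chosen points, so that a product of truncated sums becomes one sum over
    \<open>H\<close>.\<close>
  define H where "H = PiE {..<t} B"
  define U where "U h = (\<Union>j<t. h j)" for h :: "nat \<Rightarrow> 'a set"
  have finB: "finite (B j)" if "j < t" for j
    unfolding B_def using P[OF that] by (auto intro: finite_subset[of _ "Pow (P j)"])
  have finH: "finite H"
    unfolding H_def by (intro finite_PiE) (use finB in auto)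
  have hB: "h j \<subseteq> P j" if "h \<in> H" "j < t" for h j
    using that by (auto simp: H_def B_def PiE_iff)
  have finh: "finite (h j)" if "h \<in> H" "j < t" for h j
    using hB[OF that] P[OF that(2)] finite_subset by blast
  have prodU: "(\<Prod>p\<in>U h. v p) = (\<Prod>j<t. \<Prod>p\<in>h j. v p)" if h: "h \<in> H" for h and v :: "'a \<Rightarrow> real"
    unfolding U_def using hB[OF h] finh[OF h] disj by (intro prod.UNION_disjoint) blast+
  have expand: "(\<Prod>j<t. trunc_sum v (2 * b j) (P j)) = (\<Sum>h\<in>H. \<Prod>p\<in>U h. v p)" for v
  proof -
    have "(\<Prod>j<t. trunc_sum v (2 * b j) (P j)) = (\<Prod>j<t. \<Sum>d\<in>B j. \<Prod>p\<in>d. v p)"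
      by (simp add: trunc_sum_def B_def)
    also have "\<dots> = (\<Sum>h\<in>H. \<Prod>j<t. \<Prod>p\<in>h j. v p)"
      unfolding H_def by (rule prod_sum_PiE) (use finB in auto)
    also have "\<dots> = (\<Sum>h\<in>H. \<Prod>p\<in>U h. v p)"
      by (intro sum.cong refl) (simp add: prodU)
    finally show ?thesis .
  qed
  have finU: "finite (U h)" if "h \<in> H" for h
    using finh[OF that] by (auto simp: U_def)
  define \<beta> where "\<beta> n p = (if bad n p then 1 else 0 :: real)" for n p
  have "real (card {n \<in> X. \<forall>p\<in>(\<Union>j<t. P j). \<not> bad n p})
      = (\<Sum>n\<in>X. if \<forall>p\<in>(\<Union>j<t. P j). \<not> bad n p then 1 else 0)"
    using X by (simp flip: sum.inter_filter)
  also have "\<dots> \<le> (\<Sum>n\<in>X. \<Prod>j<t. trunc_sum (\<lambda>p. - \<beta> n p) (2 * b j) (P j))"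
  proof (intro sum_mono)
    fix n assume "n \<in> X"
    \<comment> \<open>Truncation at an even level bounds each block from above, and the exact block
      products are nonnegative, so these upper bounds may be multiplied.\<close>
    have "(\<Prod>j<t. \<Prod>p\<in>P j. 1 - \<beta> n p) \<le> (\<Prod>j<t. trunc_sum (\<lambda>p. - \<beta> n p) (2 * b j) (P j))"
      by (intro prod_mono conjI prod_nonneg trunc_sum_neg_le(2)) (auto simp: \<beta>_def P)
    moreover have "(if \<forall>p\<in>(\<Union>j<t. P j). \<not> bad n p then 1 else 0) \<le> (\<Prod>j<t. \<Prod>p\<in>P j. 1 - \<beta> n p)"
    proof (cases "\<forall>p\<in>(\<Union>j<t. P j). \<not> bad n p")
      case True
      then have "(\<Prod>j<t. \<Prod>p\<in>P j. 1 - \<beta> n p) = (\<Prod>j<t. \<Prod>p\<in>P j. 1)"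
        by (intro prod.cong refl) (auto simp: \<beta>_def)
      then show ?thesis using True by simp
    qed (auto intro!: prod_nonneg simp: \<beta>_def)
    ultimately show "(if \<forall>p\<in>(\<Union>j<t. P j). \<not> bad n p then 1 else 0)
        \<le> (\<Prod>j<t. trunc_sum (\<lambda>p. - \<beta> n p) (2 * b j) (P j))"
      by linarith
  qed
  also have "\<dots> = (\<Sum>h\<in>H. \<Sum>n\<in>X. \<Prod>p\<in>U h. - \<beta> n p)"
    unfolding expand by (rule sum.swap)
  also have "\<dots> \<le> (\<Sum>h\<in>H. M * (\<Prod>p\<in>U h. - w p) + c * (\<Prod>p\<in>U h. u p))"
  proof (intro sum_mono)
    fix h assume h: "h \<in> H"
    have sgn: "(\<Prod>p\<in>U h. - v p) = (-1) ^ card (U h) * (\<Prod>p\<in>U h. v p)" for v :: "'a \<Rightarrow> real"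
      by (rule prod_uminus)
    have "(\<Prod>p\<in>U h. \<beta> n p) = (if \<forall>p\<in>U h. bad n p then 1 else 0)" for n
      using finU[OF h] by (auto simp: \<beta>_def)
    then have cardU: "(\<Sum>n\<in>X. \<Prod>p\<in>U h. \<beta> n p) = real (card {n \<in> X. \<forall>p\<in>U h. bad n p})"
      using X by (simp flip: sum.inter_filter)
    have "(\<Sum>n\<in>X. \<Prod>p\<in>U h. - \<beta> n p) = (-1) ^ card (U h) * real (card {n \<in> X. \<forall>p\<in>U h. bad n p})"
      unfolding sgn sum_distrib_left[symmetric] cardU ..
    moreover have "\<bar>real (card {n \<in> X. \<forall>p\<in>U h. bad n p}) - M * (\<Prod>p\<in>U h. w p)\<bar> \<le> c * (\<Prod>p\<in>U h. u p)"
      by (rule count) (use hB[OF h] in \<open>auto simp: U_def\<close>)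
    ultimately show "(\<Sum>n\<in>X. \<Prod>p\<in>U h. - \<beta> n p) \<le> M * (\<Prod>p\<in>U h. - w p) + c * (\<Prod>p\<in>U h. u p)"
      unfolding sgn by (cases "even (card (U h))") (auto simp: abs_le_iff)
  qed
  also have "\<dots> = M * (\<Prod>j<t. trunc_sum (\<lambda>p. - w p) (2 * b j) (P j)) + c * (\<Prod>j<t. trunc_sum u (2 * b j) (P j))"
    by (simp add: expand sum.distrib sum_distrib_left)
  finally show ?thesis .
qed

section \<open>Lower bounds for products of sieve factors, and the sieve with geometric
  blocks\<close>

lemma exp_minus_double_le:
  fixes t :: real
  assumes "0 \<le> t" "t \<le> 1/2"
  shows "exp (- (2 * t)) \<le> 1 - t"
proof -
  have "- t - 2 * t\<^sup>2 \<le> ln (1 - t)"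
    using assms by (intro ln_one_minus_pos_lower_bound) auto
  moreover have "t * t \<le> t * (1/2)"
    using assms by (intro mult_left_mono) auto
  ultimately have "- (2 * t) \<le> ln (1 - t)"
    by (simp add: power2_eq_square)
  then show ?thesis
    using assms by (simp add: ln_ge_iff)
qed

text \<open>For \<open>p < 2 * g\<close> the quotient \<open>u p / p\<close> may be close to 1; then
  \<open>u p <= p - 1\<close> still leaves \<open>1 / p\<close>, and fewer than \<open>2 * g\<close>
  factors are concerned. Beyond that \<open>u p / p <= 1/2\<close>, and the factor is compared with
  an exponential.\<close>

lemma prod_one_minus_ge:
  fixes u :: "nat \<Rightarrow> real"
  assumes "finite P" "\<And>p. p \<in> P \<Longrightarrow> p \<ge> 2" "g \<ge> 1"
    and u: "\<And>p. p \<in> P \<Longrightarrow> 0 \<le> u p" "\<And>p. p \<in> P \<Longrightarrow> u p \<le> real g" "\<And>p. p \<in> P \<Longrightarrow> u p \<le> real p - 1"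
  shows "(1 / (2 * real g)) ^ (2 * g) * exp (- 2 * real g * (\<Sum>p\<in>P. 1 / real p)) \<le> (\<Prod>p\<in>P. 1 - u p / real p)"
proof -
  let ?f = "\<lambda>p. if p < 2 * g then 1 / (2 * real g) else 1"
  have le: "?f p * exp (- 2 * real g * (1 / real p)) \<le> 1 - u p / real p" if p: "p \<in> P" for p
  proof (cases "p < 2 * g")
    case True
    have "?f p * exp (- 2 * real g * (1 / real p)) \<le> ?f p * 1"
      by (intro mult_left_mono) auto
    also have "\<dots> \<le> 1 / real p"
      using True assms(2)[OF p] by (auto simp: field_simps)
    also have "\<dots> \<le> 1 - u p / real p"
      using u[OF p] assms(2)[OF p] by (simp add: field_simps)
    finally show ?thesis .
  next
    case False
    have "exp (- 2 * real g * (1 / real p)) \<le> exp (- (2 * (u p / real p)))"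
      using u[OF p] assms(2)[OF p] by (simp add: field_simps)
    also have "\<dots> \<le> 1 - u p / real p"
      using False u[OF p] assms(2)[OF p] by (intro exp_minus_double_le) (auto simp: field_simps)
    finally show ?thesis using False by simp
  qed
  have "(1 / (2 * real g)) ^ (2 * g) \<le> (1 / (2 * real g)) ^ card {p \<in> P. p < 2 * g}"
  proof (rule power_decreasing)
    have "card {p \<in> P. p < 2 * g} \<le> card {..<2 * g}"
      by (intro card_mono) auto
    then show "card {p \<in> P. p < 2 * g} \<le> 2 * g" by simp
  qed (use assms in auto)
  also have "\<dots> = (\<Prod>p\<in>P. ?f p)"
    using assms(1) by (simp flip: prod.inter_filter)
  finally have "(1 / (2 * real g)) ^ (2 * g) * exp (- 2 * real g * (\<Sum>p\<in>P. 1 / real p))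
      \<le> (\<Prod>p\<in>P. ?f p) * (\<Prod>p\<in>P. exp (- 2 * real g * (1 / real p)))"
    using assms(1) by (simp only: sum_distrib_left exp_sum) (intro mult_right_mono prod_nonneg, auto)
  also have "\<dots> = (\<Prod>p\<in>P. ?f p * exp (- 2 * real g * (1 / real p)))"
    by (simp add: prod.distrib)
  also have "\<dots> \<le> (\<Prod>p\<in>P. 1 - u p / real p)"
    by (intro prod_mono conjI le) auto
  finally show ?thesis .
qed

lemma sum_div_power2_le: "(\<Sum>j<t. real j / 2 ^ j) \<le> 2"
proof -
  have "(\<Sum>j<t. real j / 2 ^ j) = 2 - 2 * (real t + 1) / 2 ^ t"
  proof (induction t)
    case (Suc t)
    have "(\<Sum>j<Suc t. real j / 2 ^ j) = 2 - 2 * (real t + 1) / 2 ^ t + real t / 2 ^ t"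
      by (simp only: sum.lessThan_Suc Suc)
    also have "\<dots> = 2 - 2 * (real (Suc t) + 1) / 2 ^ Suc t"
      by (simp add: divide_simps)
    finally show ?case .
  qed simp
  then show ?thesis by simp
qed

text \<open>The number inside the outer exponential bounds, for one block of
  \<open>upper_bound_sieve\<close>, the ratio of the product of \<open>1 + 2 * w p\<close> (at most
  \<open>exp (16 * g)\<close>) to the product of \<open>1 - w p\<close>. The outer exponential comes
  from summing the relative errors of all blocks.\<close>

definition sieve_const :: "nat \<Rightarrow> real" where
  "sieve_const g = exp ((2 * real g) ^ (2 * g) * exp (32 * real g))"

lemma sieve_const_ge_1: "sieve_const g \<ge> 1"
  by (simp add: sieve_const_def)

text \<open>Block \<open>j\<close> consists of the primes between
  \<open>z powr (1 / 2 ^ Suc j)\<close> and \<open>z powr (1 / 2 ^ j)\<close>, truncated at level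
  \<open>2 * j\<close>. Its sum of \<open>1 / p\<close> is bounded, so its relative error is a
  multiple of \<open>(1/2) ^ Suc j\<close> and all errors together cost a constant factor. The
  moduli stay below a fixed power of \<open>z\<close> because the sum of \<open>j / 2 ^ j\<close>
  converges. Block 0 is not sieved at all, which again costs only a constant.\<close>

lemma upper_bound_sieve:
  fixes X :: "'n set" and u :: "nat \<Rightarrow> real"
  assumes X: "finite X" and z: "z > 1" and P: "P \<subseteq> primes_le z" and g: "g \<ge> 1"
    and u: "\<And>p. p \<in> P \<Longrightarrow> 0 \<le> u p" "\<And>p. p \<in> P \<Longrightarrow> u p \<le> real g" "\<And>p. p \<in> P \<Longrightarrow> u p \<le> real p - 1"
    and M: "M \<ge> 0" and c: "c \<ge> 0"
    and count: "\<And>E. E \<subseteq> P \<Longrightarrow>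
        \<bar>real (card {n \<in> X. \<forall>p\<in>E. bad n p}) - M * (\<Prod>p\<in>E. u p / real p)\<bar> \<le> c * (\<Prod>p\<in>E. u p)"
  shows "real (card {n \<in> X. \<forall>p\<in>P. \<not> bad n p})
    \<le> sieve_const g * M * (\<Prod>p\<in>P. 1 - u p / real p) + c * z powr (4 * (real g + 1))"
proof -
  define w where "w p = u p / real p" for p
  define zz where "zz j = z powr (1 / 2 ^ j)" for j :: nat
  have finP: "finite P"
    using P finite_subset finite_primes_le by blast
  have p2: "p \<ge> 2" if "p \<in> P" for p
    using that P by (auto simp: primes_le_def prime_ge_2_nat)
  have w01: "0 \<le> w p" "w p \<le> 1" if "p \<in> P" for p
    using u[OF that] p2[OF that] by (auto simp: w_def field_simps)
  have zz1: "zz j > 1" for j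
    using z by (simp add: zz_def)
  have lnzz: "ln (zz j) = ln z / 2 ^ j" for j
    using z by (simp add: zz_def ln_powr)
  obtain t where t: "zz t < 2"
  proof -
    obtain t where "ln z / ln 2 < 2 ^ t"
      using real_arch_pow[of 2] by auto
    then have "ln (zz t) < ln 2"
      by (simp add: lnzz field_simps)
    then have "zz t < 2"
      using zz1[of t] by simp
    then show ?thesis by (rule that)
  qed
  define B where "B j = {p \<in> P. zz (Suc j) < real p \<and> real p \<le> zz j}" for j
  have zz_mono: "zz j \<le> zz i" if "i \<le> j" for i j
    unfolding zz_def using z that by (intro powr_mono divide_left_mono power_increasing) auto
  have finB: "finite (B j)" for j
    using finP by (simp add: B_def)
  have BP: "B j \<subseteq> P" for j
    by (auto simp: B_def)
  note BPD = subsetD[OF BP]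
  have disj': "B i \<inter> B j = {}" if "i < j" for i j
    using zz_mono[of "Suc i" j] that by (auto simp: B_def)
  have disj: "B i \<inter> B j = {}" if "i \<noteq> j" for i j
    using disj'[of i j] disj'[of j i] that by (cases i j rule: linorder_cases) auto
  have UB: "(\<Union>j<t. B j) = P"
  proof (intro equalityI subsetI)
    fix p assume p: "p \<in> P"
    define j where "j = (LEAST i. zz i < real p)"
    have ex: "zz t < real p" using t p2[OF p] by simp
    have j: "zz j < real p" "j \<le> t"
      unfolding j_def using ex by (auto intro: LeastI Least_le)
    have "zz 0 \<ge> real p"
      using p P z by (auto simp: zz_def primes_le_def)
    then obtain i where i: "j = Suc i"
      using j by (cases j) auto
    have "\<not> zz i < real p"
      using not_less_Least[of i "\<lambda>i. zz i < real p"] i by (simp add: j_def)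
    then show "p \<in> (\<Union>j<t. B j)"
      using i j p by (auto simp: B_def)
  qed (use BP in auto)
  have sumw: "(\<Sum>p\<in>B j. 1 / real p) \<le> 8" for j
  proof -
    have "(\<Sum>p\<in>B j. 1 / real p) \<le> (\<Sum>p | p \<in> primes_le (zz j) \<and> zz (Suc j) < real p. 1 / real p)"
      using P by (intro sum_mono2) (auto simp: B_def primes_le_def intro: finite_subset[OF _ finite_primes_le[of "zz j"]])
    also have "\<dots> \<le> 4 * ln (zz j) / ln (zz (Suc j))"
      using zz1[of j] zz1[of "Suc j"] by (intro sum_inverse_prime_le) auto
    also have "\<dots> = 8"
      using z by (simp add: lnzz field_simps)
    finally show ?thesis .
  qed
  define \<kappa> where "\<kappa> = (2 * real g) ^ (2 * g) * exp (32 * real g)"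
  let ?V = "\<lambda>j. \<Prod>p\<in>B j. 1 - w p"
  have V: "(1 / (2 * real g)) ^ (2 * g) * exp (- 16 * real g) \<le> ?V j" for j
  proof -
    have "(1 / (2 * real g)) ^ (2 * g) * exp (- 16 * real g)
        \<le> (1 / (2 * real g)) ^ (2 * g) * exp (- 2 * real g * (\<Sum>p\<in>B j. 1 / real p))"
      using sumw[of j] mult_left_mono[OF sumw[of j], of "2 * real g"] by (intro mult_left_mono) auto
    also have "\<dots> \<le> ?V j"
      unfolding w_def by (intro prod_one_minus_ge finB p2 u g) (use BPD in blast)+
    finally show ?thesis .
  qed
  have W: "(\<Prod>p\<in>B j. 1 + 2 * w p) \<le> exp (16 * real g)" for j
  proof -
    have "(\<Prod>p\<in>B j. 1 + 2 * w p) \<le> (\<Prod>p\<in>B j. exp (2 * real g * (1 / real p)))"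
    proof (intro prod_mono conjI)
      fix p assume p: "p \<in> B j"
      then show "0 \<le> 1 + 2 * w p"
        using w01[OF BPD[OF p]] by auto
      have "1 + 2 * w p \<le> 1 + 2 * real g * (1 / real p)"
        using p BP[of j] u(2)[of p] p2[of p] by (auto simp: w_def divide_right_mono)
      also have "\<dots> \<le> exp (2 * real g * (1 / real p))"
        by (rule exp_ge_add_one_self)
      finally show "1 + 2 * w p \<le> exp (2 * real g * (1 / real p))" .
    qed
    also have "\<dots> = exp (2 * real g * (\<Sum>p\<in>B j. 1 / real p))"
      using finB by (simp add: exp_sum sum_distrib_left)
    also have "\<dots> \<le> exp (16 * real g)"
      using mult_left_mono[OF sumw[of j], of "2 * real g"] by simp
    finally show ?thesis .
  qed
  have block: "trunc_sum (\<lambda>p. - w p) (2 * j) (B j) \<le> ?V j * exp (\<kappa> * (1/2) ^ Suc j)" for j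
  proof -
    have Vpos: "?V j > 0"
      using V[of j] g by (intro less_le_trans[OF _ V[of j]]) auto
    have "exp (16 * real g) = \<kappa> * ((1 / (2 * real g)) ^ (2 * g) * exp (- 16 * real g))"
    proof -
      have "\<kappa> * ((1 / (2 * real g)) ^ (2 * g) * exp (- 16 * real g))
          = ((2 * real g) * (1 / (2 * real g))) ^ (2 * g) * (exp (32 * real g) * exp (- 16 * real g))"
        unfolding \<kappa>_def power_mult_distrib by (simp only: mult_ac)
      also have "\<dots> = exp (32 * real g + - 16 * real g)"
        using g by (simp only: exp_add) simp
      finally show ?thesis by simp
    qed
    also have "\<dots> \<le> \<kappa> * ?V j"
      by (intro mult_left_mono V) (simp add: \<kappa>_def)
    finally have W': "(\<Prod>p\<in>B j. 1 + 2 * w p) \<le> \<kappa> * ?V j"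
      using W[of j] by linarith
    have "trunc_sum (\<lambda>p. - w p) (2 * j) (B j) \<le> ?V j + (1/2) ^ Suc (2 * j) * (\<Prod>p\<in>B j. 1 + 2 * w p)"
      by (intro trunc_sum_neg_le(1)) (use BP w01 finB in auto)
    also have "\<dots> \<le> ?V j + (1/2) ^ Suc j * (\<kappa> * ?V j)"
    proof (intro add_left_mono mult_mono W')
      show "(1/2 :: real) ^ Suc (2 * j) \<le> (1/2) ^ Suc j"
        by (rule power_decreasing) auto
      show "0 \<le> (\<Prod>p\<in>B j. 1 + 2 * w p)"
        using BP[of j] w01 by (intro prod_nonneg) (force simp: add_nonneg_nonneg)
    qed auto
    also have "\<dots> = ?V j * (1 + \<kappa> * (1/2) ^ Suc j)"
      by (simp add: algebra_simps)
    also have "\<dots> \<le> ?V j * exp (\<kappa> * (1/2) ^ Suc j)"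
      using Vpos by (intro mult_left_mono exp_ge_add_one_self) auto
    finally show ?thesis .
  qed
  have nonneg: "0 \<le> trunc_sum (\<lambda>p. - w p) (2 * j) (B j)" for j
  proof -
    have "0 \<le> ?V j" using BP[of j] w01 by (intro prod_nonneg) force
    also have "\<dots> \<le> trunc_sum (\<lambda>p. - w p) (2 * j) (B j)"
      by (intro trunc_sum_neg_le(2)) (use BP w01 finB in auto)
    finally show ?thesis .
  qed
  have geo: "(\<Sum>j<t. (1/2 :: real) ^ Suc j) \<le> 1"
  proof -
    have "(\<Sum>j<t. (1/2 :: real) ^ Suc j) = 1 - (1/2) ^ t"
      by (induction t) (simp_all add: field_simps)
    then show ?thesis by simp
  qed
  have main: "(\<Prod>j<t. trunc_sum (\<lambda>p. - w p) (2 * j) (B j)) \<le> sieve_const g * (\<Prod>p\<in>P. 1 - w p)"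
  proof -
    have "(\<Prod>j<t. trunc_sum (\<lambda>p. - w p) (2 * j) (B j)) \<le> (\<Prod>j<t. ?V j * exp (\<kappa> * (1/2) ^ Suc j))"
      by (intro prod_mono conjI nonneg block)
    also have "\<dots> = (\<Prod>j<t. ?V j) * exp (\<kappa> * (\<Sum>j<t. (1/2) ^ Suc j))"
      by (simp only: prod.distrib sum_distrib_left exp_sum[OF finite_lessThan])
    also have "(\<Prod>j<t. ?V j) = (\<Prod>p\<in>(\<Union>j<t. B j). 1 - w p)"
      using finB disj by (intro prod.UNION_disjoint[symmetric]) auto
    also have "\<dots> * exp (\<kappa> * (\<Sum>j<t. (1/2) ^ Suc j)) \<le> \<dots> * exp (\<kappa> * 1)"
    proof (intro mult_left_mono)
      have "\<kappa> * (\<Sum>j<t. (1/2) ^ Suc j) \<le> \<kappa> * 1"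
        by (intro mult_left_mono geo) (simp add: \<kappa>_def)
      then show "exp (\<kappa> * (\<Sum>j<t. (1/2) ^ Suc j)) \<le> exp (\<kappa> * 1)"
        by simp
      show "0 \<le> (\<Prod>p\<in>(\<Union>j<t. B j). 1 - w p)"
        unfolding UB by (intro prod_nonneg) (use w01 in auto)
    qed
    finally show ?thesis
      by (simp add: UB sieve_const_def \<kappa>_def mult_ac)
  qed
  have err1: "trunc_sum u (2 * j) (B j) \<le> z powr (2 * (real g + 1) * (real j / 2 ^ j))" for j
  \<comment> \<open>A nonempty block has \<open>zz j >= 2\<close>, which turns the constant
    \<open>1 + g <= 2 ^ g\<close> into a power of \<open>zz j\<close>.\<close>
  proof (cases "B j = {}")
    case True
    then show ?thesis using z by (simp add: ge_one_powr_ge_zero)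
  next
    case False
    then obtain p where "p \<in> B j" by blast
    then have zj: "zz j \<ge> 2"
      using p2[of p] by (auto simp: B_def)
    have "B j \<subseteq> {1..nat \<lfloor>zz j\<rfloor>}"
      using p2 by (force simp: B_def le_nat_floor)
    then have "card (B j) \<le> card {1..nat \<lfloor>zz j\<rfloor>}"
      by (intro card_mono) auto
    then have "real (card (B j)) \<le> zz j"
      using zj by (auto simp: le_nat_iff le_floor_iff)
    moreover have "sum u (B j) \<le> real (card (B j)) * real g"
      by (rule sum_bounded_above) (use BP u in auto)
    ultimately have "1 + sum u (B j) \<le> 1 + zz j * real g"
      using mult_right_mono[of "real (card (B j))" "zz j" "real g"] by linarith
    also have "\<dots> \<le> zz j * (1 + real g)"
      using zj by (simp add: algebra_simps)
    also have "1 + real g \<le> 2 ^ g"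
    proof -
      have "g + 1 \<le> 2 ^ g"
        by (induction g) auto
      then have "real (g + 1) \<le> real (2 ^ g)"
        by (rule of_nat_mono)
      then show ?thesis by simp
    qed
    also have "zz j * 2 ^ g \<le> zz j * zz j ^ g"
      using zj by (intro mult_left_mono power_mono) auto
    also have "\<dots> = zz j powr (real g + 1)"
      using zj by (simp add: powr_add powr_realpow)
    finally have "1 + sum u (B j) \<le> zz j powr (real g + 1)"
      using zj by simp
    then have "(1 + sum u (B j)) ^ (2 * j) \<le> (zz j powr (real g + 1)) ^ (2 * j)"
      by (intro power_mono) (use BP u in \<open>auto intro!: add_nonneg_nonneg sum_nonneg\<close>)
    moreover have "(zz j powr (real g + 1)) ^ (2 * j) = z powr (2 * (real g + 1) * (real j / 2 ^ j))"
      using z by (simp add: zz_def powr_powr field_simps flip: powr_realpow)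
    moreover have "trunc_sum u (2 * j) (B j) \<le> (1 + sum u (B j)) ^ (2 * j)"
      by (rule trunc_sum_le_power) (use finB BP u in auto)
    ultimately show ?thesis by linarith
  qed
  have nonneg_u: "0 \<le> trunc_sum u (2 * j) (B j)" for j
    unfolding trunc_sum_def using BP[of j] u(1) by (intro sum_nonneg prod_nonneg) blast
  have err: "(\<Prod>j<t. trunc_sum u (2 * j) (B j)) \<le> z powr (4 * (real g + 1))"
  proof -
    have "(\<Prod>j<t. trunc_sum u (2 * j) (B j)) \<le> (\<Prod>j<t. z powr (2 * (real g + 1) * (real j / 2 ^ j)))"
      by (intro prod_mono conjI err1 nonneg_u)
    also have "\<dots> = z powr (2 * (real g + 1) * (\<Sum>j<t. real j / 2 ^ j))"
      using z by (simp add: powr_sum sum_distrib_left)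
    also have "\<dots> \<le> z powr (2 * (real g + 1) * 2)"
      using z by (intro powr_mono mult_left_mono sum_div_power2_le) auto
    finally show ?thesis by simp
  qed
  have "real (card {n \<in> X. \<forall>p\<in>(\<Union>j<t. B j). \<not> bad n p})
      \<le> M * (\<Prod>j<t. trunc_sum (\<lambda>p. - w p) (2 * j) (B j)) + c * (\<Prod>j<t. trunc_sum u (2 * j) (B j))"
    by (rule brun_hooley[OF X finB disj]) (auto simp: UB w_def intro: count)
  also have "\<dots> \<le> M * (sieve_const g * (\<Prod>p\<in>P. 1 - w p)) + c * z powr (4 * (real g + 1))"
    by (intro add_mono mult_left_mono main err M c)
  finally show ?thesis
    by (simp add: UB w_def mult_ac)
qed

section \<open>Densities of periodic sets\<close>

definition periodic :: "nat \<Rightarrow> (nat \<Rightarrow> bool) \<Rightarrow> bool" where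
  "periodic m S \<longleftrightarrow> 0 < m \<and> (\<forall>n. S (n + m) = S n)"

text \<open>Every period gives the same value (\<open>density_eq\<close>), so conditions with
  different moduli can be compared and combined without naming a common modulus.\<close>

definition density :: "(nat \<Rightarrow> bool) \<Rightarrow> real" where
  "density S = (let m = SOME m. periodic m S in real (card {n. n < m \<and> S n}) / real m)"

lemma periodic_add_mult:
  assumes "periodic m S"
  shows "S (n + m * k) = S n"
proof (induction k)
  case (Suc k)
  have "S (n + m * Suc k) = S ((n + m * k) + m)"
    by (simp add: algebra_simps)
  then show ?case
    using Suc assms by (simp add: periodic_def)
qed simp

lemma periodic_mod: "periodic m S \<Longrightarrow> S (n mod m) = S n"
  using periodic_add_mult[of m S "n mod m" "n div m"] by simp

lemma periodic_mult: "periodic m S \<Longrightarrow> 0 < k \<Longrightarrow> periodic (m * k) S"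
  using periodic_add_mult[of m S _ k] by (simp add: periodic_def)

lemma periodic_dvd:
  assumes "periodic m S" "m dvd l" "0 < l"
  shows "periodic l S"
proof -
  obtain k where "l = m * k" using assms by auto
  then show ?thesis using assms periodic_mult[of m S k] by auto
qed

lemma card_periodic_mult:
  assumes "periodic m S"
  shows "card {n. n < m * k \<and> S n} = k * card {n. n < m \<and> S n}"
proof (induction k)
  case (Suc k)
  let ?A = "{n. n < m * k \<and> S n}" and ?B = "{n. n < m \<and> S n}"
  have "{n. n < m * Suc k \<and> S n} = ?A \<union> (\<lambda>n. n + m * k) ` ?B" (is "?L = ?R")
  proof (intro Set.set_eqI iffI)
    fix n assume n: "n \<in> ?L"
    show "n \<in> ?R"
    proof (cases "n < m * k")
      case False
      then have "n = (n - m * k) + m * k" "n - m * k < m"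
        using n by auto
      moreover from this have "S (n - m * k)"
        using n periodic_add_mult[OF assms, of "n - m * k" k] by auto
      ultimately show ?thesis by blast
    qed (use n in auto)
  qed (auto simp: periodic_add_mult[OF assms])
  moreover have "?A \<inter> (\<lambda>n. n + m * k) ` ?B = {}" by auto
  ultimately have "card {n. n < m * Suc k \<and> S n} = card ?A + card ((\<lambda>n. n + m * k) ` ?B)"
    by (simp add: card_Un_disjoint)
  then show ?case
    using Suc by (simp add: card_image inj_on_def)
qed simp

lemma density_eq:
  assumes "periodic m S"
  shows "density S = real (card {n. n < m \<and> S n}) / real m"
proof -
  define l where "l = (SOME l. periodic l S)"
  have l: "periodic l S"
    unfolding l_def using assms by (rule someI)
  have pos: "l > 0" "m > 0"
    using l assms by (auto simp: periodic_def)
  have "real (m * card {n. n < l \<and> S n}) = real (l * card {n. n < m \<and> S n})"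
    using card_periodic_mult[OF l, of m] card_periodic_mult[OF assms, of l] by (simp add: mult.commute)
  then show ?thesis
    using pos unfolding density_def l_def[symmetric] Let_def by (simp add: field_simps)
qed

lemma density_nonneg [simp]: "0 \<le> density S"
  by (simp add: density_def Let_def)

lemma common_period:
  assumes "finite I" "\<And>i. i \<in> I \<Longrightarrow> \<exists>m. periodic m (S i)" "\<exists>m. periodic m T"
  shows "\<exists>m. periodic m T \<and> (\<forall>i\<in>I. periodic m (S i))"
proof -
  obtain m l where m: "\<And>i. i \<in> I \<Longrightarrow> periodic (m i) (S i)" and l: "periodic l T"
    using assms(2,3) by metis
  have pos: "prod m I * l > 0"
    using m l by (auto simp: periodic_def intro!: prod_pos)
  have "periodic (prod m I * l) (S i)" if "i \<in> I" for i
    using that assms(1) by (intro periodic_dvd[OF m[OF that] _ pos] dvd_mult2 dvd_prodI)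
  moreover have "periodic (prod m I * l) T"
    by (intro periodic_dvd[OF l _ pos]) simp
  ultimately show ?thesis by blast
qed

lemma sum_density_le:
  assumes I: "finite I" and S: "\<And>i. i \<in> I \<Longrightarrow> \<exists>m. periodic m (S i)" and T: "\<exists>m. periodic m T"
    and sub: "\<And>i n. i \<in> I \<Longrightarrow> S i n \<Longrightarrow> T n"
    and disj: "\<And>i j n. i \<in> I \<Longrightarrow> j \<in> I \<Longrightarrow> S i n \<Longrightarrow> S j n \<Longrightarrow> i = j"
  shows "(\<Sum>i\<in>I. density (S i)) \<le> density T"
proof -
  obtain m where mT: "periodic m T" and mS: "\<And>i. i \<in> I \<Longrightarrow> periodic m (S i)"
    using common_period[of I S T] I S T by blast
  have "(\<Sum>i\<in>I. density (S i)) = real (\<Sum>i\<in>I. card {n. n < m \<and> S i n}) / real m"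
    by (simp add: density_eq[OF mS] sum_divide_distrib)
  also have "(\<Sum>i\<in>I. card {n. n < m \<and> S i n}) = card (\<Union>i\<in>I. {n. n < m \<and> S i n})"
    using I disj by (intro card_UN_disjoint[symmetric]) auto
  also have "\<dots> \<le> card {n. n < m \<and> T n}"
    using sub by (intro card_mono) auto
  finally show ?thesis
    by (simp add: density_eq[OF mT] divide_right_mono)
qed

lemma density_mono:
  assumes "\<exists>m. periodic m S" "\<exists>m. periodic m T" "\<And>n. S n \<Longrightarrow> T n"
  shows "density S \<le> density T"
  using sum_density_le[of "{()}" "\<lambda>_. S" T] assms by auto

lemma density_le_sum:
  assumes I: "finite I" and S: "\<And>i. i \<in> I \<Longrightarrow> \<exists>m. periodic m (S i)" and T: "\<exists>m. periodic m T"
    and cover: "\<And>n. T n \<Longrightarrow> \<exists>i\<in>I. S i n"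
  shows "density T \<le> (\<Sum>i\<in>I. density (S i))"
proof -
  obtain m where mT: "periodic m T" and mS: "\<And>i. i \<in> I \<Longrightarrow> periodic m (S i)"
    using common_period[of I S T] I S T by blast
  have "card {n. n < m \<and> T n} \<le> card (\<Union>i\<in>I. {n. n < m \<and> S i n})"
    using cover I by (intro card_mono) auto
  also have "\<dots> \<le> (\<Sum>i\<in>I. card {n. n < m \<and> S i n})"
    by (rule card_UN_le[OF I])
  finally have "density T \<le> real (\<Sum>i\<in>I. card {n. n < m \<and> S i n}) / real m"
    by (simp add: density_eq[OF mT] divide_right_mono del: of_nat_sum)
  then show ?thesis
    by (simp add: density_eq[OF mS] sum_divide_distrib)
qed

lemma periodic_conj:
  assumes "periodic m S" "periodic l T"
  shows "periodic (m * l) (\<lambda>n. S n \<and> T n)"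
  using periodic_mult[OF assms(1), of l] periodic_dvd[OF assms(2), of "m * l"] assms
  by (auto simp: periodic_def)

lemma density_conj:
  assumes S: "periodic m S" and T: "periodic l T" and "coprime m l"
  shows "density (\<lambda>n. S n \<and> T n) = density S * density T"
proof -
  have pos: "m > 0" "l > 0" using S T by (auto simp: periodic_def)
  let ?f = "\<lambda>n. (n mod m, n mod l)"
  have "bij_betw ?f {n. n < m * l \<and> S n \<and> T n} ({n. n < m \<and> S n} \<times> {n. n < l \<and> T n})"
  proof (rule bij_betwI')
    fix a b assume ab: "a \<in> {n. n < m * l \<and> S n \<and> T n}" "b \<in> {n. n < m * l \<and> S n \<and> T n}"
    show "?f a = ?f b \<longleftrightarrow> a = b"
    proof
      assume "?f a = ?f b"
      then have "[a = b] (mod m * l)"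
        using \<open>coprime m l\<close> by (intro coprime_cong_mult_nat) (auto simp: Cong.cong_def)
      then show "a = b" using ab by (simp add: Cong.cong_def)
    qed simp
  next
    fix a assume "a \<in> {n. n < m * l \<and> S n \<and> T n}"
    then show "?f a \<in> {n. n < m \<and> S n} \<times> {n. n < l \<and> T n}"
      using pos by (simp add: periodic_mod[OF S] periodic_mod[OF T])
  next
    fix b assume b: "b \<in> {n. n < m \<and> S n} \<times> {n. n < l \<and> T n}"
    obtain n where n: "[n = fst b] (mod m)" "[n = snd b] (mod l)"
      using binary_chinese_remainder_nat[OF \<open>coprime m l\<close>] by blast
    have f: "?f (n mod (m * l)) = b"
      using n b by (auto simp: Cong.cong_def mod_mod_cancel prod_eq_iff)
    moreover have "S (n mod (m * l))" "T (n mod (m * l))"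
      using b f periodic_mod[OF S, of "n mod (m * l)"] periodic_mod[OF T, of "n mod (m * l)"] by auto
    ultimately show "\<exists>a\<in>{n. n < m * l \<and> S n \<and> T n}. b = ?f a"
      using pos by (intro bexI[of _ "n mod (m * l)"]) auto
  qed
  then have "card {n. n < m * l \<and> S n \<and> T n} = card {n. n < m \<and> S n} * card {n. n < l \<and> T n}"
    by (simp add: bij_betw_same_card card_cartesian_product)
  then show ?thesis
    by (simp add: density_eq[OF S] density_eq[OF T] density_eq[OF periodic_conj[OF S T]])
qed

lemma density_True: "density (\<lambda>n. True) = 1"
  using density_eq[of 1 "\<lambda>n. True"] by (simp add: periodic_def)

lemma periodic_Ball_prod:
  assumes "finite I" "\<And>i. i \<in> I \<Longrightarrow> periodic (m i) (S i)"
  shows "periodic (\<Prod>i\<in>I. m i) (\<lambda>n. \<forall>i\<in>I. S i n)"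
  using assms
proof (induction I rule: finite_induct)
  case (insert i I)
  then show ?case
    using periodic_conj[of "m i" "S i" "\<Prod>i\<in>I. m i" "\<lambda>n. \<forall>i\<in>I. S i n"] by auto
qed (simp add: periodic_def)

lemma density_Ball_prod:
  assumes "finite I" "\<And>i. i \<in> I \<Longrightarrow> periodic (m i) (S i)"
    and "\<And>i j. i \<in> I \<Longrightarrow> j \<in> I \<Longrightarrow> i \<noteq> j \<Longrightarrow> coprime (m i) (m j)"
  shows "density (\<lambda>n. \<forall>i\<in>I. S i n) = (\<Prod>i\<in>I. density (S i))"
  using assms
proof (induction I rule: finite_induct)
  case empty
  then show ?case by (simp add: density_True)
next
  case (insert i I)
  have "coprime (m i) (\<Prod>i\<in>I. m i)"
    using insert by (intro prod_coprime_right) auto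
  then have "density (\<lambda>n. S i n \<and> (\<forall>i\<in>I. S i n)) = density (S i) * density (\<lambda>n. \<forall>i\<in>I. S i n)"
    using insert by (intro density_conj[of "m i" _ "\<Prod>i\<in>I. m i"] periodic_Ball_prod) auto
  then show ?case
    using insert by simp
qed

lemma card_residue_interval:
  fixes x y :: real
  assumes "0 < m" "r < m" "0 \<le> x" "0 \<le> y"
  shows "\<bar>real (card {n. x < real n \<and> real n \<le> x + y \<and> n mod m = r}) - y / real m\<bar> \<le> 1"
proof -
  define a b where "a = \<lfloor>(x - real r) / real m\<rfloor>" and "b = \<lfloor>(x + y - real r) / real m\<rfloor>"
  have "- 1 \<le> (x - real r) / real m"
    using assms by (simp add: field_simps)
  then have a: "a \<ge> - 1"
    unfolding a_def by (simp add: le_floor_iff)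
  have mem: "x < real n \<and> real n \<le> x + y \<longleftrightarrow> a < int t \<and> int t \<le> b" if "n = r + m * t" for n t
    using assms by (auto simp: a_def b_def that floor_less_iff le_floor_iff field_simps)
  have "bij_betw (\<lambda>n. int (n div m)) {n. x < real n \<and> real n \<le> x + y \<and> n mod m = r} {a<..b}"
  proof (rule bij_betwI[where g = "\<lambda>t. r + m * nat t"])
    show "(\<lambda>n. int (n div m)) \<in> {n. x < real n \<and> real n \<le> x + y \<and> n mod m = r} \<rightarrow> {a<..b}"
    proof
      fix n assume n: "n \<in> {n. x < real n \<and> real n \<le> x + y \<and> n mod m = r}"
      then have "n = r + m * (n div m)" by auto
      from mem[OF this] n show "int (n div m) \<in> {a<..b}" by auto
    qed
    show "(\<lambda>t. r + m * nat t) \<in> {a<..b} \<rightarrow> {n. x < real n \<and> real n \<le> x + y \<and> n mod m = r}"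
    proof
      fix t assume t: "t \<in> {a<..b}"
      then have "int (nat t) = t" using a by auto
      then show "r + m * nat t \<in> {n. x < real n \<and> real n \<le> x + y \<and> n mod m = r}"
        using mem[OF refl, of "nat t"] t assms by auto
    qed
  qed (use a assms in auto)
  then have "card {n. x < real n \<and> real n \<le> x + y \<and> n mod m = r} = card {a<..b}"
    by (rule bij_betw_same_card)
  moreover have "a \<le> b"
    unfolding a_def b_def using assms by (intro floor_mono divide_right_mono) auto
  ultimately have *: "real (card {n. x < real n \<and> real n \<le> x + y \<and> n mod m = r}) = of_int b - of_int a"
    by simp
  have "(x + y - real r) / real m = (x - real r) / real m + y / real m"
    by (simp add: diff_divide_distrib add_divide_distrib)
  then show ?thesis
    unfolding * a_def b_def by linarith
qed

lemma finite_interval_nat [simp]: "finite {n::nat. x < real n \<and> real n \<le> z \<and> Q n}"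
proof -
  have "{n::nat. x < real n \<and> real n \<le> z \<and> Q n} \<subseteq> {..nat \<lfloor>z\<rfloor>}"
    by (auto simp: le_nat_floor)
  then show ?thesis by (rule finite_subset) simp
qed

text \<open>The error is the number of admissible residues, not the modulus. In the form
  \<open>m * density S\<close> it is multiplicative over coprime conditions, and the remainder of
  the sieve becomes a product of the \<open>rho Q p\<close>.\<close>

lemma card_periodic_interval:
  fixes x y :: real
  assumes S: "periodic m S" and "0 \<le> x" "0 \<le> y"
  shows "\<bar>real (card {n. x < real n \<and> real n \<le> x + y \<and> S n}) - y * density S\<bar> \<le> real m * density S"
proof -
  let ?R = "{r. r < m \<and> S r}"
  let ?N = "\<lambda>r. {n. x < real n \<and> real n \<le> x + y \<and> n mod m = r}"
  have m: "m > 0" using S by (simp add: periodic_def)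
  have "{n. x < real n \<and> real n \<le> x + y \<and> S n} = (\<Union>r\<in>?R. ?N r)"
    using m periodic_mod[OF S] by auto
  moreover have "card (\<Union>r\<in>?R. ?N r) = (\<Sum>r\<in>?R. card (?N r))"
    by (intro card_UN_disjoint) auto
  ultimately have card: "real (card {n. x < real n \<and> real n \<le> x + y \<and> S n}) = (\<Sum>r\<in>?R. real (card (?N r)))"
    by simp
  have md: "real m * density S = real (card ?R)"
    using m by (simp add: density_eq[OF S])
  have "y * density S = (\<Sum>r\<in>?R. y / real m)"
    by (simp add: density_eq[OF S])
  then have "\<bar>real (card {n. x < real n \<and> real n \<le> x + y \<and> S n}) - y * density S\<bar>
      = \<bar>\<Sum>r\<in>?R. real (card (?N r)) - y / real m\<bar>"
    by (simp add: card sum_subtractf)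
  also have "\<dots> \<le> (\<Sum>r\<in>?R. \<bar>real (card (?N r)) - y / real m\<bar>)"
    by (rule sum_abs)
  also have "\<dots> \<le> (\<Sum>r\<in>?R. 1)"
    by (intro sum_mono card_residue_interval) (use assms m in auto)
  finally show ?thesis
    by (simp add: md)
qed

section \<open>Polynomial congruences and the discriminant\<close>

lemma dvd_poly_diff:
  fixes P :: "int poly"
  shows "a - b dvd poly P a - poly P b"
proof (induction P)
  case (pCons c P)
  have "poly (pCons c P) a - poly (pCons c P) b = a * (poly P a - poly P b) + (a - b) * poly P b"
    by (simp add: algebra_simps)
  then show ?case
    using pCons.IH by simp
qed simp

lemma periodic_dvd_poly: "0 < m \<Longrightarrow> periodic m (\<lambda>n. int m dvd poly P (int n))"
  unfolding periodic_def
proof (intro conjI allI)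
  fix n
  have "int m dvd poly P (int (n + m)) - poly P (int n)"
    using dvd_poly_diff[of "int (n + m)" "int n" P] by simp
  then have "(int m dvd (poly P (int (n + m)) - poly P (int n)) + poly P (int n)) = (int m dvd poly P (int n))"
    by (rule dvd_add_right_iff)
  then show "(int m dvd poly P (int (n + m))) = (int m dvd poly P (int n))"
    by simp
qed simp

lemma density_dvd_poly: "0 < m \<Longrightarrow> density (\<lambda>n. int m dvd poly P (int n)) = real (rho P m) / real m"
  by (subst density_eq[OF periodic_dvd_poly]) (auto simp: rho_def intro!: arg_cong[of _ _ card])

lemma prime_power_dvd_cofactor:
  fixes p a b :: int
  assumes "prime p" "p ^ m dvd a * b" "\<not> p ^ r dvd a"
  shows "p ^ (m - (r - 1)) dvd b"
proof (cases "a * b = 0")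
  case True
  then show ?thesis using assms(3) by auto
next
  case False
  then have nz: "a \<noteq> 0" "b \<noteq> 0" by auto
  have pe: "prime_elem p" using assms(1) by auto
  have "multiplicity p a < r"
    using assms nz by (auto simp: power_dvd_iff_le_multiplicity prime_elem_def)
  moreover have "m \<le> multiplicity p (a * b)"
    using assms False by (auto simp: power_dvd_iff_le_multiplicity prime_elem_def)
  moreover have "multiplicity p (a * b) = multiplicity p a + multiplicity p b"
    using pe nz by (rule prime_elem_multiplicity_mult_distrib)
  ultimately have "m - (r - 1) \<le> multiplicity p b" by linarith
  then show ?thesis by (rule multiplicity_dvd')
qed

text \<open>Dividing the roots out one after the other, each step loses at most \<open>r - 1\<close> powers of \<open>p\<close>.\<close>

lemma incongruent_roots_bound:
  fixes P :: "int poly" and p :: int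
  assumes "prime p" "\<exists>i. \<not> p dvd coeff P i" "degree P \<le> d" "finite X" "card X = Suc d"
    and "\<And>n. n \<in> X \<Longrightarrow> p ^ m dvd poly P n"
    and "\<And>n n'. n \<in> X \<Longrightarrow> n' \<in> X \<Longrightarrow> n \<noteq> n' \<Longrightarrow> \<not> p ^ r dvd n - n'"
  shows "m \<le> d * (r - 1)"
  using assms
proof (induction d arbitrary: P X m)
  case 0
  then obtain c where P: "P = [:c:]"
    using degree_eq_zeroE by blast
  obtain n where "n \<in> X" using 0(5) by (cases "X = {}") auto
  then have "p ^ m dvd c" using 0(6)[of n] P by simp
  moreover have "\<not> p dvd c"
  proof -
    obtain i where "\<not> p dvd coeff P i" using 0(2) by blast
    then show ?thesis using P by (cases i) auto
  qed
  moreover have "p dvd p ^ m" if "m \<noteq> 0"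
    using that by simp
  ultimately have "m = 0"
    by (meson dvd_trans)
  then show ?case by simp
next
  case (Suc d)
  show ?case
  proof (cases "m = 0")
    case False
    obtain n0 where n0: "n0 \<in> X" using Suc.prems(5) by (cases "X = {}") auto
    define P1 where "P1 = synthetic_div P n0"
    have P: "P = [:- n0, 1:] * P1 + [:poly P n0:]"
      unfolding P1_def using synthetic_div_correct'[of n0 P] by simp
    have dn0: "p ^ m dvd poly P n0" using Suc.prems n0 by auto
    have "m - (r - 1) \<le> d * (r - 1)"
    proof (rule Suc.IH[of P1 "X - {n0}"])
      show "\<exists>i. \<not> p dvd coeff P1 i"
      proof (rule ccontr)
        assume "\<not> (\<exists>i. \<not> p dvd coeff P1 i)"
        then have "[:p:] dvd P1" by (simp add: const_poly_dvd_iff)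
        moreover have "p dvd poly P n0"
          by (rule dvd_trans[OF _ dn0]) (use False in simp)
        then have "[:p:] dvd [:poly P n0:]" by (simp add: const_poly_dvd_iff coeff_pCons split: nat.splits)
        ultimately have "[:p:] dvd P"
          by (subst P) (intro dvd_add dvd_mult)
        then show False
          using Suc.prems(2) by (simp add: const_poly_dvd_iff)
      qed
      show "degree P1 \<le> d"
        using Suc.prems(3) by (simp add: P1_def degree_synthetic_div)
      show "card (X - {n0}) = Suc d" using Suc.prems n0 by simp
      fix n assume n: "n \<in> X - {n0}"
      have "poly P n = (n - n0) * poly P1 n + poly P n0"
        by (subst P) (simp add: algebra_simps)
      moreover have "p ^ m dvd poly P n" using Suc.prems n by auto
      ultimately have "p ^ m dvd (n - n0) * poly P1 n"
        using dn0 by (simp add: dvd_add_left_iff)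
      then show "p ^ (m - (r - 1)) dvd poly P1 n"
        using Suc.prems n n0 by (intro prime_power_dvd_cofactor) auto
    qed (use Suc.prems in auto)
    then show ?thesis by simp
  qed simp
qed

text \<open>The solutions lie in at most \<open>degree P\<close> classes modulo
  \<open>p ^ r\<close>: one class more would give incongruent roots that contradict
  \<open>incongruent_roots_bound\<close>. The bound is uniform in \<open>P\<close>, also for
  \<open>p\<close> dividing the discriminant. With \<open>r = 2\<close> and
  \<open>m = Suc (degree P)\<close> it yields the density \<open>degree P / p ^ 2\<close>.\<close>

lemma density_prime_power_dvd_le:
  fixes P :: "int poly"
  assumes p: "prime p" and P: "\<exists>i. \<not> int p dvd coeff P i" and r: "degree P * (r - 1) < m"
  shows "density (\<lambda>n. int p ^ m dvd poly P (int n)) \<le> real (degree P) / real p ^ r"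
proof -
  define S where "S = (\<lambda>n. int p ^ m dvd poly P (int n))"
  define R where "R = {n mod p ^ r |n. S n}"
  have p0: "p > 0" using p by (simp add: prime_gt_0_nat)
  have finR: "finite R"
    using p0 by (intro finite_subset[of R "{..p ^ r}"]) (auto simp: R_def intro: less_imp_le)
  have cardR: "card R \<le> degree P"
  proof (rule ccontr)
    assume "\<not> card R \<le> degree P"
    then obtain R' where R': "R' \<subseteq> R" "card R' = Suc (degree P)" "finite R'"
      by (metis not_less_eq_eq obtain_subset_with_card_n)
    have "\<forall>c\<in>R'. \<exists>n. S n \<and> n mod p ^ r = c"
      using R' by (auto simp: R_def)
    then obtain f where f: "\<And>c. c \<in> R' \<Longrightarrow> S (f c)" "\<And>c. c \<in> R' \<Longrightarrow> f c mod p ^ r = c"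
      by metis
    let ?X = "(\<lambda>c. int (f c)) ` R'"
    have inj: "inj_on (\<lambda>c. int (f c)) R'"
    proof (rule inj_onI)
      fix a b assume ab: "a \<in> R'" "b \<in> R'" "int (f a) = int (f b)"
      then have "f a mod p ^ r = f b mod p ^ r" by simp
      then show "a = b" using f(2) ab by simp
    qed
    have "m \<le> degree P * (r - 1)"
    proof (rule incongruent_roots_bound[of "int p" P "degree P" ?X])
      show "card ?X = Suc (degree P)" using inj R' by (simp add: card_image)
      fix n assume "n \<in> ?X"
      then show "int p ^ m dvd poly P n" using f by (auto simp: S_def)
    next
      fix n n' assume "n \<in> ?X" "n' \<in> ?X" "n \<noteq> n'"
      then obtain c c' where c: "c \<in> R'" "c' \<in> R'" "n = int (f c)" "n' = int (f c')" "c \<noteq> c'"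
        by auto
      show "\<not> int p ^ r dvd n - n'"
      proof
        assume "int p ^ r dvd n - n'"
        then have "[int (f c) = int (f c')] (mod int (p ^ r))"
          using c by (simp add: cong_iff_dvd_diff)
        then have "[f c = f c'] (mod p ^ r)"
          by (simp only: cong_int_iff)
        then show False using f(2)[of c] f(2)[of c'] c by (simp add: Cong.cong_def)
      qed
    qed (use p P R' in auto)
    then show False using r by simp
  qed
  have pT: "periodic (p ^ r) (\<lambda>n. n mod p ^ r \<in> R)"
    using p0 by (simp add: periodic_def)
  have "density S \<le> density (\<lambda>n. n mod p ^ r \<in> R)"
  proof (rule density_mono)
    show "\<exists>m. periodic m S"
      using periodic_dvd_poly[of "p ^ m" P] p0 by (auto simp: S_def)
  qed (use pT in \<open>auto simp: R_def\<close>)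
  also have "\<dots> = real (card {n. n < p ^ r \<and> n mod p ^ r \<in> R}) / real (p ^ r)"
    by (rule density_eq[OF pT])
  also have "\<dots> \<le> real (card R) / real (p ^ r)"
    using finR by (intro divide_right_mono of_nat_mono card_mono) auto
  also have "\<dots> \<le> real (degree P) / real (p ^ r)"
    using cardR by (intro divide_right_mono) auto
  finally show ?thesis by (simp add: S_def)
qed

lemma density_prime_power_dvd_le_powr:
  fixes P :: "int poly"
  assumes p: "prime p" and P: "\<exists>i. \<not> int p dvd coeff P i" and m: "m \<ge> 1" and d: "degree P > 0"
  shows "density (\<lambda>n. int p ^ m dvd poly P (int n)) \<le> real (degree P) * real p powr (- (real m / real (degree P)))"
proof -
  \<comment> \<open>This is \<open>m / degree P\<close> rounded up, the largest value with
    \<open>degree P * (r - 1) < m\<close>.\<close>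
  define r where "r = Suc ((m - 1) div degree P)"
  have "density (\<lambda>n. int p ^ m dvd poly P (int n)) \<le> real (degree P) / real p ^ r"
  proof (rule density_prime_power_dvd_le[OF p P])
    have "degree P * ((m - 1) div degree P) \<le> m - 1" by (rule times_div_less_eq_dividend)
    then show "degree P * (r - 1) < m" using m unfolding r_def diff_Suc_1 by linarith
  qed
  also have "real p ^ r = real p powr (real r)"
    using p by (simp add: powr_realpow prime_gt_0_nat)
  also have "real (degree P) / real p powr (real r) \<le> real (degree P) / real p powr (real m / real (degree P))"
  proof (intro divide_left_mono powr_mono)
    have "m - 1 < degree P * r"
      unfolding r_def using d by (simp add: dividend_less_times_div)
    then have "m \<le> degree P * r" using m by linarith
    then have "real m \<le> real (degree P) * real r"
      by (metis of_nat_le_iff of_nat_mult)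
    then show "real m / real (degree P) \<le> real r"
      using d by (simp add: field_simps)
    show "1 \<le> real p" using prime_ge_1_nat[OF p] by simp
  qed (use p prime_gt_0_nat in auto)
  finally show ?thesis by (simp add: powr_minus divide_inverse)
qed

text \<open>Cramer's rule: the adjugate maps \<open>A x\<close>, which vanishes modulo
  \<open>p\<close>, to \<open>det A\<close> times \<open>x\<close>, and one entry of
  \<open>x\<close> is 1.\<close>

lemma dvd_det_if_kernel:
  fixes A :: "int mat"
  assumes A: "A \<in> carrier_mat n n" and x: "x \<in> carrier_vec n" and k: "k < n" "vec_index x k = 1"
    and dv: "\<And>i. i < n \<Longrightarrow> p dvd (\<Sum>j<n. A $$ (i, j) * vec_index x j)"
  shows "p dvd det A"
proof -
  have "(det A \<cdot>\<^sub>m 1\<^sub>m n) *\<^sub>v x = adj_mat A *\<^sub>v (A *\<^sub>v x)"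
    by (simp only: assoc_mult_mat_vec[OF adj_mat(1)[OF A] A x, symmetric] adj_mat(3)[OF A])
  moreover have "vec_index ((det A \<cdot>\<^sub>m 1\<^sub>m n) *\<^sub>v x) k = det A"
  proof -
    have "vec_index ((det A \<cdot>\<^sub>m 1\<^sub>m n) *\<^sub>v x) k = (\<Sum>j<n. (if k = j then det A else 0) * vec_index x j)"
      using k x by (auto simp: scalar_prod_def lessThan_atLeast0 intro!: sum.cong)
    also have "\<dots> = det A"
      using k by (simp add: if_distrib[of "\<lambda>a. a * _"] cong: if_cong)
    finally show ?thesis .
  qed
  moreover have "p dvd vec_index (adj_mat A *\<^sub>v (A *\<^sub>v x)) k"
  proof -
    have "vec_index (A *\<^sub>v x) i = (\<Sum>j<n. A $$ (i, j) * vec_index x j)" if "i < n" for i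
      using that A x by (auto simp: scalar_prod_def lessThan_atLeast0 intro!: sum.cong)
    then have "p dvd vec_index (A *\<^sub>v x) i" if "i < n" for i
      using that dv by simp
    moreover have "vec_index (adj_mat A *\<^sub>v v) k = (\<Sum>j<n. adj_mat A $$ (k, j) * vec_index v j)"
      if "v \<in> carrier_vec n" for v
      using that k adj_mat(1)[OF A] by (auto simp: scalar_prod_def lessThan_atLeast0 intro!: sum.cong)
    moreover have "A *\<^sub>v x \<in> carrier_vec n"
      using A x by simp
    ultimately show ?thesis
      by (simp only:) (intro dvd_sum dvd_mult, simp)
  qed
  ultimately show ?thesis by metis
qed

text \<open>The Sylvester matrix maps the vector of descending powers of \<open>a\<close> to
  multiples of \<open>poly P a\<close> and \<open>poly R a\<close>. A common root modulo
  \<open>q\<close> is therefore a kernel vector modulo \<open>q\<close>.\<close>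

lemma sylvester_mult_powers:
  fixes P R :: "int poly"
  assumes i: "i < degree P + degree R" and q: "q dvd poly P a" "q dvd poly R a"
  shows "q dvd (\<Sum>j<degree P + degree R. sylvester_mat P R $$ (i, j) * a ^ (degree P + degree R - 1 - j))"
proof -
  let ?m = "degree P" and ?n = "degree R"
  let ?N = "?m + ?n"
  show ?thesis
  proof (cases "i < ?n")
    case True
    have "(\<Sum>j<?N. sylvester_mat P R $$ (i, j) * a ^ (?N - 1 - j))
        = (\<Sum>j\<in>{i..i + ?m}. coeff P (?m + i - j) * a ^ (?N - 1 - j))"
      using True i by (intro sum.mono_neutral_cong_right) (auto simp: sylvester_index_mat)
    also have "\<dots> = (\<Sum>t\<le>?m. coeff P t * a ^ t * a ^ (?n - 1 - i))"
      by (rule sum.reindex_bij_witness[of _ "\<lambda>t. ?m + i - t" "\<lambda>j. ?m + i - j"])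
         (use True in \<open>auto simp: algebra_simps simp flip: power_add\<close>)
    also have "\<dots> = poly P a * a ^ (?n - 1 - i)"
      by (simp add: poly_altdef sum_distrib_right)
    finally show ?thesis using q by simp
  next
    case False
    have "(\<Sum>j<?N. sylvester_mat P R $$ (i, j) * a ^ (?N - 1 - j))
        = (\<Sum>j\<in>{i - ?n..i}. coeff R (i - j) * a ^ (?N - 1 - j))"
      using False i by (intro sum.mono_neutral_cong_right) (auto simp: sylvester_index_mat)
    also have "\<dots> = (\<Sum>t\<le>?n. coeff R t * a ^ t * a ^ (?N - 1 - i))"
      by (rule sum.reindex_bij_witness[of _ "\<lambda>t. i - t" "\<lambda>j. i - j"])
         (use False i in \<open>auto simp: algebra_simps simp flip: power_add\<close>)
    also have "\<dots> = poly R a * a ^ (?N - 1 - i)"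
      by (simp add: poly_altdef sum_distrib_right)
    finally show ?thesis using q by simp
  qed
qed

text \<open>A double root makes the resultant vanish modulo \<open>p\<close>, but if
  \<open>p\<close> divides the leading coefficient, the division by it could remove this factor. In
  that case the first column of the Sylvester matrix is divided by the leading coefficient before
  expanding along it; every cofactor is still divisible by \<open>p\<close>, because the powers of
  \<open>a\<close> without the first one form a kernel vector of each minor.\<close>

lemma double_root_dvd_discriminant:
  fixes P :: "int poly"
  assumes p: "prime p" and deg: "degree P \<ge> 2" and root: "p dvd poly P a" "p dvd poly (pderiv P) a"
  shows "p dvd poly_discriminant P"
proof -
  let ?S = "sylvester_mat P (pderiv P)" and ?N = "degree P + degree (pderiv P)" and ?c = "lead_coeff P"
  have N: "?N \<ge> 2" using deg by simp
  have c0: "?c \<noteq> 0" using deg by auto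
  have S: "?S \<in> carrier_mat ?N ?N" by (rule sylvester_carrier_mat)
  obtain D where D: "resultant P (pderiv P) = ?c * D"
    using lead_coeff_dvd_resultant_pderiv[of P] deg by auto
  have "p dvd D"
  proof (cases "p dvd ?c")
    case False
    have "p dvd det ?S"
    proof (rule dvd_det_if_kernel[OF S])
      show "vec ?N (\<lambda>j. a ^ (?N - 1 - j)) \<in> carrier_vec ?N" by simp
      show "?N - 1 < ?N" "vec_index (vec ?N (\<lambda>j. a ^ (?N - 1 - j))) (?N - 1) = 1" using N by auto
      fix i assume "i < ?N"
      then show "p dvd (\<Sum>j<?N. ?S $$ (i, j) * vec_index (vec ?N (\<lambda>j. a ^ (?N - 1 - j))) j)"
        using sylvester_mult_powers[OF _ root] by simp
    qed
    then show ?thesis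
      using D False p by (simp add: resultant_def prime_dvd_mult_iff)
  next
    case True
    have cS: "?c dvd ?S $$ (i, 0)" if "i < ?N" for i
    proof -
      have "coeff (pderiv P) (degree P - 1) = of_nat (degree P) * ?c"
        using deg by (simp add: coeff_pderiv)
      moreover have "degree (pderiv P) = degree P - 1" by (rule degree_pderiv)
      moreover have "i = degree P - 1" if "Suc i \<le> degree P" "\<not> i < degree P - 1"
        using that by linarith
      ultimately show ?thesis
        using that deg by (auto simp: sylvester_index_mat)
    qed
    have cof: "p dvd cofactor ?S i 0" if i: "i < ?N" for i
    proof -
      have "p dvd det (mat_delete ?S i 0)"
      proof (rule dvd_det_if_kernel[of _ "?N - 1"])
        let ?x = "vec (?N - 1) (\<lambda>j. a ^ (?N - 1 - Suc j))"
        show "mat_delete ?S i 0 \<in> carrier_mat (?N - 1) (?N - 1)"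
          using S by (rule mat_delete_carrier)
        show "?x \<in> carrier_vec (?N - 1)" by simp
        show "?N - 2 < ?N - 1" "vec_index ?x (?N - 2) = 1" using N by auto
        fix l assume l: "l < ?N - 1"
        define l' where "l' = insert_index i l"
        have l': "l' < ?N" using l by (auto simp: l'_def insert_index_def)
        have SucN: "Suc (?N - 1) = ?N" using N by linarith
        have "mat_delete ?S i 0 $$ (l, j) = ?S $$ (l', Suc j)" if "j < ?N - 1" for j
          using mat_delete_index[of ?S "?N - 1" i 0 l j] i l that deg unfolding SucN
          by (simp add: l'_def sylvester_carrier_mat)
        then have "(\<Sum>j<?N - 1. mat_delete ?S i 0 $$ (l, j) * vec_index ?x j)
            = (\<Sum>j<?N - 1. ?S $$ (l', Suc j) * a ^ (?N - 1 - Suc j))"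
          by simp
        \<comment> \<open>Deleting the first column changes the row sum by a multiple of
          \<open>p\<close>, since the leading coefficient divides that column and \<open>p\<close>
          divides the leading coefficient.\<close>
        also have "\<dots> = (\<Sum>j<Suc (?N - 1). ?S $$ (l', j) * a ^ (?N - 1 - j)) - ?S $$ (l', 0) * a ^ (?N - 1)"
          by (simp only: sum.lessThan_Suc_shift) simp
        also have "p dvd \<dots>"
          unfolding SucN
          by (intro dvd_diff sylvester_mult_powers[OF l' root] dvd_mult2 dvd_trans[OF True cS[OF l']])
        finally show "p dvd (\<Sum>j<?N - 1. mat_delete ?S i 0 $$ (l, j) * vec_index ?x j)" .
      qed
      then show ?thesis by (simp add: cofactor_def)
    qed
    have "?c * D = (\<Sum>i<?N. ?S $$ (i, 0) * cofactor ?S i 0)"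
      unfolding D[symmetric] resultant_def by (rule laplace_expansion_column[OF S]) (use N in auto)
    also have "\<dots> = (\<Sum>i<?N. ?c * (?S $$ (i, 0) div ?c * cofactor ?S i 0))"
    proof (rule sum.cong[OF refl])
      fix i assume "i \<in> {..<?N}"
      then have "i < ?N" by (rule lessThan_iff[THEN iffD1])
      from dvd_mult_div_cancel[OF cS[OF this]]
      show "?S $$ (i, 0) * cofactor ?S i 0 = ?c * (?S $$ (i, 0) div ?c * cofactor ?S i 0)"
        by (simp only: mult.assoc[symmetric])
    qed
    also have "\<dots> = ?c * (\<Sum>i<?N. ?S $$ (i, 0) div ?c * cofactor ?S i 0)"
      by (rule sum_distrib_left[symmetric])
    finally have "D = (\<Sum>i<?N. ?S $$ (i, 0) div ?c * cofactor ?S i 0)"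
      using c0 by (simp only: mult_cancel_left) simp
    then show ?thesis
      by (simp only:) (intro dvd_sum dvd_mult cof, simp)
  qed
  then show ?thesis
    using c0 by (simp add: poly_discriminant_def D)
qed

text \<open>An irreducible common factor of \<open>Q\<close> and its derivative would be associated
  to some \<open>Qs ! i\<close>. That polynomial would divide either the product of the others,
  against coprimality, or its own derivative, against the degree. The result makes the set of primes
  dividing \<open>D\<close> finite, so that \<open>Delta_factor\<close> is a genuine
  product.\<close>

lemma discriminant_nonzero:
  fixes Qs :: "int poly list"
  assumes irr: "\<And>j. j < length Qs \<Longrightarrow> irreducible (Qs ! j)"
    and cop: "\<And>i j. i < length Qs \<Longrightarrow> j < length Qs \<Longrightarrow> i \<noteq> j \<Longrightarrow> coprime (Qs ! i) (Qs ! j)"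
    and deg: "\<And>j. j < length Qs \<Longrightarrow> degree (Qs ! j) > 0"
    and ne: "Qs \<noteq> []"
  shows "poly_discriminant (prod_list Qs) \<noteq> 0"
proof -
  define Q where "Q = prod_list Qs"
  have Q0: "Q \<noteq> 0"
    using deg unfolding Q_def prod_list_zero_iff by (metis degree_0 in_set_conv_nth less_irrefl)
  have "Qs ! 0 dvd Q"
    unfolding Q_def using ne by (cases Qs) auto
  then have degQ: "degree Q > 0"
    using dvd_imp_degree_le[OF _ Q0] deg[of 0] ne by fastforce
  have mem: "\<exists>x\<in>set xs. h dvd x" if "prime_elem h" "h dvd prod_list xs" for h :: "int poly" and xs
    using that(2)
  proof (induction xs)
    case Nil
    then show ?case using that(1) by (auto simp: prime_elem_def)
  next
    case (Cons x xs)
    then show ?case using that(1) by (auto simp: prime_elem_dvd_mult_iff)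
  qed
  have "resultant Q (pderiv Q) \<noteq> 0"
  proof
    assume "resultant Q (pderiv Q) = 0"
    then have "degree (gcd Q (pderiv Q)) \<noteq> 0"
      by (simp add: resultant_0_gcd)
    then have "\<not> is_unit (gcd Q (pderiv Q))" "gcd Q (pderiv Q) \<noteq> 0"
      by (auto simp: is_unit_iff_degree poly_dvd_1)
    then obtain h where h: "prime h" "h dvd gcd Q (pderiv Q)"
      using prime_divisor_exists by blast
    then have hQ: "prime_elem h" "h dvd Q" "h dvd pderiv Q" by auto
    obtain i where i: "i < length Qs" "h dvd Qs ! i"
      using mem[OF hQ(1), of Qs] hQ(2) by (auto simp: Q_def in_set_conv_nth)
    let ?q = "Qs ! i"
    have qh: "?q dvd h"
      using irreducibleD'[OF irr[OF i(1)] i(2)] hQ(1) by (auto simp: prime_elem_def)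
    have qp: "prime_elem ?q"
      using irr[OF i(1)] by (simp add: irreducible_imp_prime_elem_gcd)
    define xs ys where "xs = take i Qs" and "ys = drop (Suc i) Qs"
    have Qs: "Qs = xs @ ?q # ys"
      using id_take_nth_drop[OF i(1)] by (simp add: xs_def ys_def)
    have "Q = ?q * (prod_list xs * prod_list ys)"
      unfolding Q_def by (subst Qs) (simp add: mult_ac)
    then have "pderiv Q = ?q * pderiv (prod_list xs * prod_list ys) + prod_list xs * prod_list ys * pderiv ?q"
      by (simp only: pderiv_mult)
    moreover have "?q dvd pderiv Q" using qh hQ(3) by (rule dvd_trans)
    ultimately have "?q dvd prod_list xs * prod_list ys * pderiv ?q"
      by (simp add: dvd_add_right_iff)
    then consider "?q dvd prod_list (xs @ ys)" | "?q dvd pderiv ?q"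
      using qp by (auto simp: prime_elem_dvd_mult_iff)
    then show False
    proof cases
      case 1
      then obtain x where x: "x \<in> set (xs @ ys)" "?q dvd x" using mem[OF qp] by blast
      have "\<exists>j<length Qs. j \<noteq> i \<and> x = Qs ! j"
        using x(1) i(1) unfolding xs_def ys_def set_append
      proof (elim UnE)
        assume "x \<in> set (take i Qs)"
        then obtain l where "l < i" "x = Qs ! l"
          using i(1) by (auto simp: in_set_conv_nth)
        then show ?thesis using i(1) by (intro exI[of _ l]) auto
      next
        assume "x \<in> set (drop (Suc i) Qs)"
        then obtain l where "l < length Qs - Suc i" "x = Qs ! (Suc i + l)"
          by (auto simp: in_set_conv_nth)
        then show ?thesis by (intro exI[of _ "Suc i + l"]) auto
      qed
      then obtain j where j: "j < length Qs" "j \<noteq> i" "x = Qs ! j" by blast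
      have "coprime ?q x" using cop[OF i(1) j(1)] j by auto
      then have "is_unit ?q" using x(2) by (metis coprime_common_divisor dvd_refl)
      then show False using qp by (auto simp: prime_elem_def)
    next
      case 2
      have "pderiv ?q \<noteq> 0" using deg[OF i(1)] by (simp add: pderiv_eq_0_iff)
      then have "degree ?q \<le> degree (pderiv ?q)" using 2 by (rule dvd_imp_degree_le[rotated])
      then show False using deg[OF i(1)] by (simp add: degree_pderiv)
    qed
  qed
  moreover obtain d where "resultant Q (pderiv Q) = lead_coeff Q * d"
    using lead_coeff_dvd_resultant_pderiv[OF degQ] by auto
  ultimately show ?thesis
    using Q0 by (auto simp: poly_discriminant_def simp flip: Q_def)
qed

section \<open>Size-restricted sums of multiplicative weights\<close>

text \<open>With \<open>sz = sum_list\<close> a choice encodes a tuple of integers composed of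
  primes in \<open>P\<close> by its exponent vector at each prime, and the bounded quantity is the
  product of the entries. This encoding lets one prime be split off at a time
  (\<open>choice_sum_insert\<close>).\<close>

definition bounded_choices :: "('v \<Rightarrow> nat) \<Rightarrow> 'v set \<Rightarrow> nat set \<Rightarrow> real \<Rightarrow> (nat \<Rightarrow> 'v) set" where
  "bounded_choices sz N P X = {e \<in> PiE P (\<lambda>_. N). (\<Prod>p\<in>P. real p ^ sz (e p)) \<le> X}"

definition choice_sum :: "('v \<Rightarrow> nat) \<Rightarrow> 'v set \<Rightarrow> (nat \<Rightarrow> 'v \<Rightarrow> real) \<Rightarrow> nat set \<Rightarrow> real \<Rightarrow> real" where
  "choice_sum sz N G P X = (\<Sum>e\<in>bounded_choices sz N P X. \<Prod>p\<in>P. G p (e p))"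

lemma finite_bounded_choices: "finite N \<Longrightarrow> finite P \<Longrightarrow> finite (bounded_choices sz N P X)"
  unfolding bounded_choices_def by (rule finite_subset[of _ "PiE P (\<lambda>_. N)"]) (auto intro: finite_PiE)

lemma bounded_choices_mono: "X \<le> Y \<Longrightarrow> bounded_choices sz N P X \<subseteq> bounded_choices sz N P Y"
  by (auto simp: bounded_choices_def)

lemma choice_sum_insert:
  assumes fin: "finite N" "finite P" and p: "p \<notin> P" "p > 0"
  shows "choice_sum sz N G (insert p P) X = (\<Sum>\<nu>\<in>N. G p \<nu> * choice_sum sz N G P (X / real p ^ sz \<nu>))"
proof -
  let ?f = "\<lambda>(\<nu>, e). e(p := \<nu>)"
  let ?S = "SIGMA \<nu>:N. bounded_choices sz N P (X / real p ^ sz \<nu>)"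
  have upd: "(\<Prod>q\<in>P. h q ((e(p := \<nu>)) q)) = (\<Prod>q\<in>P. h q (e q))"
    for h :: "nat \<Rightarrow> 'a \<Rightarrow> real" and e \<nu>
    using p by (intro prod.cong refl) auto
  have "bij_betw ?f ?S (bounded_choices sz N (insert p P) X)"
  proof (rule bij_betwI[where g = "\<lambda>e. (e p, e(p := undefined))"])
    show "?f \<in> ?S \<rightarrow> bounded_choices sz N (insert p P) X"
    proof
      fix a assume "a \<in> ?S"
      then obtain \<nu> e where a: "a = (\<nu>, e)" "\<nu> \<in> N" "e \<in> PiE P (\<lambda>_. N)"
        "(\<Prod>q\<in>P. real q ^ sz (e q)) \<le> X / real p ^ sz \<nu>"
        by (auto simp: bounded_choices_def)
      then have "real p ^ sz \<nu> * (\<Prod>q\<in>P. real q ^ sz (e q)) \<le> X"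
        using p by (simp add: field_simps)
      then show "?f a \<in> bounded_choices sz N (insert p P) X"
        using a p fin upd[of "\<lambda>q x. real q ^ sz x" e \<nu>] by (auto simp: bounded_choices_def PiE_iff extensional_def)
    qed
    show "(\<lambda>e. (e p, e(p := undefined))) \<in> bounded_choices sz N (insert p P) X \<rightarrow> ?S"
    proof
      fix e assume e: "e \<in> bounded_choices sz N (insert p P) X"
      then have "real p ^ sz (e p) * (\<Prod>q\<in>P. real q ^ sz (e q)) \<le> X"
        using p fin by (simp add: bounded_choices_def)
      then show "(e p, e(p := undefined)) \<in> ?S"
        using e p upd[of "\<lambda>q x. real q ^ sz x" e undefined]
        by (auto simp: bounded_choices_def PiE_iff extensional_def field_simps)
    qed
    show "(\<lambda>e. (e p, e(p := undefined))) (?f a) = a" if "a \<in> ?S" for a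
      using that p by (auto simp: bounded_choices_def PiE_iff extensional_def fun_eq_iff)
    show "?f ((\<lambda>e. (e p, e(p := undefined))) e) = e" for e
      by simp
  qed
  then have "choice_sum sz N G (insert p P) X = (\<Sum>a\<in>?S. \<Prod>q\<in>insert p P. G q (?f a q))"
    unfolding choice_sum_def by (rule sum.reindex_bij_betw[symmetric])
  also have "\<dots> = (\<Sum>a\<in>?S. case a of (\<nu>, e) \<Rightarrow> G p \<nu> * (\<Prod>q\<in>P. G q (e q)))"
  proof (intro sum.cong refl)
    fix a assume "a \<in> ?S"
    obtain \<nu> e where a: "a = (\<nu>, e)" by (cases a)
    show "(\<Prod>q\<in>insert p P. G q (?f a q)) = (case a of (\<nu>, e) \<Rightarrow> G p \<nu> * (\<Prod>q\<in>P. G q (e q)))"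
      using fin p upd[of G e \<nu>] by (simp add: a)
  qed
  also have "\<dots> = (\<Sum>\<nu>\<in>N. \<Sum>e\<in>bounded_choices sz N P (X / real p ^ sz \<nu>). G p \<nu> * (\<Prod>q\<in>P. G q (e q)))"
    using fin by (subst sum.Sigma) (auto intro: finite_bounded_choices)
  finally show ?thesis
    by (simp add: choice_sum_def sum_distrib_left)
qed

lemma choice_sum_nonneg:
  assumes "\<And>p \<nu>. p \<in> P \<Longrightarrow> \<nu> \<in> N \<Longrightarrow> 0 \<le> G p \<nu>"
  shows "0 \<le> choice_sum sz N G P X"
  unfolding choice_sum_def using assms
  by (auto intro!: sum_nonneg prod_nonneg simp: bounded_choices_def PiE_iff)

lemma choice_sum_mono_bound:
  assumes "finite N" "finite P" "X \<le> Y" "\<And>p \<nu>. p \<in> P \<Longrightarrow> \<nu> \<in> N \<Longrightarrow> 0 \<le> G p \<nu>"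
  shows "choice_sum sz N G P X \<le> choice_sum sz N G P Y"
  unfolding choice_sum_def using assms
  by (intro sum_mono2 bounded_choices_mono finite_bounded_choices)
     (auto intro!: prod_nonneg simp: bounded_choices_def PiE_iff)

text \<open>Because of the cut these sums are not Euler products, yet they compare as if they were.
  \<open>G\<close> is replaced by \<open>H\<close> at one prime after the other: the additional
  weight \<open>H - G\<close> at an exponent comes with the smaller cut \<open>X / p ^ sz\<close>,
  and the sum with that cut is at most the sum over \<open>insert p P\<close> with cut
  \<open>X\<close>, already by the choices that are trivial at \<open>p\<close>.\<close>

lemma choice_sum_compare:
  assumes N: "finite N" "o\<^sub>N \<in> N" "sz o\<^sub>N = 0" and P: "finite P" "\<And>p. p \<in> P \<Longrightarrow> p > 0"
    and G: "\<And>p \<nu>. p \<in> P \<Longrightarrow> \<nu> \<in> N \<Longrightarrow> 0 \<le> G p \<nu>" "\<And>p \<nu>. p \<in> P \<Longrightarrow> \<nu> \<in> N \<Longrightarrow> G p \<nu> \<le> H p \<nu>"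
    and one: "\<And>p. p \<in> P \<Longrightarrow> G p o\<^sub>N = 1" "\<And>p. p \<in> P \<Longrightarrow> H p o\<^sub>N = 1"
  shows "choice_sum sz N H P X \<le> (\<Prod>p\<in>P. 1 + (\<Sum>\<nu>\<in>N - {o\<^sub>N}. H p \<nu> - G p \<nu>)) * choice_sum sz N G P X"
  using P G one
proof (induction P arbitrary: X rule: finite_induct)
  case empty
  then show ?case by (simp add: choice_sum_def)
next
  case (insert p P)
  let ?h = "\<lambda>p. \<Sum>\<nu>\<in>N - {o\<^sub>N}. H p \<nu> - G p \<nu>"
  let ?E = "\<Prod>p\<in>P. 1 + ?h p"
  have IH: "choice_sum sz N H P X \<le> ?E * choice_sum sz N G P X" for X
    using insert by auto
  have E: "0 \<le> ?E"
    using insert.prems by (intro prod_nonneg add_nonneg_nonneg sum_nonneg) (auto simp: diff_ge_0_iff_ge)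
  have Gp: "0 \<le> G p \<nu>" "G p \<nu> \<le> H p \<nu>" if "\<nu> \<in> N" for \<nu>
    using insert.prems that by auto
  have S0: "0 \<le> choice_sum sz N G P X" for X
    using insert.prems by (intro choice_sum_nonneg) auto
  have p: "p > 0" using insert.prems by auto
  have "choice_sum sz N H (insert p P) X = (\<Sum>\<nu>\<in>N. H p \<nu> * choice_sum sz N H P (X / real p ^ sz \<nu>))"
    by (rule choice_sum_insert[OF N(1) insert.hyps p])
  also have "\<dots> \<le> (\<Sum>\<nu>\<in>N. H p \<nu> * (?E * choice_sum sz N G P (X / real p ^ sz \<nu>)))"
    by (intro sum_mono mult_left_mono IH) (use Gp in \<open>auto intro: order_trans\<close>)
  also have "\<dots> = ?E * (\<Sum>\<nu>\<in>N. H p \<nu> * choice_sum sz N G P (X / real p ^ sz \<nu>))"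
    by (subst sum_distrib_left) (intro sum.cong refl, simp only: mult_ac)
  also have "(\<Sum>\<nu>\<in>N. H p \<nu> * choice_sum sz N G P (X / real p ^ sz \<nu>))
      = (\<Sum>\<nu>\<in>N. G p \<nu> * choice_sum sz N G P (X / real p ^ sz \<nu>))
        + (\<Sum>\<nu>\<in>N. (H p \<nu> - G p \<nu>) * choice_sum sz N G P (X / real p ^ sz \<nu>))"
    by (simp add: algebra_simps flip: sum.distrib)
  also have "(\<Sum>\<nu>\<in>N. G p \<nu> * choice_sum sz N G P (X / real p ^ sz \<nu>)) = choice_sum sz N G (insert p P) X"
    by (rule choice_sum_insert[OF N(1) insert.hyps p, symmetric])
  also have "(\<Sum>\<nu>\<in>N. (H p \<nu> - G p \<nu>) * choice_sum sz N G P (X / real p ^ sz \<nu>))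
      = (\<Sum>\<nu>\<in>N - {o\<^sub>N}. (H p \<nu> - G p \<nu>) * choice_sum sz N G P (X / real p ^ sz \<nu>))"
    using N insert.prems by (subst sum.remove[OF N(1,2)]) simp
  also have "\<dots> \<le> (\<Sum>\<nu>\<in>N - {o\<^sub>N}. (H p \<nu> - G p \<nu>) * choice_sum sz N G (insert p P) X)"
  proof (intro sum_mono mult_left_mono)
    fix \<nu> assume \<nu>: "\<nu> \<in> N - {o\<^sub>N}"
    show "0 \<le> H p \<nu> - G p \<nu>" using Gp \<nu> by auto
    show "choice_sum sz N G P (X / real p ^ sz \<nu>) \<le> choice_sum sz N G (insert p P) X"
    proof (cases "0 \<le> X")
      case True
      have "X / real p ^ sz \<nu> \<le> X / 1"
        using True p by (intro divide_left_mono) auto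
      then have "choice_sum sz N G P (X / real p ^ sz \<nu>) \<le> choice_sum sz N G P X"
        using insert.prems insert.hyps N by (intro choice_sum_mono_bound) auto
      also have "\<dots> = G p o\<^sub>N * choice_sum sz N G P (X / real p ^ sz o\<^sub>N)"
        using insert.prems N by simp
      also have "\<dots> \<le> choice_sum sz N G (insert p P) X"
        unfolding choice_sum_insert[OF N(1) insert.hyps p]
        by (rule member_le_sum[OF N(2) _ N(1)]) (use Gp S0 in auto)
      finally show ?thesis .
    next
      \<comment> \<open>For negative \<open>X\<close> dividing by a power of \<open>p\<close> would
        raise the cut, but no choice is admissible then.\<close>
      case False
      have "X / real p ^ sz \<nu> < 0"
        using False p by (simp add: divide_neg_pos)
      moreover have "0 \<le> (\<Prod>q\<in>P. real q ^ sz (e q))" for e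
        by (intro prod_nonneg) auto
      ultimately have "\<not> (\<Prod>q\<in>P. real q ^ sz (e q)) \<le> X / real p ^ sz \<nu>" for e
        by (meson not_le less_le_trans)
      then have "bounded_choices sz N P (X / real p ^ sz \<nu>) = {}"
        by (simp add: bounded_choices_def)
      then have "choice_sum sz N G P (X / real p ^ sz \<nu>) = 0"
        by (simp add: choice_sum_def)
      moreover have "0 \<le> choice_sum sz N G (insert p P) X"
        using insert.prems by (intro choice_sum_nonneg) auto
      ultimately show ?thesis by simp
    qed
  qed
  also have "\<dots> = ?h p * choice_sum sz N G (insert p P) X"
    by (simp add: sum_distrib_right)
  also have "?E * (choice_sum sz N G (insert p P) X + ?h p * choice_sum sz N G (insert p P) X)
      = (\<Prod>p\<in>insert p P. 1 + ?h p) * choice_sum sz N G (insert p P) X"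
    using insert.hyps by (simp add: algebra_simps)
  finally show ?case using E by (simp add: mult_left_mono)
qed

section \<open>Local densities of a system of polynomials\<close>

lemma power_sum_list_dvd_prod_list:
  fixes a :: "'a :: comm_semiring_1"
  assumes "length \<nu> = length xs" "\<And>j. j < length xs \<Longrightarrow> a ^ (\<nu> ! j) dvd xs ! j"
  shows "a ^ sum_list \<nu> dvd prod_list xs"
  using assms
proof (induction \<nu> xs rule: list_induct2)
  case (Cons e \<nu> x xs)
  have "a ^ e dvd x" using Cons.prems[of 0] by simp
  moreover have "a ^ sum_list \<nu> dvd prod_list xs"
    using Cons.prems[of "Suc _"] by (intro Cons.IH) auto
  ultimately show ?case by (simp add: power_add mult_dvd_mono)
qed simp

lemma degree_prod_list_sum:
  fixes Ps :: "'a :: idom poly list"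
  assumes "0 \<notin> set Ps"
  shows "degree (prod_list Ps) = (\<Sum>j<length Ps. degree (Ps ! j))"
  using assms
proof (induction Ps)
  case (Cons P Ps)
  then have "prod_list Ps \<noteq> 0" "P \<noteq> 0" by (auto simp: prod_list_zero_iff)
  then show ?case
    using Cons by (simp add: degree_mult_eq sum.lessThan_Suc_shift del: sum.lessThan_Suc)
qed simp

lemma mem_dvd_prod_list: "x \<in> set xs \<Longrightarrow> (x :: 'a :: comm_monoid_mult) dvd prod_list xs"
  by (induction xs) (auto intro: dvd_mult)

lemma prime_dvd_prod_list:
  fixes p :: "'a :: factorial_semiring"
  assumes "prime p"
  shows "p dvd prod_list xs \<longleftrightarrow> (\<exists>x\<in>set xs. p dvd x)"
proof (induction xs)
  case Nil
  then show ?case using assms not_prime_unit by auto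
qed (use assms in \<open>auto simp: prime_dvd_mult_iff\<close>)

lemma mult_nth_dvd_prod_list:
  assumes "i < length xs" "j < length xs" "i \<noteq> j"
  shows "(xs ! i :: 'a :: comm_monoid_mult) * xs ! j dvd prod_list xs"
  using assms
proof (induction xs arbitrary: i j)
  case (Cons x xs)
  have *: "xs ! l dvd prod_list xs" if "l < length xs" for l
    using that by (intro mem_dvd_prod_list) simp
  show ?case
  proof (cases i; cases j)
    fix i' j' assume "i = Suc i'" "j = Suc j'"
    then show ?thesis using Cons by auto
  qed (use Cons.prems * in \<open>auto intro: mult_dvd_mono simp: mult.commute\<close>)
qed simp

locale poly_system =
  fixes Qs :: "int poly list" and Q :: "int poly" and g :: nat and D :: int
  assumes Q_eq: "Q = prod_list Qs" and degree_Q: "degree Q = g" and D_eq: "D = poly_discriminant Q"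
    and no_fixed: "\<And>p. \<not> fixed_prime_divisor p Q"
    and degree_pos: "\<And>P. P \<in> set Qs \<Longrightarrow> degree P > 0"
    and nonempty: "Qs \<noteq> []" and D_nonzero: "D \<noteq> 0"
begin

definition zero_vec :: "nat list" where
  "zero_vec = replicate (length Qs) 0"

definition exponents :: "nat \<Rightarrow> nat list set" where
  "exponents L = {\<nu>. length \<nu> = length Qs \<and> set \<nu> \<subseteq> {..L}}"

text \<open>Exact valuations of all polynomials at \<open>n\<close>, expressed by divisibility
  instead of \<open>multiplicity\<close>: the condition is visibly periodic modulo a power of
  \<open>p\<close> and fails wherever a polynomial vanishes.\<close>

definition event :: "nat \<Rightarrow> nat list \<Rightarrow> nat \<Rightarrow> bool" where
  "event p \<nu> n \<longleftrightarrow> (\<forall>j < length Qs. int p ^ (\<nu> ! j) dvd poly (Qs ! j) (int n)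
      \<and> \<not> int p ^ Suc (\<nu> ! j) dvd poly (Qs ! j) (int n))"

definition w :: "nat \<Rightarrow> real" where
  "w p = real (rho Q p) / real p"

lemma Qs_nonzero: "0 \<notin> set Qs"
  using degree_pos by fastforce

lemma degree_sum: "(\<Sum>j<length Qs. degree (Qs ! j)) = g"
  using degree_prod_list_sum[OF Qs_nonzero] by (simp add: degree_Q flip: Q_eq)

lemma g_pos: "g \<ge> 1"
proof -
  have "degree (Qs ! 0) \<le> (\<Sum>j<length Qs. degree (Qs ! j))"
    by (rule member_le_sum) (use nonempty in auto)
  moreover have "degree (Qs ! 0) > 0"
    using nonempty by (intro degree_pos) auto
  ultimately show ?thesis by (simp add: degree_sum)
qed

lemma nonroot: "prime p \<Longrightarrow> \<exists>n::nat. \<not> int p dvd poly Q (int n)"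
  using no_fixed[of p] by (auto simp: fixed_prime_divisor_def)

lemma primitive_Q:
  assumes "prime p"
  shows "\<exists>i. \<not> int p dvd coeff Q i"
proof (rule ccontr)
  assume "\<not> ?thesis"
  then have "int p dvd poly Q x" for x
    by (auto simp: poly_altdef intro!: dvd_sum)
  then show False using nonroot[OF assms] by blast
qed

lemma primitive_nth:
  assumes "prime p" "j < length Qs"
  shows "\<exists>i. \<not> int p dvd coeff (Qs ! j) i"
proof (rule ccontr)
  assume "\<not> ?thesis"
  then have "[:int p:] dvd Qs ! j" by (simp add: const_poly_dvd_iff)
  also have "Qs ! j dvd Q"
    unfolding Q_eq using assms by (intro mem_dvd_prod_list) simp
  finally show False using primitive_Q[OF assms(1)] by (simp add: const_poly_dvd_iff)
qed

lemma density_Q: "prime p \<Longrightarrow> density (\<lambda>n. int p dvd poly Q (int n)) = w p"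
  by (simp add: w_def density_dvd_poly prime_gt_0_nat)

lemma density_Q_power_le:
  assumes "prime p" "m \<ge> 1"
  shows "density (\<lambda>n. int p ^ m dvd poly Q (int n)) \<le> real g * real p powr (- (real m / real g))"
  using density_prime_power_dvd_le_powr[OF assms(1) primitive_Q[OF assms(1)] assms(2)] g_pos
  by (simp add: degree_Q)

lemma rho_le_g:
  assumes "prime p"
  shows "real (rho Q p) \<le> real g"
proof -
  have "w p \<le> real g / real p ^ 1"
    using density_prime_power_dvd_le[OF assms primitive_Q[OF assms], of 1 1] assms
    by (simp add: density_Q degree_Q)
  then show ?thesis
    using assms by (simp add: w_def divide_le_cancel prime_gt_0_nat)
qed

lemma rho_le_pred:
  assumes "prime p"
  shows "real (rho Q p) \<le> real p - 1"
proof -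
  have p0: "p > 0" using assms by (simp add: prime_gt_0_nat)
  obtain n :: nat where n: "\<not> int p dvd poly Q (int n)"
    using nonroot[OF assms] by blast
  then have "\<not> int p dvd poly Q (int (n mod p))"
    using periodic_mod[OF periodic_dvd_poly[OF p0]] by blast
  then have "n mod p \<in> {0..<p}" "n mod p \<notin> {m \<in> {0..<p}. int p dvd poly Q (int m)}"
    using p0 by auto
  then have "{m \<in> {0..<p}. int p dvd poly Q (int m)} \<subset> {0..<p}"
    by blast
  then have "rho Q p < p"
    unfolding rho_def using psubset_card_mono[of "{0..<p}" "{m \<in> {0..<p}. int p dvd poly Q (int m)}"] by simp
  then show ?thesis by linarith
qed

lemma w_bounds:
  assumes "prime p"
  shows "0 \<le> w p" "w p < 1" "w p \<le> real g / real p"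
  using rho_le_pred[OF assms] rho_le_g[OF assms] prime_gt_0_nat[OF assms]
  by (auto simp: w_def field_simps)

lemma finite_exponents [simp]: "finite (exponents L)"
proof -
  have "exponents L = {\<nu>. set \<nu> \<subseteq> {..L} \<and> length \<nu> = length Qs}"
    by (auto simp: exponents_def)
  then show ?thesis by (simp add: finite_lists_length_eq)
qed

lemma zero_vec_in [simp]: "zero_vec \<in> exponents L"
  by (auto simp: zero_vec_def exponents_def)

lemma sum_list_zero_vec [simp]: "sum_list zero_vec = 0"
  by (simp add: zero_vec_def)

lemma sum_list_pos: "\<nu> \<in> exponents L \<Longrightarrow> \<nu> \<noteq> zero_vec \<Longrightarrow> sum_list \<nu> \<ge> 1"
proof (rule ccontr)
  assume \<nu>: "\<nu> \<in> exponents L" "\<nu> \<noteq> zero_vec" and small: "\<not> sum_list \<nu> \<ge> 1"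
  have "sum_list \<nu> = 0" using small by linarith
  then have "\<nu> = replicate (length Qs) 0"
    using \<nu> by (intro replicate_eqI) (auto simp: exponents_def)
  with \<nu> show False by (simp add: zero_vec_def)
qed

lemma periodic_event:
  assumes "p > 0" "\<And>j. j < length Qs \<Longrightarrow> \<nu> ! j \<le> M"
  shows "periodic (p ^ Suc M) (event p \<nu>)"
proof -
  have "periodic (p ^ Suc M) (\<lambda>n. int p ^ e dvd poly P (int n))" if "e \<le> Suc M" for e P
  proof -
    have "p ^ e dvd p ^ Suc M" using that by (rule le_imp_power_dvd)
    then show ?thesis
      using periodic_dvd[OF periodic_dvd_poly[of "p ^ e" P], of "p ^ Suc M"] assms(1) by simp
  qed
  then have *: "(int p ^ e dvd poly P (int (n + p ^ Suc M))) = (int p ^ e dvd poly P (int n))"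
    if "e \<le> Suc M" for e P n
    using that unfolding periodic_def by blast
  have "event p \<nu> (n + p ^ Suc M) = event p \<nu> n" for n
    unfolding event_def
  proof (intro all_cong)
    fix j assume "j < length Qs"
    then have "\<nu> ! j \<le> Suc M" "Suc (\<nu> ! j) \<le> Suc M" using assms(2) by (auto simp: le_SucI)
    then show "(int p ^ (\<nu> ! j) dvd poly (Qs ! j) (int (n + p ^ Suc M))
        \<and> \<not> int p ^ Suc (\<nu> ! j) dvd poly (Qs ! j) (int (n + p ^ Suc M)))
      = (int p ^ (\<nu> ! j) dvd poly (Qs ! j) (int n) \<and> \<not> int p ^ Suc (\<nu> ! j) dvd poly (Qs ! j) (int n))"
      by (simp only: *)
  qed
  then show ?thesis using assms(1) by (simp only: periodic_def) simp
qed

lemma periodic_event_sum_list: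
  assumes "p > 0" "length \<nu> = length Qs"
  shows "periodic (p ^ Suc (sum_list \<nu>)) (event p \<nu>)"
  by (rule periodic_event) (use assms in \<open>auto intro: elem_le_sum_list\<close>)

lemma event_unique:
  assumes "event p \<nu> n" "event p \<mu> n" "length \<nu> = length Qs" "length \<mu> = length Qs"
  shows "\<nu> = \<mu>"
proof (rule nth_equalityI)
  fix j assume "j < length \<nu>"
  then have j: "j < length Qs" using assms by simp
  have *: "a \<le> b" if "int p ^ a dvd y" "\<not> int p ^ Suc b dvd y" for a b y
  proof (rule ccontr)
    assume "\<not> a \<le> b"
    then have "int p ^ Suc b dvd int p ^ a" by (intro le_imp_power_dvd) simp
    then show False using that dvd_trans by blast
  qed
  have "\<nu> ! j \<le> \<mu> ! j" "\<mu> ! j \<le> \<nu> ! j"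
    by (rule *[of _ "poly (Qs ! j) (int n)"]; use assms(1,2) j in \<open>simp add: event_def\<close>)+
  then show "\<nu> ! j = \<mu> ! j" by simp
qed (use assms in simp)

lemma event_dvd:
  assumes "event p \<nu> n" "length \<nu> = length Qs"
  shows "int p ^ sum_list \<nu> dvd poly Q (int n)"
  unfolding Q_eq poly_prod_list
  by (rule power_sum_list_dvd_prod_list) (use assms in \<open>auto simp: event_def\<close>)

lemma event_zero_vec:
  assumes "prime p"
  shows "event p zero_vec n \<longleftrightarrow> \<not> int p dvd poly Q (int n)"
proof -
  have "int p dvd poly Q (int n) \<longleftrightarrow> (\<exists>P\<in>set Qs. int p dvd poly P (int n))"
  proof -
    have "prime (int p)" using assms by simp
    then show ?thesis
      unfolding Q_eq poly_prod_list by (subst prime_dvd_prod_list) auto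
  qed
  moreover have "(\<exists>P\<in>set Qs. int p dvd poly P (int n)) \<longleftrightarrow> (\<exists>j<length Qs. int p dvd poly (Qs ! j) (int n))"
    by (metis in_set_conv_nth)
  ultimately show ?thesis
    by (simp add: event_def zero_vec_def)
qed

text \<open>Exact valuations are unique, so events for different exponent vectors are disjoint and
  their densities add up.\<close>

lemma sum_density_event_le:
  assumes "p > 0" "M \<subseteq> exponents L" "\<exists>m. periodic m T" "\<And>\<nu> n. \<nu> \<in> M \<Longrightarrow> event p \<nu> n \<Longrightarrow> T n"
  shows "(\<Sum>\<nu>\<in>M. density (event p \<nu>)) \<le> density T"
proof (rule sum_density_le)
  show "finite M" using assms(2) finite_exponents finite_subset by blast
  show "\<exists>m. periodic m (event p \<nu>)" if "\<nu> \<in> M" for \<nu>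
    using periodic_event_sum_list[of p \<nu>] assms that by (auto simp: exponents_def)
  show "\<nu> = \<mu>" if "\<nu> \<in> M" "\<mu> \<in> M" "event p \<nu> n" "event p \<mu> n" for \<nu> \<mu> n
    using event_unique[OF that(3,4)] that assms by (auto simp: exponents_def)
qed (use assms in auto)

lemma sum_density_size_le:
  assumes p: "prime p" and m: "m \<ge> 1"
  shows "(\<Sum>\<nu> | \<nu> \<in> exponents L \<and> sum_list \<nu> = m. density (event p \<nu>)) \<le> real g * real p powr (- (real m / real g))"
proof -
  have p0: "p > 0" using p by (simp add: prime_gt_0_nat)
  have "(\<Sum>\<nu> | \<nu> \<in> exponents L \<and> sum_list \<nu> = m. density (event p \<nu>))
      \<le> density (\<lambda>n. int p ^ m dvd poly Q (int n))"
    using p0 periodic_dvd_poly[of "p ^ m" Q]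
    by (intro sum_density_event_le) (auto dest: event_dvd simp: exponents_def)
  also have "\<dots> \<le> real g * real p powr (- (real m / real g))"
    by (rule density_Q_power_le[OF p m])
  finally show ?thesis .
qed

lemma sum_density_nonzero_le:
  assumes p: "prime p" and M: "M \<subseteq> exponents L - {zero_vec}"
  shows "(\<Sum>\<nu>\<in>M. density (event p \<nu>)) \<le> real g / real p"
proof -
  have p0: "p > 0" using p by (simp add: prime_gt_0_nat)
  have "(\<Sum>\<nu>\<in>M. density (event p \<nu>)) \<le> density (\<lambda>n. int p dvd poly Q (int n))"
  proof (rule sum_density_event_le)
    fix \<nu> n assume \<nu>: "\<nu> \<in> M" "event p \<nu> n"
    then have "length \<nu> = length Qs" "sum_list \<nu> \<ge> 1"
      using M sum_list_pos[of \<nu> L] by (auto simp: exponents_def)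
    then have "int p ^ 1 dvd int p ^ sum_list \<nu>"
      by (intro le_imp_power_dvd)
    also have "\<dots> dvd poly Q (int n)"
      using \<nu> \<open>length \<nu> = length Qs\<close> by (intro event_dvd)
    finally show "int p dvd poly Q (int n)" by simp
  qed (use M p0 periodic_dvd_poly[of p Q] in auto)
  also have "\<dots> \<le> real g / real p"
    using p by (simp add: density_Q w_bounds)
  finally show ?thesis .
qed

lemma sum_density_large_le:
  assumes p: "prime p"
  shows "(\<Sum>\<nu> | \<nu> \<in> exponents L \<and> (\<exists>j<length Qs. degree (Qs ! j) < \<nu> ! j). density (event p \<nu>))
    \<le> real g / (real p)\<^sup>2"
proof -
  let ?S = "\<lambda>j n. int p ^ Suc (degree (Qs ! j)) dvd poly (Qs ! j) (int n)"
  let ?T = "\<lambda>n. \<exists>j<length Qs. ?S j n"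
  have p0: "p > 0" using p by (simp add: prime_gt_0_nat)
  have perS: "periodic (p ^ Suc (degree (Qs ! j))) (?S j)" for j
    using periodic_dvd_poly[of "p ^ Suc (degree (Qs ! j))" "Qs ! j"] p0 by simp
  have "\<exists>m. periodic m (\<lambda>n. True) \<and> (\<forall>j\<in>{..<length Qs}. periodic m (?S j))"
    by (rule common_period) (use perS in \<open>auto simp: periodic_def[of _ "\<lambda>n. True"]\<close>)
  then obtain m where "m > 0" "\<And>j. j < length Qs \<Longrightarrow> periodic m (?S j)"
    by (auto simp: periodic_def[of _ "\<lambda>n. True"])
  then have perT: "periodic m ?T"
    unfolding periodic_def by blast
  have "(\<Sum>\<nu> | \<nu> \<in> exponents L \<and> (\<exists>j<length Qs. degree (Qs ! j) < \<nu> ! j). density (event p \<nu>)) \<le> density ?T"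
  proof (rule sum_density_event_le[OF p0])
    fix \<nu> n assume \<nu>: "\<nu> \<in> {\<nu> \<in> exponents L. \<exists>j<length Qs. degree (Qs ! j) < \<nu> ! j}" and ev: "event p \<nu> n"
    then obtain j where j: "j < length Qs" "Suc (degree (Qs ! j)) \<le> \<nu> ! j" by (auto simp: Suc_le_eq)
    then have "int p ^ Suc (degree (Qs ! j)) dvd int p ^ (\<nu> ! j)" by (intro le_imp_power_dvd)
    also have "\<dots> dvd poly (Qs ! j) (int n)" using ev j by (auto simp: event_def)
    finally show "?T n" using j by blast
  qed (use perT in auto)
  also have "\<dots> \<le> (\<Sum>j<length Qs. density (?S j))"
    by (rule density_le_sum) (use perT perS in auto)
  also have "\<dots> \<le> (\<Sum>j<length Qs. real (degree (Qs ! j)) / (real p)\<^sup>2)"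
  proof (intro sum_mono)
    fix j assume "j \<in> {..<length Qs}"
    then show "density (?S j) \<le> real (degree (Qs ! j)) / (real p)\<^sup>2"
      using primitive_nth[OF p, of j] by (intro density_prime_power_dvd_le[OF p]) auto
  qed
  also have "\<dots> = real g / (real p)\<^sup>2"
    by (simp flip: degree_sum sum_divide_distrib)
  finally show ?thesis .
qed

end

section \<open>Weights attached to a multiplicative function\<close>

lemma bigomega_prime_power: "prime p \<Longrightarrow> Defs.bigomega (p ^ m) = m"
  by (simp add: Defs.bigomega_def prime_factorization_prime_power)

lemma prod_list_map_power: "prod_list (map (\<lambda>e. p ^ e) \<nu>) = (p :: 'a :: comm_monoid_mult) ^ sum_list \<nu>"
  by (induction \<nu>) (auto simp: power_add)

locale weighted_system = poly_system +
  fixes F :: "nat list \<Rightarrow> real" and A B \<epsilon> :: real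
  assumes F_class: "F \<in> class_M (length Qs) A B \<epsilon>" and F_mult: "multiplicative_fun (length Qs) F"
    and F_one: "F (replicate (length Qs) 1) = 1"
    and A_ge: "1 \<le> A" and B_ge: "1 \<le> B" and eps_pos: "0 < \<epsilon>"
begin

lemma F_nonneg: "ns \<in> pos_tuples (length Qs) \<Longrightarrow> 0 \<le> F ns"
  using F_class by (auto simp: class_M_def)

lemma F_prod_le:
  assumes "a \<in> pos_tuples (length Qs)" "b \<in> pos_tuples (length Qs)" "coprime (prod_list a) (prod_list b)"
  shows "F (map2 (*) a b) \<le> A ^ Defs.bigomega (prod_list a) * F b"
    and "F (map2 (*) a b) \<le> B * real (prod_list a) powr \<epsilon> * F b"
proof -
  have "F (map2 (*) a b) \<le> min (A ^ Defs.bigomega (prod_list a)) (B * real (prod_list a) powr \<epsilon>) * F b"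
    using F_class assms by (auto simp: class_M_def)
  moreover have "min (A ^ Defs.bigomega (prod_list a)) (B * real (prod_list a) powr \<epsilon>) * F b \<le> A ^ Defs.bigomega (prod_list a) * F b"
    "min (A ^ Defs.bigomega (prod_list a)) (B * real (prod_list a) powr \<epsilon>) * F b \<le> B * real (prod_list a) powr \<epsilon> * F b"
    using F_nonneg[OF assms(2)] by (auto intro!: mult_right_mono)
  ultimately show "F (map2 (*) a b) \<le> A ^ Defs.bigomega (prod_list a) * F b"
    "F (map2 (*) a b) \<le> B * real (prod_list a) powr \<epsilon> * F b" by linarith+
qed

lemma F_le:
  assumes a: "a \<in> pos_tuples (length Qs)"
  shows "F a \<le> A ^ Defs.bigomega (prod_list a)" and "F a \<le> B * real (prod_list a) powr \<epsilon>"
proof -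
  let ?one = "replicate (length Qs) (1::nat)"
  have "?one \<in> pos_tuples (length Qs)" by (simp add: pos_tuples_def)
  moreover have "map2 (*) a ?one = a"
    using a by (intro nth_equalityI) (auto simp: pos_tuples_def)
  ultimately show "F a \<le> A ^ Defs.bigomega (prod_list a)" "F a \<le> B * real (prod_list a) powr \<epsilon>"
    using F_prod_le[OF a, of ?one] F_one by simp_all
qed

definition f :: "nat \<Rightarrow> nat list \<Rightarrow> real" where
  "f p \<nu> = F (map (\<lambda>e. p ^ e) \<nu>)"

lemma prime_power_tuple:
  "prime p \<Longrightarrow> length \<nu> = length Qs \<Longrightarrow> map (\<lambda>e. p ^ e) \<nu> \<in> pos_tuples (length Qs)"
  by (auto simp: pos_tuples_def prime_gt_0_nat)

lemma f_bounds:
  assumes "prime p" "length \<nu> = length Qs"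
  shows "0 \<le> f p \<nu>" "f p \<nu> \<le> A ^ sum_list \<nu>" "f p \<nu> \<le> B * real p powr (\<epsilon> * real (sum_list \<nu>))"
proof -
  have "real p ^ sum_list \<nu> = real p powr real (sum_list \<nu>)"
    using assms(1) by (simp add: powr_realpow prime_gt_0_nat)
  then have "(real p ^ sum_list \<nu>) powr \<epsilon> = real p powr (\<epsilon> * real (sum_list \<nu>))"
    by (simp add: powr_powr mult.commute)
  then show "0 \<le> f p \<nu>" "f p \<nu> \<le> A ^ sum_list \<nu>" "f p \<nu> \<le> B * real p powr (\<epsilon> * real (sum_list \<nu>))"
    using F_nonneg[OF prime_power_tuple[OF assms]] F_le[OF prime_power_tuple[OF assms]] assms(1)
    by (simp_all add: f_def prod_list_map_power bigomega_prime_power)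
qed

definition h :: "nat \<Rightarrow> real" where
  "h p = 1 / (1 - w p)"

text \<open>\<open>w p\<close> can be close to 1 only for \<open>p < 2 * g\<close>. There the
  absence of a fixed prime divisor gives \<open>h p <= p\<close>, which is below
  \<open>4 * g ^ 2 / p\<close>.\<close>

lemma h_bounds:
  assumes p: "prime p"
  shows "1 \<le> h p" "h p \<le> 1 + 4 * (real g)\<^sup>2 / real p"
proof -
  have w: "0 \<le> w p" "w p < 1" "w p \<le> real g / real p"
    using w_bounds[OF p] by auto
  have p0: "real p > 0" using p by (simp add: prime_gt_0_nat)
  show "1 \<le> h p" using w by (simp add: h_def)
  show "h p \<le> 1 + 4 * (real g)\<^sup>2 / real p"
  proof (cases "real p < 2 * real g")
    case True
    have "1 / real p \<le> 1 - w p"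
      using rho_le_pred[OF p] p0 by (simp add: w_def field_simps)
    then have "h p \<le> real p"
      using w p0 by (simp add: h_def field_simps)
    also have "real p \<le> 4 * (real g)\<^sup>2 / real p"
      using True p0 mult_mono[of "real p" "2 * real g" "real p" "2 * real g"] by (simp add: field_simps power2_eq_square)
    finally show ?thesis by simp
  next
    case False
    then have w2: "w p \<le> 1/2"
      using w p0 order_trans[OF w(3), of "1/2"] by (simp add: field_simps)
    have "w p * w p \<le> w p * (1/2)" using w2 w by (intro mult_left_mono) auto
    then have "1 \<le> (1 - w p) * (1 + 2 * w p)"
      by (simp add: algebra_simps)
    then have "h p \<le> 1 + 2 * w p"
      using w by (simp add: h_def field_simps)
    also have "2 * w p \<le> 2 * (real g / real p)" using w by simp
    also have "2 * (real g / real p) \<le> 4 * (real g)\<^sup>2 / real p"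
      using g_pos p0 mult_mono[of 1 "real g" "real g" "real g"] by (auto simp: field_simps power2_eq_square)
    finally show ?thesis by simp
  qed
qed

text \<open>The weight \<open>twisted \<beta>\<close> carries Rankin's factor \<open>a powr \<beta>\<close> and compensates for the sieve
  factors at the primes dividing \<open>a\<close>; \<open>clean\<close> is the weight occurring in the main term.\<close>

definition twisted :: "real \<Rightarrow> nat \<Rightarrow> nat list \<Rightarrow> real" where
  "twisted \<beta> p \<nu> = (if \<nu> = zero_vec then 1
      else real p powr (\<beta> * real (sum_list \<nu>)) * h p * (f p \<nu> * density (event p \<nu>)))"

definition clean :: "nat \<Rightarrow> nat list \<Rightarrow> real" where
  "clean p \<nu> = (if \<nu> = zero_vec then 1 else if int p dvd D then 0 else f p \<nu> * density (event p \<nu>))"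

definition large :: "nat list \<Rightarrow> bool" where
  "large \<nu> \<longleftrightarrow> (\<exists>j<length Qs. degree (Qs ! j) < \<nu> ! j)"

text \<open>The part of the local weight that must be paid for by a constant: the twist and the
  sieve compensation beyond 1, plus the full weight of exponents exceeding a degree, which
  \<open>Delta_factor\<close> does not contain.\<close>

definition excess :: "real \<Rightarrow> nat \<Rightarrow> nat \<Rightarrow> real" where
  "excess \<beta> L p = (\<Sum>\<nu>\<in>exponents L - {zero_vec}.
      (real p powr (\<beta> * real (sum_list \<nu>)) * h p - 1 + (if large \<nu> then 1 else 0)) * (f p \<nu> * density (event p \<nu>)))"

text \<open>The first summand belongs to exponents of total size at most \<open>4 * g\<close>, where
  \<open>f\<close> is at most \<open>A ^ (4 * g)\<close>; the second to the larger ones, where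
  \<open>f\<close> is bounded through \<open>B\<close> and \<epsilon> and a geometric series
  remains.\<close>

definition excess_const :: "real \<Rightarrow> real" where
  "excess_const K = A ^ (4 * g) * real g * (exp (4 * real g * K) * (4 * (real g)\<^sup>2 + 4 * real g) + 1)
     + (1 + 4 * (real g)\<^sup>2) * B * real g * (1 / (1 - 2 powr (- (1 / (2 * real g)))))"

lemma density_f_nonneg: "prime p \<Longrightarrow> \<nu> \<in> exponents L \<Longrightarrow> 0 \<le> f p \<nu> * density (event p \<nu>)"
  using f_bounds[of p \<nu>] by (auto simp: exponents_def)

text \<open>At total exponent \<open>m\<close> the density is at most
  \<open>g * p powr (- m / g)\<close>, while twist and \<open>f\<close> together grow at most like
  \<open>p powr (m / (2 * g))\<close>. This leaves \<open>p powr (- m / (2 * g))\<close>, which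
  beyond \<open>m = 4 * g\<close> is \<open>1 / p ^ 2\<close> times a geometric tail with ratio at
  most \<open>2 powr (- 1 / (2 * g))\<close>.\<close>

lemma tail_sum_le:
  assumes p: "prime p" and bound: "\<beta> + \<epsilon> \<le> 1 / (2 * real g)"
  shows "(\<Sum>\<nu> | \<nu> \<in> exponents L \<and> 4 * g < sum_list \<nu>. real p powr (\<beta> * real (sum_list \<nu>)) * (f p \<nu> * density (event p \<nu>)))
    \<le> B * real g * (1 / (1 - 2 powr (- (1 / (2 * real g))))) * (1 / (real p)\<^sup>2)"
proof -
  let ?S = "{\<nu>. \<nu> \<in> exponents L \<and> 4 * g < sum_list \<nu>}"
  let ?I = "sum_list ` ?S"
  let ?q = "real p powr (- (1 / (2 * real g)))" and ?r = "2 powr (- (1 / (2 * real g)))"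
  have p2: "real p \<ge> 2" using prime_ge_2_nat[OF p] by simp
  have g: "real g > 0" using g_pos by simp
  have finS: "finite ?S" using finite_exponents[of L] by simp
  have r: "0 < ?r" "?r < 1"
    using g by (auto simp: powr_less_one)
  have q: "0 < ?q" "?q \<le> ?r" using p2 g by (auto intro!: powr_mono2')
  have inner: "(\<Sum>\<nu> | \<nu> \<in> ?S \<and> sum_list \<nu> = m. real p powr (\<beta> * real (sum_list \<nu>)) * (f p \<nu> * density (event p \<nu>)))
      \<le> B * real g * (1 / (real p)\<^sup>2) * ?r ^ (m - 4 * g)" if m: "m \<in> ?I" for m
  proof -
    have m4: "4 * g < m" using m by auto
    have "(\<Sum>\<nu> | \<nu> \<in> ?S \<and> sum_list \<nu> = m. real p powr (\<beta> * real (sum_list \<nu>)) * (f p \<nu> * density (event p \<nu>)))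
        \<le> (\<Sum>\<nu> | \<nu> \<in> ?S \<and> sum_list \<nu> = m. B * real p powr ((\<beta> + \<epsilon>) * real m) * density (event p \<nu>))"
    proof (intro sum_mono)
      fix \<nu> assume \<nu>: "\<nu> \<in> {\<nu>. \<nu> \<in> ?S \<and> sum_list \<nu> = m}"
      then have "f p \<nu> \<le> B * real p powr (\<epsilon> * real m)"
        using f_bounds(3)[OF p, of \<nu>] by (auto simp: exponents_def)
      then have "real p powr (\<beta> * real m) * (f p \<nu> * density (event p \<nu>))
          \<le> real p powr (\<beta> * real m) * ((B * real p powr (\<epsilon> * real m)) * density (event p \<nu>))"
        by (intro mult_left_mono mult_right_mono) auto
      then show "real p powr (\<beta> * real (sum_list \<nu>)) * (f p \<nu> * density (event p \<nu>))
          \<le> B * real p powr ((\<beta> + \<epsilon>) * real m) * density (event p \<nu>)"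
        using \<nu> by (simp add: powr_add algebra_simps)
    qed
    also have "\<dots> = B * real p powr ((\<beta> + \<epsilon>) * real m) * (\<Sum>\<nu> | \<nu> \<in> ?S \<and> sum_list \<nu> = m. density (event p \<nu>))"
      by (simp add: sum_distrib_left)
    also have "\<dots> \<le> B * real p powr ((\<beta> + \<epsilon>) * real m) * (real g * real p powr (- (real m / real g)))"
    proof (intro mult_left_mono)
      have "(\<Sum>\<nu> | \<nu> \<in> ?S \<and> sum_list \<nu> = m. density (event p \<nu>))
          \<le> (\<Sum>\<nu> | \<nu> \<in> exponents L \<and> sum_list \<nu> = m. density (event p \<nu>))"
        using finite_exponents[of L] by (intro sum_mono2) auto
      also have "\<dots> \<le> real g * real p powr (- (real m / real g))"
        using m4 by (intro sum_density_size_le[OF p]) auto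
      finally show "(\<Sum>\<nu> | \<nu> \<in> ?S \<and> sum_list \<nu> = m. density (event p \<nu>))
          \<le> real g * real p powr (- (real m / real g))" .
    qed (use B_ge in auto)
    also have "\<dots> = B * real g * (real p powr ((\<beta> + \<epsilon>) * real m) * real p powr (- (real m / real g)))"
      by (simp only: mult_ac)
    also have "\<dots> = B * real g * real p powr ((\<beta> + \<epsilon>) * real m + - (real m / real g))"
      by (simp only: powr_add)
    also have "\<dots> \<le> B * real g * real p powr (- 2 + - (1 / (2 * real g)) * real (m - 4 * g))"
    proof (intro mult_left_mono powr_mono)
      have "(\<beta> + \<epsilon>) * real m \<le> 1 / (2 * real g) * real m"
        using bound by (intro mult_right_mono) auto
      moreover have "- 2 + - (1 / (2 * real g)) * real (m - 4 * g) = - (1 / (2 * real g) * real m)"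
        using m4 g by (simp add: of_nat_diff field_simps)
      moreover have "real m / real g = 2 * (1 / (2 * real g) * real m)"
        using g by simp
      ultimately show "(\<beta> + \<epsilon>) * real m + - (real m / real g) \<le> - 2 + - (1 / (2 * real g)) * real (m - 4 * g)"
        by linarith
    qed (use p2 B_ge in auto)
    also have "real p powr (- 2 + - (1 / (2 * real g)) * real (m - 4 * g)) = (1 / (real p)\<^sup>2) * ?q ^ (m - 4 * g)"
    proof -
      have "real p powr (- 2) = 1 / (real p)\<^sup>2"
        using p2 by (simp add: powr_minus_divide)
      moreover have "real p powr (- (1 / (2 * real g)) * real (m - 4 * g)) = ?q ^ (m - 4 * g)"
        using q by (simp only: powr_powr[symmetric] powr_realpow)
      ultimately show ?thesis by (simp only: powr_add)
    qed
    also have "B * real g * ((1 / (real p)\<^sup>2) * ?q ^ (m - 4 * g)) \<le> B * real g * ((1 / (real p)\<^sup>2) * ?r ^ (m - 4 * g))"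
      using q B_ge by (intro mult_left_mono power_mono) auto
    finally show ?thesis by (simp only: mult.assoc)
  qed
  have "(\<Sum>\<nu>\<in>?S. real p powr (\<beta> * real (sum_list \<nu>)) * (f p \<nu> * density (event p \<nu>)))
      = (\<Sum>m\<in>?I. \<Sum>\<nu> | \<nu> \<in> ?S \<and> sum_list \<nu> = m. real p powr (\<beta> * real (sum_list \<nu>)) * (f p \<nu> * density (event p \<nu>)))"
    by (rule sum.image_gen[OF finS])
  also have "\<dots> \<le> (\<Sum>m\<in>?I. B * real g * (1 / (real p)\<^sup>2) * ?r ^ (m - 4 * g))"
    by (intro sum_mono inner)
  also have "\<dots> = B * real g * (1 / (real p)\<^sup>2) * (\<Sum>m\<in>?I. ?r ^ (m - 4 * g))"
    by (simp add: sum_distrib_left)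
  also have "\<dots> \<le> B * real g * (1 / (real p)\<^sup>2) * (1 / (1 - ?r))"
  proof (intro mult_left_mono)
    have "inj_on (\<lambda>m. m - 4 * g) ?I"
      by (rule inj_onI) auto
    then have "(\<Sum>m\<in>?I. ?r ^ (m - 4 * g)) = (\<Sum>i\<in>(\<lambda>m. m - 4 * g) ` ?I. ?r ^ i)"
      by (simp add: sum.reindex)
    also have "\<dots> \<le> (\<Sum>i. ?r ^ i)"
      using r finS by (intro sum_le_suminf summable_geometric) auto
    also have "\<dots> = 1 / (1 - ?r)"
      using r by (intro suminf_geometric) auto
    finally show "(\<Sum>m\<in>?I. ?r ^ (m - 4 * g)) \<le> 1 / (1 - ?r)" .
  qed (use B_ge in auto)
  finally show ?thesis by (simp only: mult_ac)
qed

end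

lemma exp_minus_one_le: "exp t - 1 \<le> t * exp (t :: real)"
proof -
  have "1 - t \<le> exp (- t)" using exp_ge_add_one_self[of "- t"] by simp
  then have "(1 - t) * exp t \<le> exp (- t) * exp t" by (intro mult_right_mono) auto
  then show ?thesis by (simp add: algebra_simps flip: exp_add)
qed

context weighted_system
begin

lemma weight_ge_1:
  assumes "prime p" "0 \<le> \<beta>"
  shows "1 \<le> real p powr (\<beta> * real m) * h p"
proof -
  have "1 * 1 \<le> real p powr (\<beta> * real m) * h p"
    using h_bounds(1)[OF assms(1)] assms prime_ge_1_nat[OF assms(1)]
    by (intro mult_mono ge_one_powr_ge_zero) auto
  then show ?thesis by simp
qed

lemma excess_nonneg:
  assumes "prime p" "0 \<le> \<beta>"
  shows "0 \<le> excess \<beta> L p"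
  unfolding excess_def
proof (intro sum_nonneg mult_nonneg_nonneg)
  fix \<nu> assume "\<nu> \<in> exponents L - {zero_vec}"
  then show "0 \<le> f p \<nu>" "0 \<le> density (event p \<nu>)"
    using f_bounds(1)[OF assms(1), of \<nu>] by (auto simp: exponents_def)
  show "0 \<le> real p powr (\<beta> * real (sum_list \<nu>)) * h p - 1 + (if large \<nu> then 1 else 0)"
    using weight_ge_1[OF assms, of "sum_list \<nu>"] by auto
qed

text \<open>The shape of the bound is dictated by summation over \<open>p <= W\<close>: the first
  part adds up to a multiple of \<open>\<beta> * ln W\<close>, hence of \<open>K\<close>, and the
  second converges.\<close>

lemma excess_le:
  assumes p: "prime p" and \<beta>: "0 \<le> \<beta>" "\<beta> * ln (real p) \<le> K" "\<beta> + \<epsilon> \<le> 1 / (2 * real g)"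
  shows "excess \<beta> L p \<le> excess_const K * (\<beta> * (ln (real p) / real p) + 1 / (real p)\<^sup>2)"
proof -
  let ?u = "\<lambda>\<nu>. real p powr (\<beta> * real (sum_list \<nu>)) * h p"
  let ?t = "\<lambda>\<nu>. (?u \<nu> - 1 + (if large \<nu> then 1 else 0)) * (f p \<nu> * density (event p \<nu>))"
  let ?S1 = "{\<nu> \<in> exponents L - {zero_vec}. sum_list \<nu> \<le> 4 * g}"
  let ?S2 = "{\<nu>. \<nu> \<in> exponents L \<and> 4 * g < sum_list \<nu>}"
  define b where "b = \<beta> * (ln (real p) / real p)"
  define c where "c = 1 / (real p)\<^sup>2"
  define E where "E = exp (4 * real g * K)"
  have p1: "real p \<ge> 1" using prime_ge_1_nat[OF p] by simp
  have bc: "0 \<le> b" "0 \<le> c" using p1 \<beta> by (auto simp: b_def c_def)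
  have AA: "A ^ (4 * g) \<ge> 1" using A_ge by (rule one_le_power)
  \<comment> \<open>The largest weight among exponents of total size at most
    \<open>4 * g\<close>.\<close>
  define U where "U = real p powr (\<beta> * real (4 * g)) * h p"
  have U1: "U \<ge> 1" unfolding U_def by (rule weight_ge_1[OF p \<beta>(1)])
  have split: "exponents L - {zero_vec} = ?S1 \<union> ?S2" by auto
  have "excess \<beta> L p = (\<Sum>\<nu>\<in>?S1 \<union> ?S2. ?t \<nu>)"
    unfolding excess_def by (rule sum.cong[OF split refl])
  also have "\<dots> = (\<Sum>\<nu>\<in>?S1. ?t \<nu>) + (\<Sum>\<nu>\<in>?S2. ?t \<nu>)"
    using finite_exponents[of L] by (intro sum.union_disjoint) auto
  finally have E12: "excess \<beta> L p = (\<Sum>\<nu>\<in>?S1. ?t \<nu>) + (\<Sum>\<nu>\<in>?S2. ?t \<nu>)" .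
  have "(\<Sum>\<nu>\<in>?S1. ?t \<nu>) \<le> (\<Sum>\<nu>\<in>?S1. ((U - 1) * A ^ (4 * g)) * density (event p \<nu>) + (if large \<nu> then A ^ (4 * g) * density (event p \<nu>) else 0))"
  proof (intro sum_mono)
    fix \<nu> assume \<nu>: "\<nu> \<in> ?S1"
    have fA: "f p \<nu> \<le> A ^ (4 * g)"
      using f_bounds(2)[OF p, of \<nu>] \<nu> power_increasing[of "sum_list \<nu>" "4 * g" A] A_ge
      by (auto simp: exponents_def)
    have f0: "0 \<le> f p \<nu>" using f_bounds(1)[OF p, of \<nu>] \<nu> by (auto simp: exponents_def)
    have "?u \<nu> \<le> U"
      unfolding U_def using \<nu> \<beta> p1 h_bounds(1)[OF p]
      by (intro mult_right_mono powr_mono mult_left_mono) auto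
    then have "?u \<nu> - 1 + (if large \<nu> then 1 else 0) \<le> U - 1 + (if large \<nu> then 1 else 0)" by simp
    then have "?t \<nu> \<le> (U - 1 + (if large \<nu> then 1 else 0)) * (f p \<nu> * density (event p \<nu>))"
      using f0 by (intro mult_right_mono) auto
    also have "\<dots> \<le> (U - 1 + (if large \<nu> then 1 else 0)) * (A ^ (4 * g) * density (event p \<nu>))"
      using fA U1 by (intro mult_left_mono mult_right_mono) auto
    also have "\<dots> = ((U - 1) * A ^ (4 * g)) * density (event p \<nu>) + (if large \<nu> then 1 else 0) * (A ^ (4 * g) * density (event p \<nu>))"
      by (simp only: distrib_right mult.assoc)
    also have "(if large \<nu> then 1 else 0) * (A ^ (4 * g) * density (event p \<nu>)) = (if large \<nu> then A ^ (4 * g) * density (event p \<nu>) else 0)"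
      by simp
    finally show "?t \<nu> \<le> ((U - 1) * A ^ (4 * g)) * density (event p \<nu>) + (if large \<nu> then A ^ (4 * g) * density (event p \<nu>) else 0)" .
  qed
  also have "\<dots> = (U - 1) * A ^ (4 * g) * (\<Sum>\<nu>\<in>?S1. density (event p \<nu>)) + A ^ (4 * g) * (\<Sum>\<nu> | \<nu> \<in> ?S1 \<and> large \<nu>. density (event p \<nu>))"
  proof -
    have fin: "finite ?S1" using finite_exponents[of L] by simp
    have "(\<Sum>\<nu>\<in>?S1. if large \<nu> then A ^ (4 * g) * density (event p \<nu>) else 0)
        = (\<Sum>\<nu>\<in>{\<nu>. \<nu> \<in> ?S1 \<and> large \<nu>}. A ^ (4 * g) * density (event p \<nu>))"
      by (rule sum.inter_filter[OF fin, symmetric])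
    also have "\<dots> = A ^ (4 * g) * (\<Sum>\<nu> | \<nu> \<in> ?S1 \<and> large \<nu>. density (event p \<nu>))"
      by (rule sum_distrib_left[symmetric])
    finally have 1: "(\<Sum>\<nu>\<in>?S1. if large \<nu> then A ^ (4 * g) * density (event p \<nu>) else 0)
        = A ^ (4 * g) * (\<Sum>\<nu> | \<nu> \<in> ?S1 \<and> large \<nu>. density (event p \<nu>))" .
    have 2: "(\<Sum>\<nu>\<in>?S1. ((U - 1) * A ^ (4 * g)) * density (event p \<nu>)) = (U - 1) * A ^ (4 * g) * (\<Sum>\<nu>\<in>?S1. density (event p \<nu>))"
      by (rule sum_distrib_left[symmetric])
    show ?thesis by (subst sum.distrib) (rule arg_cong2[where f = "(+)", OF 2 1])
  qed
  also have "\<dots> \<le> (U - 1) * A ^ (4 * g) * (real g / real p) + A ^ (4 * g) * (real g * c)"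
  proof (intro add_mono mult_left_mono)
    show "(\<Sum>\<nu>\<in>?S1. density (event p \<nu>)) \<le> real g / real p"
      by (rule sum_density_nonzero_le[OF p, of _ L]) auto
    have "(\<Sum>\<nu> | \<nu> \<in> ?S1 \<and> large \<nu>. density (event p \<nu>))
        \<le> (\<Sum>\<nu> | \<nu> \<in> exponents L \<and> large \<nu>. density (event p \<nu>))"
      using finite_exponents[of L] by (intro sum_mono2) auto
    also have "\<dots> \<le> real g * c"
      using sum_density_large_le[OF p, of L] by (simp add: large_def c_def)
    finally show "(\<Sum>\<nu> | \<nu> \<in> ?S1 \<and> large \<nu>. density (event p \<nu>)) \<le> real g * c" .
  qed (use U1 AA in auto)
  finally have T1: "(\<Sum>\<nu>\<in>?S1. ?t \<nu>) \<le> (U - 1) * A ^ (4 * g) * (real g / real p) + A ^ (4 * g) * (real g * c)" .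
  have "(\<Sum>\<nu>\<in>?S2. ?t \<nu>) \<le> (\<Sum>\<nu>\<in>?S2. h p * (real p powr (\<beta> * real (sum_list \<nu>)) * (f p \<nu> * density (event p \<nu>))))"
  proof (intro sum_mono)
    fix \<nu> assume \<nu>: "\<nu> \<in> ?S2"
    have "?t \<nu> \<le> ?u \<nu> * (f p \<nu> * density (event p \<nu>))"
      using density_f_nonneg[OF p, of \<nu> L] \<nu> by (intro mult_right_mono) auto
    then show "?t \<nu> \<le> h p * (real p powr (\<beta> * real (sum_list \<nu>)) * (f p \<nu> * density (event p \<nu>)))"
      by (simp only: mult_ac)
  qed
  also have "\<dots> = h p * (\<Sum>\<nu>\<in>?S2. real p powr (\<beta> * real (sum_list \<nu>)) * (f p \<nu> * density (event p \<nu>)))"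
    by (simp only: sum_distrib_left)
  also have "\<dots> \<le> (1 + 4 * (real g)\<^sup>2) * (B * real g * (1 / (1 - 2 powr (- (1 / (2 * real g))))) * c)"
  proof (intro mult_mono)
    have "4 * (real g)\<^sup>2 / real p \<le> 4 * (real g)\<^sup>2 / 1"
      using p1 by (intro divide_left_mono) auto
    then show "h p \<le> 1 + 4 * (real g)\<^sup>2"
      using h_bounds(2)[OF p] by linarith
    show "(\<Sum>\<nu>\<in>?S2. real p powr (\<beta> * real (sum_list \<nu>)) * (f p \<nu> * density (event p \<nu>)))
        \<le> B * real g * (1 / (1 - 2 powr (- (1 / (2 * real g))))) * c"
      unfolding c_def by (rule tail_sum_le[OF p \<beta>(3)])
    show "0 \<le> (\<Sum>\<nu>\<in>?S2. real p powr (\<beta> * real (sum_list \<nu>)) * (f p \<nu> * density (event p \<nu>)))"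
      using f_bounds(1)[OF p] by (intro sum_nonneg mult_nonneg_nonneg) (auto simp: exponents_def)
  qed auto
  finally have T2: "(\<Sum>\<nu>\<in>?S2. ?t \<nu>) \<le> (1 + 4 * (real g)\<^sup>2) * (B * real g * (1 / (1 - 2 powr (- (1 / (2 * real g))))) * c)" .
  have main: "excess \<beta> L p \<le> (U - 1) * A ^ (4 * g) * (real g / real p) + A ^ (4 * g) * (real g * c)
      + (1 + 4 * (real g)\<^sup>2) * (B * real g * (1 / (1 - 2 powr (- (1 / (2 * real g))))) * c)"
    unfolding E12 by (rule add_mono[OF T1 T2])
  have "(U - 1) * (1 / real p) \<le> E * (4 * (real g)\<^sup>2 + 4 * real g) * (b + c)"
  proof -
    define e where "e = real p powr (\<beta> * real (4 * g))"
    have e: "e = exp (4 * real g * (\<beta> * ln (real p)))"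
      using p1 by (simp add: e_def powr_def mult_ac)
    have eE: "e \<le> E"
      unfolding e E_def using mult_left_mono[OF \<beta>(2), of "4 * real g"] by simp
    \<comment> \<open>The deviation of the sieve factor is \<open>O(1 / p)\<close> and that of the
      twist \<open>O(\<beta> * ln p)\<close>. The nontrivial events have total density
      \<open>O(1 / p)\<close>, which supplies the missing factor in both cases.\<close>
    have "U - 1 = e * (h p - 1) + (e - 1)"
      by (simp add: U_def e_def algebra_simps)
    also have "\<dots> \<le> E * (4 * (real g)\<^sup>2 / real p) + (4 * real g * (\<beta> * ln (real p))) * E"
    proof (intro add_mono)
      show "e * (h p - 1) \<le> E * (4 * (real g)\<^sup>2 / real p)"
        using eE h_bounds[OF p] by (intro mult_mono) (auto simp: E_def)
      have "e - 1 \<le> (4 * real g * (\<beta> * ln (real p))) * e"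
        unfolding e by (rule exp_minus_one_le)
      also have "\<dots> \<le> (4 * real g * (\<beta> * ln (real p))) * E"
        using eE \<beta>(1) p1 by (intro mult_left_mono) auto
      finally show "e - 1 \<le> (4 * real g * (\<beta> * ln (real p))) * E" .
    qed
    finally have "(U - 1) * (1 / real p) \<le> (E * (4 * (real g)\<^sup>2 / real p) + (4 * real g * (\<beta> * ln (real p))) * E) * (1 / real p)"
      using p1 by (intro mult_right_mono) auto
    also have "\<dots> = E * (4 * (real g)\<^sup>2 * c + 4 * real g * b)"
      by (simp add: b_def c_def power2_eq_square algebra_simps)
    also have "\<dots> \<le> E * ((4 * (real g)\<^sup>2 + 4 * real g) * c + (4 * (real g)\<^sup>2 + 4 * real g) * b)"
      using bc by (intro mult_left_mono add_mono mult_right_mono) (auto simp: E_def)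
    also have "\<dots> = E * (4 * (real g)\<^sup>2 + 4 * real g) * (b + c)"
      by (simp add: algebra_simps)
    finally show ?thesis .
  qed
  then have "A ^ (4 * g) * real g * ((U - 1) * (1 / real p)) \<le> A ^ (4 * g) * real g * (E * (4 * (real g)\<^sup>2 + 4 * real g) * (b + c))"
    using AA by (intro mult_left_mono) auto
  moreover have "A ^ (4 * g) * (real g * c) \<le> A ^ (4 * g) * real g * (b + c)"
    using AA bc by (simp add: mult.assoc mult_left_mono)
  moreover have "(1 + 4 * (real g)\<^sup>2) * (B * real g * (1 / (1 - 2 powr (- (1 / (2 * real g))))) * c)
      \<le> (1 + 4 * (real g)\<^sup>2) * (B * real g * (1 / (1 - 2 powr (- (1 / (2 * real g))))) * (b + c))"
  proof -
    have "2 powr (- (1 / (2 * real g))) < 1"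
      using g_pos by (intro powr_less_one) auto
    then show ?thesis
      using bc B_ge by (intro mult_left_mono mult_nonneg_nonneg) auto
  qed
  moreover have "(U - 1) * A ^ (4 * g) * (real g / real p) = A ^ (4 * g) * real g * ((U - 1) * (1 / real p))"
    by simp
  ultimately have "excess \<beta> L p \<le> A ^ (4 * g) * real g * (E * (4 * (real g)\<^sup>2 + 4 * real g) * (b + c))
      + A ^ (4 * g) * real g * (b + c)
      + (1 + 4 * (real g)\<^sup>2) * (B * real g * (1 / (1 - 2 powr (- (1 / (2 * real g))))) * (b + c))"
    using main by linarith
  also have "\<dots> = excess_const K * (b + c)"
    unfolding excess_const_def E_def[symmetric] by (simp only: distrib_left distrib_right mult_ac add_ac mult_1_right mult_1_left)
  finally show ?thesis by (simp only: b_def c_def)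
qed

lemma excess_const_nonneg: "0 \<le> excess_const K"
proof -
  have "2 powr (- (1 / (2 * real g))) < 1"
    using g_pos by (intro powr_less_one) auto
  then show ?thesis
    using A_ge B_ge by (auto simp: excess_const_def intro!: add_nonneg_nonneg mult_nonneg_nonneg)
qed

lemma sum_excess_le:
  assumes P: "P \<subseteq> primes_le W" and W: "W \<ge> 1" and \<beta>: "0 \<le> \<beta>" "\<beta> * ln W \<le> K" "\<beta> + \<epsilon> \<le> 1 / (2 * real g)"
  shows "(\<Sum>p\<in>P. excess \<beta> L p) \<le> excess_const K * (4 * K + 1)"
proof -
  have finP: "finite P" using P finite_primes_le finite_subset by blast
  have pr: "prime p" if "p \<in> P" for p using that P by (auto simp: primes_le_def)
  have "(\<Sum>p\<in>P. excess \<beta> L p) \<le> (\<Sum>p\<in>P. excess_const K * (\<beta> * (ln (real p) / real p) + 1 / (real p)\<^sup>2))"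
  proof (intro sum_mono excess_le pr \<beta>)
    fix p assume p: "p \<in> P"
    have "ln (real p) \<le> ln W"
      using p P prime_gt_0_nat[OF pr[OF p]] by (auto simp: primes_le_def)
    then have "\<beta> * ln (real p) \<le> \<beta> * ln W" using \<beta> by (intro mult_left_mono)
    then show "\<beta> * ln (real p) \<le> K" using \<beta> by linarith
  qed
  also have "\<dots> = excess_const K * (\<beta> * (\<Sum>p\<in>P. ln (real p) / real p) + (\<Sum>p\<in>P. 1 / (real p)\<^sup>2))"
    by (simp only: sum_distrib_left sum.distrib distrib_left)
  also have "\<dots> \<le> excess_const K * (\<beta> * (4 * ln W) + 1)"
  proof (intro mult_left_mono add_mono \<beta> excess_const_nonneg)
    have "(\<Sum>p\<in>P. ln (real p) / real p) \<le> (\<Sum>p\<in>primes_le W. ln (real p) / real p)"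
      using P by (intro sum_mono2 ln_prime_div_nonneg) (auto simp: prime_of_primes_le)
    then show "(\<Sum>p\<in>P. ln (real p) / real p) \<le> 4 * ln W"
      using sum_ln_prime_le[OF W] by linarith
    show "(\<Sum>p\<in>P. 1 / (real p)\<^sup>2) \<le> 1"
      using finP pr by (intro sum_inverse_square_le prime_ge_2_nat)
  qed
  also have "\<dots> \<le> excess_const K * (4 * K + 1)"
    using \<beta> by (intro mult_left_mono excess_const_nonneg) auto
  finally show ?thesis .
qed

section \<open>The local factors of \<open>Delta_factor\<close>\<close>

definition delta_local :: "nat \<Rightarrow> real" where
  "delta_local p = 1 + (\<Sum>\<nu> | length \<nu> = length Qs \<and> (\<forall>j < length Qs. \<nu> ! j \<le> degree (Qs ! j)).
      F (map (\<lambda>e. p ^ e) \<nu>) *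
      real (card {n \<in> {0..<p ^ (Max (set \<nu>) + 1)}. \<forall>j < length Qs.
        exact_dvd (int p ^ (\<nu> ! j)) (poly (Qs ! j) (int n))}) / real (p ^ (Max (set \<nu>) + 1)))"

lemma Delta_factor_eq: "Delta_factor Qs F D = (\<Prod>p | prime p \<and> int p dvd D. delta_local p)"
  by (simp add: Delta_factor_def delta_local_def)

lemma exact_dvdI:
  fixes b :: int
  assumes p: "prime p" and "int p ^ a dvd b" "\<not> int p ^ Suc a dvd b"
  shows "exact_dvd (int p ^ a) b"
proof -
  obtain c where c: "b = int p ^ a * c" using assms by auto
  have p0: "int p ^ a \<noteq> 0" using p by auto
  have "\<not> int p dvd c"
    using assms(3) c by (auto simp: mult.commute intro: mult_dvd_mono)
  then have "coprime (int p) c"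
    using p by (simp add: prime_imp_coprime)
  then have "coprime (int p ^ a) c" by simp
  then show ?thesis
    using c p0 by (simp add: exact_dvd_def coprime_iff_gcd_eq_1)
qed

text \<open>In general a strict inequality: for exponent 0 \<open>exact_dvd\<close> imposes no
  condition, whereas \<open>event\<close> forbids divisibility by \<open>p\<close>.\<close>

lemma density_event_le_exact:
  assumes p: "prime p" and \<nu>: "length \<nu> = length Qs"
  shows "density (event p \<nu>) \<le> real (card {n \<in> {0..<p ^ (Max (set \<nu>) + 1)}. \<forall>j < length Qs.
        exact_dvd (int p ^ (\<nu> ! j)) (poly (Qs ! j) (int n))}) / real (p ^ (Max (set \<nu>) + 1))"
proof -
  have "periodic (p ^ Suc (Max (set \<nu>))) (event p \<nu>)"
    using \<nu> p by (intro periodic_event Max_ge) (auto simp: prime_gt_0_nat)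
  then have "density (event p \<nu>) = real (card {n. n < p ^ (Max (set \<nu>) + 1) \<and> event p \<nu> n}) / real (p ^ (Max (set \<nu>) + 1))"
    using density_eq by simp
  also have "\<dots> \<le> real (card {n \<in> {0..<p ^ (Max (set \<nu>) + 1)}. \<forall>j < length Qs.
        exact_dvd (int p ^ (\<nu> ! j)) (poly (Qs ! j) (int n))}) / real (p ^ (Max (set \<nu>) + 1))"
    using p by (intro divide_right_mono of_nat_mono card_mono) (auto simp: event_def intro: exact_dvdI)
  finally show ?thesis .
qed

lemma delta_local_ge:
  assumes p: "prime p"
  shows "1 + (\<Sum>\<nu> | \<nu> \<in> exponents L - {zero_vec} \<and> \<not> large \<nu>. f p \<nu> * density (event p \<nu>)) \<le> delta_local p"
proof -
  let ?I = "{\<nu>. length \<nu> = length Qs \<and> (\<forall>j < length Qs. \<nu> ! j \<le> degree (Qs ! j))}"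
  have "\<nu> ! j \<le> g" if "\<nu> \<in> ?I" "j < length Qs" for \<nu> j
  proof -
    have "degree (Qs ! j) \<le> (\<Sum>j<length Qs. degree (Qs ! j))"
      by (rule member_le_sum) (use that in auto)
    then show ?thesis using that degree_sum by fastforce
  qed
  then have "?I \<subseteq> exponents g"
    by (auto simp: exponents_def in_set_conv_nth)
  then have finI: "finite ?I" using finite_exponents finite_subset by blast
  have "(\<Sum>\<nu> | \<nu> \<in> exponents L - {zero_vec} \<and> \<not> large \<nu>. f p \<nu> * density (event p \<nu>))
      \<le> (\<Sum>\<nu>\<in>?I. f p \<nu> * density (event p \<nu>))"
  proof (intro sum_mono2 finI)
    show "{\<nu> \<in> exponents L - {zero_vec}. \<not> large \<nu>} \<subseteq> ?I"
    proof
      fix \<nu> assume "\<nu> \<in> {\<nu> \<in> exponents L - {zero_vec}. \<not> large \<nu>}"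
      then have "length \<nu> = length Qs" "\<not> large \<nu>" by (auto simp: exponents_def)
      moreover have "\<nu> ! j \<le> degree (Qs ! j)" if "j < length Qs" for j
        using that \<open>\<not> large \<nu>\<close> unfolding large_def by (meson not_le)
      ultimately show "\<nu> \<in> ?I" by simp
    qed
    show "0 \<le> f p \<nu> * density (event p \<nu>)" if "\<nu> \<in> ?I - {\<nu> \<in> exponents L - {zero_vec}. \<not> large \<nu>}" for \<nu>
      using that f_bounds(1)[OF p, of \<nu>] by (intro mult_nonneg_nonneg) auto
  qed
  also have "\<dots> \<le> (\<Sum>\<nu>\<in>?I. F (map (\<lambda>e. p ^ e) \<nu>) *
      (real (card {n \<in> {0..<p ^ (Max (set \<nu>) + 1)}. \<forall>j < length Qs.
        exact_dvd (int p ^ (\<nu> ! j)) (poly (Qs ! j) (int n))}) / real (p ^ (Max (set \<nu>) + 1))))"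
    unfolding f_def using f_bounds(1)[OF p, unfolded f_def] density_event_le_exact[OF p]
    by (intro sum_mono mult_left_mono) auto
  finally show ?thesis by (simp add: delta_local_def)
qed

lemma delta_local_ge_1: "prime p \<Longrightarrow> 1 \<le> delta_local p"
  by (rule order_trans[OF _ delta_local_ge[of p 0]])
     (auto intro!: sum_nonneg density_f_nonneg)

lemma Delta_factor_ge_1: "1 \<le> Delta_factor Qs F D"
  unfolding Delta_factor_eq by (intro prod_ge_1 delta_local_ge_1) auto

text \<open>If \<open>p\<close> divides \<open>D\<close>, \<open>clean\<close> keeps the trivial
  exponent only, so the whole remaining weight has to be paid: exponents within the degrees by
  \<open>delta_local\<close>, the rest by \<open>excess\<close>. Since
  \<open>delta_local p >= 1\<close>, adding \<open>excess\<close> costs at most the factor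
  \<open>1 + excess\<close>.\<close>

lemma local_factor_le:
  assumes p: "prime p" and \<beta>: "0 \<le> \<beta>"
  shows "1 + (\<Sum>\<nu>\<in>exponents L - {zero_vec}. twisted \<beta> p \<nu> - clean p \<nu>)
    \<le> (if int p dvd D then delta_local p else 1) * exp (excess \<beta> L p)"
proof -
  let ?N = "exponents L - {zero_vec}"
  let ?u = "\<lambda>\<nu>. real p powr (\<beta> * real (sum_list \<nu>)) * h p"
  let ?fd = "\<lambda>\<nu>. f p \<nu> * density (event p \<nu>)"
  have fd: "0 \<le> ?fd \<nu>" if "\<nu> \<in> ?N" for \<nu> using density_f_nonneg[OF p, of \<nu> L] that by auto
  have ex: "0 \<le> excess \<beta> L p" by (rule excess_nonneg[OF p \<beta>])
  show ?thesis
  proof (cases "int p dvd D")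
    case False
    have "(\<Sum>\<nu>\<in>?N. twisted \<beta> p \<nu> - clean p \<nu>) \<le> excess \<beta> L p"
      unfolding excess_def
    proof (intro sum_mono)
      fix \<nu> assume \<nu>: "\<nu> \<in> ?N"
      then have "twisted \<beta> p \<nu> - clean p \<nu> = (?u \<nu> - 1 + 0) * ?fd \<nu>"
        using False by (simp add: twisted_def clean_def algebra_simps)
      also have "\<dots> \<le> (?u \<nu> - 1 + (if large \<nu> then 1 else 0)) * ?fd \<nu>"
        using fd[OF \<nu>] by (intro mult_right_mono) auto
      finally show "twisted \<beta> p \<nu> - clean p \<nu> \<le> (?u \<nu> - 1 + (if large \<nu> then 1 else 0)) * ?fd \<nu>" .
    qed
    moreover have "1 + excess \<beta> L p \<le> exp (excess \<beta> L p)" by (rule exp_ge_add_one_self)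
    ultimately have "1 + (\<Sum>\<nu>\<in>?N. twisted \<beta> p \<nu> - clean p \<nu>) \<le> exp (excess \<beta> L p)" by linarith
    then show ?thesis using False by simp
  next
    case True
    have "(\<Sum>\<nu>\<in>?N. twisted \<beta> p \<nu> - clean p \<nu>)
        = (\<Sum>\<nu>\<in>?N. (?u \<nu> - 1 + (if large \<nu> then 1 else 0)) * ?fd \<nu> + (if \<not> large \<nu> then ?fd \<nu> else 0))"
      using True by (intro sum.cong refl) (auto simp: twisted_def clean_def algebra_simps)
    also have "\<dots> = excess \<beta> L p + (\<Sum>\<nu> | \<nu> \<in> ?N \<and> \<not> large \<nu>. ?fd \<nu>)"
      by (simp only: sum.distrib excess_def sum.inter_filter[OF finite_Diff[OF finite_exponents]])
    finally have "1 + (\<Sum>\<nu>\<in>?N. twisted \<beta> p \<nu> - clean p \<nu>) \<le> delta_local p + excess \<beta> L p"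
      using delta_local_ge[OF p, of L] by linarith
    also have "\<dots> \<le> delta_local p * (1 + excess \<beta> L p)"
      using delta_local_ge_1[OF p] ex mult_right_mono[of 1 "delta_local p" "excess \<beta> L p"]
      by (simp add: algebra_simps)
    also have "\<dots> \<le> delta_local p * exp (excess \<beta> L p)"
      using delta_local_ge_1[OF p] by (intro mult_left_mono exp_ge_add_one_self) auto
    finally show ?thesis using True by simp
  qed
qed

lemma clean_nonneg: "prime p \<Longrightarrow> \<nu> \<in> exponents L \<Longrightarrow> 0 \<le> clean p \<nu>"
  by (auto simp: clean_def density_f_nonneg)

lemma clean_le_twisted:
  assumes "prime p" "\<nu> \<in> exponents L" "0 \<le> \<beta>"
  shows "clean p \<nu> \<le> twisted \<beta> p \<nu>"
proof -
  have "1 * (f p \<nu> * density (event p \<nu>)) \<le> real p powr (\<beta> * real (sum_list \<nu>)) * h p * (f p \<nu> * density (event p \<nu>))"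
    by (rule mult_right_mono[OF weight_ge_1[OF assms(1,3)] density_f_nonneg[OF assms(1,2)]])
  then show ?thesis
    using density_f_nonneg[OF assms(1,2)] by (auto simp: twisted_def clean_def)
qed

text \<open>The common comparison for all classes of \<open>n\<close>: Rankin's factor, the sieve
  compensation and the primes dividing \<open>D\<close> are removed at the price of
  \<open>Delta_factor\<close> and a constant depending on \<open>K\<close>, with the cut
  \<open>X\<close> unchanged.\<close>

lemma twisted_sum_le:
  assumes P: "P \<subseteq> primes_le W" and W: "W \<ge> 1" and \<beta>: "0 \<le> \<beta>" "\<beta> * ln W \<le> K" "\<beta> + \<epsilon> \<le> 1 / (2 * real g)"
  shows "choice_sum sum_list (exponents L) (twisted \<beta>) P X
    \<le> Delta_factor Qs F D * exp (excess_const K * (4 * K + 1)) * choice_sum sum_list (exponents L) clean P X"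
proof -
  have finP: "finite P" using P finite_primes_le finite_subset by blast
  have pr: "prime p" if "p \<in> P" for p using that P by (auto simp: primes_le_def)
  have finD: "finite {p. prime p \<and> int p dvd D}"
  proof -
    have "{p. prime p \<and> int p dvd D} \<subseteq> {..nat \<bar>D\<bar>}"
      using D_nonzero by (auto dest: dvd_imp_le_int)
    then show ?thesis by (rule finite_subset) simp
  qed
  have "(\<Prod>p\<in>P. 1 + (\<Sum>\<nu>\<in>exponents L - {zero_vec}. twisted \<beta> p \<nu> - clean p \<nu>))
      \<le> (\<Prod>p\<in>P. (if int p dvd D then delta_local p else 1) * exp (excess \<beta> L p))"
    using clean_le_twisted[OF pr _ \<beta>(1)]
    by (intro prod_mono conjI local_factor_le pr \<beta> add_nonneg_nonneg sum_nonneg) (auto simp: diff_ge_0_iff_ge)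
  also have "\<dots> = (\<Prod>p | p \<in> P \<and> int p dvd D. delta_local p) * exp (\<Sum>p\<in>P. excess \<beta> L p)"
    using finP by (simp add: prod.distrib exp_sum prod.inter_filter)
  also have "\<dots> \<le> Delta_factor Qs F D * exp (excess_const K * (4 * K + 1))"
  proof (intro mult_mono)
    show "(\<Prod>p | p \<in> P \<and> int p dvd D. delta_local p) \<le> Delta_factor Qs F D"
      unfolding Delta_factor_eq using pr order_trans[OF zero_le_one delta_local_ge_1]
      by (intro prod_mono2 finD) (auto intro: delta_local_ge_1)
    show "exp (\<Sum>p\<in>P. excess \<beta> L p) \<le> exp (excess_const K * (4 * K + 1))"
      using sum_excess_le[OF P W \<beta>] by simp
  qed (use Delta_factor_ge_1 in auto)
  finally have *: "(\<Prod>p\<in>P. 1 + (\<Sum>\<nu>\<in>exponents L - {zero_vec}. twisted \<beta> p \<nu> - clean p \<nu>))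
      \<le> Delta_factor Qs F D * exp (excess_const K * (4 * K + 1))" .
  have "choice_sum sum_list (exponents L) (twisted \<beta>) P X
    \<le> (\<Prod>p\<in>P. 1 + (\<Sum>\<nu>\<in>exponents L - {zero_vec}. twisted \<beta> p \<nu> - clean p \<nu>)) * choice_sum sum_list (exponents L) clean P X"
    by (rule choice_sum_compare)
       (use finP pr clean_nonneg clean_le_twisted \<beta> in \<open>auto simp: prime_gt_0_nat twisted_def clean_def\<close>)
  also have "\<dots> \<le> Delta_factor Qs F D * exp (excess_const K * (4 * K + 1)) * choice_sum sum_list (exponents L) clean P X"
    by (intro mult_right_mono * choice_sum_nonneg clean_nonneg pr)
  finally show ?thesis .
qed

end

section \<open>The main term\<close>

context weighted_system
begin

text \<open>If two polynomials vanish at \<open>n\<close> modulo \<open>p\<close>, then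
  \<open>Q\<close> and its derivative both do, and \<open>p\<close> divides \<open>D\<close>. So an
  event with two nonzero exponents is empty, and one with a single nonzero exponent is contained in
  a single divisibility.\<close>

lemma density_event_le_rho:
  assumes p: "prime p" and D: "\<not> int p dvd D" and \<nu>: "length \<nu> = length Qs"
  shows "density (event p \<nu>) \<le> (\<Prod>j<length Qs. real (rho (Qs ! j) (p ^ (\<nu> ! j))) / real (p ^ (\<nu> ! j)))"
proof -
  have p0: "p > 0" using p by (simp add: prime_gt_0_nat)
  have per: "\<exists>m. periodic m (event p \<nu>)" using periodic_event_sum_list[OF p0 \<nu>] by blast
  have rho1: "real (rho P 1) / real (1::nat) = 1" for P
    using density_dvd_poly[of 1 P] by (simp add: density_True)
  show ?thesis
  proof (cases "\<exists>j<length Qs. \<nu> ! j \<noteq> 0")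
    case False
    have "density (event p \<nu>) \<le> density (\<lambda>n. True)"
      by (rule density_mono[OF per]) (auto simp: periodic_def)
    also have "\<dots> = (\<Prod>j<length Qs. real (rho (Qs ! j) (p ^ (\<nu> ! j))) / real (p ^ (\<nu> ! j)))"
      using False rho1 by (simp add: density_True)
    finally show ?thesis .
  next
    case True
    then obtain j where j: "j < length Qs" "\<nu> ! j \<noteq> 0" by blast
    show ?thesis
    proof (cases "\<exists>i<length Qs. i \<noteq> j \<and> \<nu> ! i \<noteq> 0")
      case False
      have "density (event p \<nu>) \<le> density (\<lambda>n. int (p ^ (\<nu> ! j)) dvd poly (Qs ! j) (int n))"
        using periodic_dvd_poly[of "p ^ (\<nu> ! j)" "Qs ! j"] p0 j
        by (intro density_mono[OF per]) (auto simp: event_def)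
      also have "\<dots> = real (rho (Qs ! j) (p ^ (\<nu> ! j))) / real (p ^ (\<nu> ! j))"
        by (rule density_dvd_poly) (use p0 in simp)
      also have "\<dots> = (\<Prod>i\<in>{j}. real (rho (Qs ! i) (p ^ (\<nu> ! i))) / real (p ^ (\<nu> ! i)))"
        by simp
      also have "\<dots> = (\<Prod>i<length Qs. real (rho (Qs ! i) (p ^ (\<nu> ! i))) / real (p ^ (\<nu> ! i)))"
        using j False rho1 by (intro prod.mono_neutral_left) auto
      finally show ?thesis .
    next
      case True
      then obtain i where i: "i < length Qs" "i \<noteq> j" "\<nu> ! i \<noteq> 0" by blast
      have no: "\<not> event p \<nu> n" for n
      proof
        assume ev: "event p \<nu> n"
        have dv: "int p dvd poly (Qs ! l) (int n)" if "l < length Qs" "\<nu> ! l \<noteq> 0" for l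
        proof -
          have "int p dvd int p ^ (\<nu> ! l)" using that by simp
          also have "\<dots> dvd poly (Qs ! l) (int n)" using ev that by (simp add: event_def)
          finally show ?thesis .
        qed
        obtain R where R: "Q = (Qs ! i * Qs ! j) * R"
          using mult_nth_dvd_prod_list[OF i(1) j(1) i(2)] unfolding Q_eq by (elim dvdE)
        have "R \<noteq> 0" "Qs ! i \<noteq> 0" "Qs ! j \<noteq> 0"
          using g_pos degree_Q R by auto
        then have "degree Q = degree (Qs ! i) + degree (Qs ! j) + degree R"
          by (simp add: R degree_mult_eq)
        moreover have "degree (Qs ! i) > 0" "degree (Qs ! j) > 0"
          using i j by (auto intro: degree_pos)
        ultimately have "degree Q \<ge> 2" by linarith
        moreover have "int p dvd poly Q (int n)" using dv[OF i(1,3)] by (simp add: R)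
        moreover have "int p dvd poly (pderiv Q) (int n)"
          using dv[OF i(1,3)] dv[OF j] by (simp add: R pderiv_mult)
        ultimately have "int p dvd D"
          unfolding D_eq using p by (intro double_root_dvd_discriminant) auto
        then show False using D by simp
      qed
      obtain m where m: "periodic m (event p \<nu>)" using per by blast
      have "density (event p \<nu>) = 0"
        using no by (simp add: density_eq[OF m])
      then show ?thesis by (auto intro!: prod_nonneg)
    qed
  qed
qed

section \<open>From exponent choices back to tuples of integers\<close>

definition tuple :: "nat set \<Rightarrow> (nat \<Rightarrow> nat list) \<Rightarrow> nat list" where
  "tuple P e = map (\<lambda>j. \<Prod>p\<in>P. p ^ (e p ! j)) [0..<length Qs]"

lemma length_tuple [simp]: "length (tuple P e) = length Qs"
  by (simp add: tuple_def)

lemma nth_tuple: "j < length Qs \<Longrightarrow> tuple P e ! j = (\<Prod>p\<in>P. p ^ (e p ! j))"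
  by (simp add: tuple_def)

lemma tuple_pos: "finite P \<Longrightarrow> (\<And>p. p \<in> P \<Longrightarrow> prime p) \<Longrightarrow> tuple P e \<in> pos_tuples (length Qs)"
  by (auto simp: pos_tuples_def tuple_def intro!: prod_pos prime_gt_0_nat)

lemma prod_list_upt: "prod_list (map u [0..<n]) = (\<Prod>j<n. u j)" for u :: "nat \<Rightarrow> 'b :: comm_monoid_mult"
  by (induction n) (auto simp: mult.commute)

lemma prod_list_tuple:
  assumes "\<And>p. p \<in> P \<Longrightarrow> length (e p) = length Qs"
  shows "prod_list (tuple P e) = (\<Prod>p\<in>P. p ^ sum_list (e p))"
proof -
  have "prod_list (tuple P e) = (\<Prod>p\<in>P. \<Prod>j<length Qs. p ^ (e p ! j))"
    unfolding tuple_def prod_list_upt by (rule prod.swap)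
  also have "\<dots> = (\<Prod>p\<in>P. p ^ sum_list (e p))"
    using assms by (intro prod.cong refl) (simp add: sum_list_sum_nth lessThan_atLeast0 flip: power_sum)
  finally show ?thesis .
qed

lemma tuple_insert:
  assumes "finite P" "p \<notin> P" "length (e p) = length Qs"
  shows "tuple (insert p P) e = map2 (*) (map (\<lambda>i. p ^ i) (e p)) (tuple P e)"
  by (rule nth_equalityI) (use assms in \<open>auto simp: nth_tuple\<close>)

lemma coprime_primes_prod:
  fixes p :: nat
  assumes "prime p" "p \<notin> P" "\<And>q. q \<in> P \<Longrightarrow> prime q"
  shows "coprime (p ^ a) (\<Prod>q\<in>P. q ^ b q)"
  by (rule prod_coprime_right) (use assms in \<open>auto intro: primes_coprime\<close>)

lemma F_tuple:
  assumes "finite P" "\<And>p. p \<in> P \<Longrightarrow> prime p" "\<And>p. p \<in> P \<Longrightarrow> length (e p) = length Qs"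
  shows "F (tuple P e) = (\<Prod>p\<in>P. f p (e p))"
  using assms
proof (induction P rule: finite_induct)
  case empty
  have "tuple {} e = replicate (length Qs) 1"
    by (rule nth_equalityI) (auto simp: nth_tuple)
  then show ?case using F_one by (simp only: prod.empty)
next
  case (insert p P)
  have "prod_list (tuple P e) = (\<Prod>q\<in>P. q ^ sum_list (e q))"
    using insert by (intro prod_list_tuple) auto
  moreover have "coprime (p ^ sum_list (e p)) (\<Prod>q\<in>P. q ^ sum_list (e q))"
    using insert by (intro coprime_primes_prod) auto
  ultimately have "coprime (prod_list (map (\<lambda>i. p ^ i) (e p))) (prod_list (tuple P e))"
    by (simp only: prod_list_map_power)
  moreover have "map (\<lambda>i. p ^ i) (e p) \<in> pos_tuples (length Qs)"
    using insert by (intro prime_power_tuple) auto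
  moreover have "tuple P e \<in> pos_tuples (length Qs)"
    using insert by (intro tuple_pos) auto
  ultimately have "F (tuple (insert p P) e) = F (map (\<lambda>i. p ^ i) (e p)) * F (tuple P e)"
    using F_mult insert by (simp add: tuple_insert multiplicative_fun_def)
  then show ?case using insert by (simp add: f_def)
qed

lemma rho_prod:
  assumes "finite P" "\<And>p. p \<in> P \<Longrightarrow> prime p"
  shows "real (rho R (\<Prod>p\<in>P. p ^ a p)) / real (\<Prod>p\<in>P. p ^ a p) = (\<Prod>p\<in>P. real (rho R (p ^ a p)) / real (p ^ a p))"
proof -
  have pos: "(\<Prod>p\<in>P. p ^ a p) > 0"
    using assms by (auto intro!: prod_pos prime_gt_0_nat)
  have "int (\<Prod>p\<in>P. p ^ a p) dvd x \<longleftrightarrow> (\<forall>p\<in>P. int (p ^ a p) dvd x)" for x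
    using assms
  proof (induction P rule: finite_induct)
    case (insert p P)
    have "coprime (int (p ^ a p)) (int (\<Prod>p\<in>P. p ^ a p))"
      unfolding coprime_int_iff using insert by (intro coprime_primes_prod) auto
    then have "int (p ^ a p) * int (\<Prod>p\<in>P. p ^ a p) dvd x \<longleftrightarrow> int (p ^ a p) dvd x \<and> int (\<Prod>p\<in>P. p ^ a p) dvd x"
      by (meson divides_mult dvd_mult_left dvd_mult_right)
    then show ?case using insert by simp
  qed simp
  then have "density (\<lambda>n. int (\<Prod>p\<in>P. p ^ a p) dvd poly R (int n)) = density (\<lambda>n. \<forall>p\<in>P. int (p ^ a p) dvd poly R (int n))"
    by simp
  also have "\<dots> = (\<Prod>p\<in>P. density (\<lambda>n. int (p ^ a p) dvd poly R (int n)))"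
    using assms periodic_dvd_poly
    by (intro density_Ball_prod[where m = "\<lambda>p. p ^ a p"]) (auto simp: prime_gt_0_nat primes_coprime simp del: of_nat_power)
  also have "\<dots> = (\<Prod>p\<in>P. real (rho R (p ^ a p)) / real (p ^ a p))"
    using assms by (intro prod.cong refl density_dvd_poly) (auto simp: prime_gt_0_nat)
  finally show ?thesis using density_dvd_poly[OF pos, of R] by simp
qed

lemma tuple_inj:
  assumes P: "finite P" "\<And>p. p \<in> P \<Longrightarrow> prime p"
    and e: "\<And>p. p \<in> P \<Longrightarrow> length (e p) = length Qs" "\<And>p. p \<in> P \<Longrightarrow> length (e' p) = length Qs"
    and eq: "tuple P e = tuple P e'" and p: "p \<in> P"
  shows "e p = e' p"
proof (rule nth_equalityI)
  fix j assume "j < length (e p)"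
  then have j: "j < length Qs" using e p by simp
  have mult: "multiplicity p (\<Prod>q\<in>P. q ^ a q) = a p" for a
    using P p by (subst multiplicity_prod_prime_powers) auto
  show "e p ! j = e' p ! j"
    using arg_cong[OF eq, of "\<lambda>t. multiplicity p (t ! j)"] j by (simp add: nth_tuple mult)
qed (use e p in simp)

definition target_sum :: "real \<Rightarrow> real" where
  "target_sum x = (\<Sum>ns | ns \<in> pos_tuples (length Qs) \<and> real (prod_list ns) \<le> x \<and> coprime (int (prod_list ns)) D.
      F ns * (\<Prod>j<length Qs. real (rho (Qs ! j) (ns ! j))) / real (prod_list ns))"

lemma finite_pos_tuples_le: "finite {ns. ns \<in> pos_tuples k \<and> real (prod_list ns) \<le> x \<and> R ns}"
proof -
  have "{ns. ns \<in> pos_tuples k \<and> real (prod_list ns) \<le> x \<and> R ns} \<subseteq> {ns. set ns \<subseteq> {..nat \<lfloor>x\<rfloor>} \<and> length ns = k}"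
  proof
    fix ns assume ns: "ns \<in> {ns. ns \<in> pos_tuples k \<and> real (prod_list ns) \<le> x \<and> R ns}"
    then have "prod_list ns > 0"
      by (auto simp: pos_tuples_def prod_list_zero_iff intro!: gr0I)
    then have "n \<le> prod_list ns" if "n \<in> set ns" for n
      using that by (intro dvd_imp_le mem_dvd_prod_list)
    moreover have "prod_list ns \<le> nat \<lfloor>x\<rfloor>"
      using ns by (intro le_nat_floor) auto
    ultimately show "ns \<in> {ns. set ns \<subseteq> {..nat \<lfloor>x\<rfloor>} \<and> length ns = k}"
      using ns by (auto simp: pos_tuples_def intro: order_trans)
  qed
  then show ?thesis by (rule finite_subset) (simp add: finite_lists_length_eq)
qed

lemma target_term_nonneg:
  "ns \<in> pos_tuples (length Qs) \<Longrightarrow> 0 \<le> F ns * (\<Prod>j<length Qs. real (rho (Qs ! j) (ns ! j))) / real (prod_list ns)"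
  using F_nonneg by (auto intro!: divide_nonneg_nonneg mult_nonneg_nonneg prod_nonneg)

text \<open>Only choices that are trivial at the primes dividing \<open>D\<close> contribute; they
  decode injectively to tuples coprime to \<open>D\<close>, and the product of local densities is at
  most the product of the \<open>rho (Qs ! j) (ns ! j) / ns ! j\<close>.\<close>

lemma clean_sum_le_target:
  assumes P: "finite P" "\<And>p. p \<in> P \<Longrightarrow> prime p" and "X \<le> x"
  shows "choice_sum sum_list (exponents L) clean P X \<le> target_sum x"
proof -
  let ?B = "bounded_choices sum_list (exponents L) P X"
  let ?B' = "{e \<in> ?B. \<forall>p\<in>P. int p dvd D \<longrightarrow> e p = zero_vec}"
  let ?T = "\<lambda>ns. F ns * (\<Prod>j<length Qs. real (rho (Qs ! j) (ns ! j))) / real (prod_list ns)"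
  have finB: "finite ?B" using P by (intro finite_bounded_choices) auto
  have len: "length (e p) = length Qs" if "e \<in> ?B" "p \<in> P" for e p
    using that by (auto simp: bounded_choices_def PiE_iff exponents_def)
  have "choice_sum sum_list (exponents L) clean P X = (\<Sum>e\<in>?B'. \<Prod>p\<in>P. clean p (e p))"
    unfolding choice_sum_def using finB P by (intro sum.mono_neutral_right) (auto simp: clean_def)
  also have "\<dots> \<le> (\<Sum>e\<in>?B'. ?T (tuple P e))"
  proof (intro sum_mono)
    fix e assume e: "e \<in> ?B'"
    let ?r = "\<lambda>p. \<Prod>j<length Qs. real (rho (Qs ! j) (p ^ (e p ! j))) / real (p ^ (e p ! j))"
    have ex: "e p \<in> exponents L" if "p \<in> P" for p
      using e that by (auto simp: bounded_choices_def PiE_iff)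
    have "(\<Prod>p\<in>P. clean p (e p)) \<le> (\<Prod>p\<in>P. f p (e p) * ?r p)"
    proof (rule prod_mono, rule conjI)
      fix p assume p: "p \<in> P"
      show "0 \<le> clean p (e p)" by (rule clean_nonneg[OF P(2)[OF p] ex[OF p]])
      show "clean p (e p) \<le> f p (e p) * ?r p"
      proof (cases "e p = zero_vec")
        case True
        have "real (rho R 1) / real (1::nat) = 1" for R
          using density_dvd_poly[of 1 R] by (simp add: density_True)
        then have "?r p = 1" using True by (simp add: zero_vec_def)
        moreover have "f p zero_vec = 1"
          using F_one by (simp add: f_def zero_vec_def map_replicate)
        ultimately show ?thesis using True by (simp add: clean_def)
      next
        case False
        then have "\<not> int p dvd D" using e p by auto
        then show ?thesis
          using False f_bounds(1)[OF P(2)[OF p] len] density_event_le_rho[OF P(2)[OF p] _ len] e p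
          by (auto simp: clean_def intro!: mult_left_mono)
      qed
    qed
    also have "\<dots> = F (tuple P e) * (\<Prod>p\<in>P. ?r p)"
      using e len P by (simp add: prod.distrib F_tuple)
    also have "(\<Prod>p\<in>P. ?r p) = (\<Prod>j<length Qs. \<Prod>p\<in>P. real (rho (Qs ! j) (p ^ (e p ! j))) / real (p ^ (e p ! j)))"
      by (rule prod.swap)
    also have "\<dots> = (\<Prod>j<length Qs. real (rho (Qs ! j) (tuple P e ! j)) / real (tuple P e ! j))"
      by (intro prod.cong refl) (simp only: lessThan_iff nth_tuple rho_prod[OF P])
    also have "\<dots> = (\<Prod>j<length Qs. real (rho (Qs ! j) (tuple P e ! j))) / real (prod_list (tuple P e))"
      by (simp add: prod_dividef tuple_def prod_list_upt)
    finally show "(\<Prod>p\<in>P. clean p (e p)) \<le> ?T (tuple P e)" by simp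
  qed
  also have "\<dots> = (\<Sum>ns\<in>tuple P ` ?B'. ?T ns)"
  proof (rule sum.reindex[symmetric, unfolded o_def])
    show "inj_on (tuple P) ?B'"
    proof (rule inj_onI)
      fix e e' assume e: "e \<in> ?B'" "e' \<in> ?B'" "tuple P e = tuple P e'"
      then have "e p = e' p" if "p \<in> P" for p
        using tuple_inj[OF P _ _ e(3) that] len by auto
      moreover have "e \<in> extensional P" "e' \<in> extensional P"
        using e by (auto simp: bounded_choices_def PiE_iff)
      ultimately show "e = e'" by (intro extensionalityI)
    qed
  qed
  also have "\<dots> \<le> target_sum x"
    unfolding target_sum_def
  proof (intro sum_mono2 finite_pos_tuples_le target_term_nonneg)
    show "tuple P ` ?B' \<subseteq> {ns. ns \<in> pos_tuples (length Qs) \<and> real (prod_list ns) \<le> x \<and> coprime (int (prod_list ns)) D}"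
    proof
      fix ns assume "ns \<in> tuple P ` ?B'"
      then obtain e where e: "e \<in> ?B'" "ns = tuple P e" by blast
      have pl: "prod_list ns = (\<Prod>p\<in>P. p ^ sum_list (e p))"
        using e len by (auto intro: prod_list_tuple)
      have "real (prod_list ns) \<le> x"
        using e(1) \<open>X \<le> x\<close> unfolding pl by (simp add: bounded_choices_def)
      moreover have "coprime (int (prod_list ns)) D"
      proof -
        have "coprime (int p ^ sum_list (e p)) D" if p: "p \<in> P" for p
        proof (cases "int p dvd D")
          case True
          then show ?thesis using e p by auto
        next
          case False
          then have "coprime (int p) D" using P(2)[OF p] by (simp add: prime_imp_coprime)
          then show ?thesis by simp
        qed
        then show ?thesis unfolding pl by (simp add: prod_coprime_left)
      qed
      ultimately show "ns \<in> {ns. ns \<in> pos_tuples (length Qs) \<and> real (prod_list ns) \<le> x \<and> coprime (int (prod_list ns)) D}"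
        using e tuple_pos[OF P] by auto
    qed
  qed auto
  finally show ?thesis .
qed

text \<open>The tuple of ones contributes 1. This permits charging the exceptional integers, which
  carry no arithmetic weight, to the main term.\<close>

lemma target_sum_ge_1: "x \<ge> 1 \<Longrightarrow> 1 \<le> target_sum x"
  using clean_sum_le_target[of "{}" 1 x 0] by (simp add: choice_sum_def bounded_choices_def)

end

section \<open>Sifted integers with prescribed smooth part\<close>

context weighted_system
begin

definition V :: "real \<Rightarrow> real" where
  "V z = (\<Prod>p\<in>primes_le z. 1 - w p)"

definition support :: "nat set \<Rightarrow> (nat \<Rightarrow> nat list) \<Rightarrow> nat set" where
  "support P e = {p \<in> P. e p \<noteq> zero_vec}"

text \<open>Exact valuations are prescribed on the support, and all other primes up to
  \<open>z\<close> are excluded. Primes outside the support and above \<open>z\<close> stay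
  free.\<close>

definition coupled :: "real \<Rightarrow> nat set \<Rightarrow> (nat \<Rightarrow> nat list) \<Rightarrow> nat \<Rightarrow> bool" where
  "coupled z P e n \<longleftrightarrow> (\<forall>p\<in>support P e. event p (e p) n)
     \<and> (\<forall>p\<in>primes_le z - support P e. \<not> int p dvd poly Q (int n))"

text \<open>The sieve runs over the primes up to \<open>z\<close> outside the support; the factors
  \<open>h p\<close> restore the missing ones to \<open>V z\<close>. The hypothesis on
  \<open>Z\<close> and \<open>z\<close> makes the remainder at most the main term, hence the factor
  2.\<close>

lemma coupled_count:
  fixes x y z Z :: real
  assumes P: "finite P" "\<And>p. p \<in> P \<Longrightarrow> prime p" and e: "e \<in> bounded_choices sum_list (exponents L) P Z"
    and x: "0 \<le> x" and z: "z > 1" and size: "Z\<^sup>2 * z powr (4 * (real g + 1)) \<le> y * V z" and "0 \<le> y"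
  shows "real (card {n. x < real n \<and> real n \<le> x + y \<and> coupled z P e n})
    \<le> 2 * sieve_const g * y * V z * (\<Prod>p\<in>support P e. h p * density (event p (e p)))"
proof -
  let ?S = "support P e"
  let ?P1 = "primes_le z - ?S"
  let ?X = "{n. x < real n \<and> real n \<le> x + y \<and> (\<forall>p\<in>?S. event p (e p) n)}"
  let ?per = "\<lambda>p. p ^ Suc (sum_list (e p))"
  define m where "m = (\<Prod>p\<in>?S. ?per p)"
  define dn where "dn = (\<Prod>p\<in>?S. density (event p (e p)))"
  have S: "finite ?S" "?S \<subseteq> P" using P by (auto simp: support_def)
  have prS: "prime p" if "p \<in> ?S" for p using that S P by auto
  have pr1: "prime p" if "p \<in> ?P1" for p using that by (auto simp: primes_le_def)
  have ex: "e p \<in> exponents L" if "p \<in> ?S" for p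
    using that e S by (auto simp: bounded_choices_def PiE_iff)
  have len: "length (e p) = length Qs" if "p \<in> ?S" for p
    using ex[OF that] by (simp add: exponents_def)
  have perS: "periodic (?per p) (event p (e p))" if "p \<in> ?S" for p
    using prS[OF that] len[OF that] by (intro periodic_event_sum_list) (auto simp: prime_gt_0_nat)
  have dn0: "0 \<le> dn" unfolding dn_def by (intro prod_nonneg) auto
  have w01: "0 \<le> 1 - w p" "1 - w p \<le> 1" "0 < 1 - w p" if "prime p" for p
    using w_bounds[OF that] by auto
  have count: "\<bar>real (card {n \<in> ?X. \<forall>p\<in>E. int p dvd poly Q (int n)}) - y * dn * (\<Prod>p\<in>E. real (rho Q p) / real p)\<bar>
      \<le> real m * dn * (\<Prod>p\<in>E. real (rho Q p))" if E: "E \<subseteq> ?P1" for E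
  proof -
    let ?m = "\<lambda>p. if p \<in> ?S then ?per p else p"
    let ?C = "\<lambda>p n. if p \<in> ?S then event p (e p) n else int p dvd poly Q (int n)"
    have finE: "finite E" using E finite_primes_le finite_subset by blast
    have disj: "?S \<inter> E = {}" using E by auto
    have pr: "prime p" if "p \<in> ?S \<union> E" for p using that prS pr1 E by auto
    have per: "periodic (?m p) (?C p)" if "p \<in> ?S \<union> E" for p
      using perS[of p] pr[OF that] periodic_dvd_poly[of p Q] by (auto simp: prime_gt_0_nat)
    have cop: "coprime (?m p) (?m q)" if "p \<in> ?S \<union> E" "q \<in> ?S \<union> E" "p \<noteq> q" for p q
      using primes_coprime[OF pr[OF that(1)] pr[OF that(2)] that(3)] by (auto simp del: power_Suc)
    have splitE: "(\<Prod>p\<in>?S \<union> E. u p) = (\<Prod>p\<in>?S. u p) * (\<Prod>p\<in>E. u p)"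
      for u :: "nat \<Rightarrow> 'b :: comm_monoid_mult"
      using S finE disj by (intro prod.union_disjoint)
    have notS: "p \<notin> ?S" if "p \<in> E" for p using that disj by auto
    have "(\<Prod>p\<in>?S \<union> E. ?m p) = m * \<Prod>E"
      unfolding splitE m_def using notS by (intro arg_cong2[where f = "(*)"] prod.cong) auto
    then have perC: "periodic (m * \<Prod>E) (\<lambda>n. \<forall>p\<in>?S \<union> E. ?C p n)"
      using periodic_Ball_prod[of "?S \<union> E" ?m ?C] per S finE by auto
    have "density (\<lambda>n. \<forall>p\<in>?S \<union> E. ?C p n) = (\<Prod>p\<in>?S \<union> E. density (?C p))"
      by (rule density_Ball_prod[where m = ?m]) (use S finE per cop in auto)
    also have "\<dots> = dn * (\<Prod>p\<in>E. real (rho Q p) / real p)"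
      unfolding splitE dn_def
    proof (intro arg_cong2[where f = "(*)"] prod.cong refl)
      fix p assume p: "p \<in> E"
      then show "density (?C p) = real (rho Q p) / real p"
        using notS[OF p] pr[of p] by (simp add: density_dvd_poly prime_gt_0_nat)
    qed simp
    finally have dC: "density (\<lambda>n. \<forall>p\<in>?S \<union> E. ?C p n) = dn * (\<Prod>p\<in>E. real (rho Q p) / real p)" .
    have "(\<forall>p\<in>?S \<union> E. ?C p n) \<longleftrightarrow> (\<forall>p\<in>?S. event p (e p) n) \<and> (\<forall>p\<in>E. int p dvd poly Q (int n))" for n
      using notS by auto
    then have set: "{n \<in> ?X. \<forall>p\<in>E. int p dvd poly Q (int n)} = {n. x < real n \<and> real n \<le> x + y \<and> (\<forall>p\<in>?S \<union> E. ?C p n)}"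
      by auto
    have "real (m * \<Prod>E) * (dn * (\<Prod>p\<in>E. real (rho Q p) / real p)) = real m * dn * (\<Prod>p\<in>E. real p * (real (rho Q p) / real p))"
      by (simp only: prod.distrib of_nat_mult of_nat_prod mult_ac)
    also have "(\<Prod>p\<in>E. real p * (real (rho Q p) / real p)) = (\<Prod>p\<in>E. real (rho Q p))"
      using pr by (intro prod.cong refl) (auto simp: prime_gt_0_nat)
    finally have err: "real (m * \<Prod>E) * (dn * (\<Prod>p\<in>E. real (rho Q p) / real p)) = real m * dn * (\<Prod>p\<in>E. real (rho Q p))" .
    show ?thesis
      using card_periodic_interval[OF perC x \<open>0 \<le> y\<close>] unfolding dC set err by (simp only: mult.assoc)
  qed
  have sieve: "real (card {n \<in> ?X. \<forall>p\<in>?P1. \<not> int p dvd poly Q (int n)})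
    \<le> sieve_const g * (y * dn) * (\<Prod>p\<in>?P1. 1 - real (rho Q p) / real p) + (real m * dn) * z powr (4 * (real g + 1))"
  proof (rule upper_bound_sieve[OF _ z _ g_pos])
    show "finite ?X" by simp
  qed (use count pr1 rho_le_g rho_le_pred dn0 \<open>0 \<le> y\<close> in auto)
  have V1: "V z \<le> (\<Prod>p\<in>?P1. 1 - w p)" "0 \<le> V z"
  proof -
    have "V z = (\<Prod>p\<in>?P1. 1 - w p) * (\<Prod>p\<in>primes_le z \<inter> ?S. 1 - w p)"
      unfolding V_def by (subst prod.union_disjoint[symmetric]) (auto intro!: prod.cong)
    also have "\<dots> \<le> (\<Prod>p\<in>?P1. 1 - w p) * 1"
      using w01 prS pr1 by (intro mult_left_mono prod_le_1 prod_nonneg) auto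
    finally show "V z \<le> (\<Prod>p\<in>?P1. 1 - w p)" by simp
    show "0 \<le> V z" unfolding V_def using w01 by (intro prod_nonneg) (auto simp: primes_le_def)
  qed
  have V2: "(\<Prod>p\<in>?P1. 1 - w p) \<le> V z * (\<Prod>p\<in>?S. h p)"
  proof -
    have "(\<Prod>p\<in>?P1. 1 - w p) = V z * (\<Prod>p\<in>primes_le z \<inter> ?S. h p)"
    proof -
      have "V z = (\<Prod>p\<in>?P1. 1 - w p) * (\<Prod>p\<in>primes_le z \<inter> ?S. 1 - w p)"
        unfolding V_def by (subst prod.union_disjoint[symmetric]) (auto intro!: prod.cong)
      moreover have "(\<Prod>p\<in>primes_le z \<inter> ?S. 1 - w p) * (\<Prod>p\<in>primes_le z \<inter> ?S. h p) = 1"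
        unfolding prod.distrib[symmetric]
      proof (rule prod.neutral, rule ballI)
        fix p assume "p \<in> primes_le z \<inter> ?S"
        then show "(1 - w p) * h p = 1"
          using w01(3)[OF prS[of p]] by (simp add: h_def)
      qed
      ultimately show ?thesis by simp
    qed
    also have "\<dots> \<le> V z * (\<Prod>p\<in>?S. h p)"
    proof (intro mult_left_mono V1(2) prod_mono2)
      show "1 \<le> h p" if "p \<in> ?S - primes_le z \<inter> ?S" for p using that h_bounds(1)[OF prS] by auto
      show "0 \<le> h p" if "p \<in> primes_le z \<inter> ?S" for p using that h_bounds(1)[OF prS[of p]] by auto
    qed (use S in auto)
    finally show ?thesis .
  qed
  \<comment> \<open>An exact valuation \<open>s >= 1\<close> is decided modulo
    \<open>p ^ Suc s\<close>, and \<open>Suc s <= 2 * s\<close>; so the modulus is at most the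
    square of the prescribed part.\<close>
  have mZ: "real m \<le> Z\<^sup>2"
  proof -
    have "real m = (\<Prod>p\<in>?S. real p ^ Suc (sum_list (e p)))"
      by (simp add: m_def of_nat_prod)
    also have "\<dots> \<le> (\<Prod>p\<in>?S. (real p ^ sum_list (e p))\<^sup>2)"
    proof (intro prod_mono conjI)
      fix p assume p: "p \<in> ?S"
      then have "sum_list (e p) \<ge> 1"
        using ex[OF p] sum_list_pos by (auto simp: support_def)
      then have "Suc (sum_list (e p)) \<le> sum_list (e p) * 2" by linarith
      then show "real p ^ Suc (sum_list (e p)) \<le> (real p ^ sum_list (e p))\<^sup>2"
        using prime_ge_1_nat[OF prS[OF p]] unfolding power_mult[symmetric] by (intro power_increasing) auto
    qed auto
    also have "\<dots> = (\<Prod>p\<in>?S. real p ^ sum_list (e p))\<^sup>2"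
      by (rule prod_power_distrib[symmetric])
    also have "(\<Prod>p\<in>?S. real p ^ sum_list (e p)) = (\<Prod>p\<in>P. real p ^ sum_list (e p))"
      using P S by (intro prod.mono_neutral_left) (auto simp: support_def)
    also have "(\<Prod>p\<in>P. real p ^ sum_list (e p))\<^sup>2 \<le> Z\<^sup>2"
      using e by (intro power_mono prod_nonneg) (auto simp: bounded_choices_def)
    finally show ?thesis .
  qed
  have "(real m * dn) * z powr (4 * (real g + 1)) = dn * (real m * z powr (4 * (real g + 1)))"
    by (simp only: mult_ac)
  also have "\<dots> \<le> dn * (Z\<^sup>2 * z powr (4 * (real g + 1)))"
    using mZ dn0 by (intro mult_left_mono mult_right_mono) auto
  also have "\<dots> \<le> dn * (y * V z)"
    using size dn0 by (intro mult_left_mono)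
  also have "\<dots> \<le> dn * (y * (\<Prod>p\<in>?P1. 1 - w p))"
    using V1 dn0 \<open>0 \<le> y\<close> by (intro mult_left_mono) auto
  also have "\<dots> = 1 * ((y * dn) * (\<Prod>p\<in>?P1. 1 - w p))"
    by (simp only: mult_ac mult_1)
  also have "\<dots> \<le> sieve_const g * ((y * dn) * (\<Prod>p\<in>?P1. 1 - w p))"
    using sieve_const_ge_1[of g] dn0 \<open>0 \<le> y\<close> w01 pr1
    by (intro mult_right_mono mult_nonneg_nonneg prod_nonneg) auto
  finally have err: "(real m * dn) * z powr (4 * (real g + 1)) \<le> sieve_const g * ((y * dn) * (\<Prod>p\<in>?P1. 1 - w p))" .
  have "{n. x < real n \<and> real n \<le> x + y \<and> coupled z P e n} = {n \<in> ?X. \<forall>p\<in>?P1. \<not> int p dvd poly Q (int n)}"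
    by (auto simp: coupled_def)
  then have "real (card {n. x < real n \<and> real n \<le> x + y \<and> coupled z P e n})
      \<le> 2 * sieve_const g * ((y * dn) * (\<Prod>p\<in>?P1. 1 - w p))"
    using sieve err by (simp add: w_def)
  also have "\<dots> \<le> 2 * sieve_const g * ((y * dn) * (V z * (\<Prod>p\<in>?S. h p)))"
    using V2 sieve_const_ge_1[of g] dn0 \<open>0 \<le> y\<close> by (intro mult_left_mono) auto
  also have "\<dots> = 2 * sieve_const g * y * V z * (\<Prod>p\<in>?S. h p * density (event p (e p)))"
    by (simp only: dn_def prod.distrib mult_ac)
  finally show ?thesis .
qed

end

section \<open>Prime parts of integers and the splitting of F along them\<close>

lemma prod_coprime_dvd:
  fixes u :: "nat \<Rightarrow> nat"
  assumes "finite P" "\<And>p q. p \<in> P \<Longrightarrow> q \<in> P \<Longrightarrow> p \<noteq> q \<Longrightarrow> coprime (u p) (u q)" "\<And>p. p \<in> P \<Longrightarrow> u p dvd N"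
  shows "(\<Prod>p\<in>P. u p) dvd N"
  using assms
proof (induction P rule: finite_induct)
  case (insert p P)
  have "coprime (u p) (\<Prod>p\<in>P. u p)"
    by (rule prod_coprime_right) (use insert in auto)
  then show ?case using insert by (auto intro!: divides_mult)
qed simp

lemma prod_list_pos_nat: "(\<And>n. n \<in> set ns \<Longrightarrow> 0 < n) \<Longrightarrow> 0 < (prod_list ns :: nat)"
  by (induction ns) auto

definition prime_part :: "nat set \<Rightarrow> nat \<Rightarrow> nat" where
  "prime_part P N = (\<Prod>p\<in>P. p ^ multiplicity p N)"

lemma prime_part_dvd:
  assumes "finite P" "\<And>p. p \<in> P \<Longrightarrow> prime p"
  shows "prime_part P N dvd N"
  unfolding prime_part_def using assms
  by (intro prod_coprime_dvd) (auto intro: primes_coprime simp: multiplicity_dvd)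

lemma prime_part_pos: "(\<And>p. p \<in> P \<Longrightarrow> prime p) \<Longrightarrow> prime_part P N > 0"
  unfolding prime_part_def by (intro prod_pos) (auto simp: prime_gt_0_nat)

lemma not_dvd_cofactor_prime_part:
  assumes "finite P" "\<And>p. p \<in> P \<Longrightarrow> prime p" "N > 0" "p \<in> P"
  shows "\<not> p dvd N div prime_part P N"
proof
  assume dv: "p dvd N div prime_part P N"
  have N: "N = prime_part P N * (N div prime_part P N)"
    using prime_part_dvd[OF assms(1,2)] by simp
  have c0: "N div prime_part P N \<noteq> 0"
    using N assms(3) by (metis mult_0_right less_irrefl)
  have pp: "prime_part P N \<noteq> 0" using prime_part_pos[of P N] assms(2) by auto
  have "multiplicity p N = multiplicity p (prime_part P N) + multiplicity p (N div prime_part P N)"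
    using assms c0 pp by (subst N, intro prime_elem_multiplicity_mult_distrib) auto
  moreover have "multiplicity p (prime_part P N) = multiplicity p N"
    unfolding prime_part_def using assms by (subst multiplicity_prod_prime_powers) auto
  moreover have "multiplicity p (N div prime_part P N) > 0"
    using dv c0 assms by (simp add: prime_multiplicity_gt_zero_iff)
  ultimately show False by simp
qed

lemma power_bigomega_le:
  assumes "b > 0" "\<And>p. prime p \<Longrightarrow> p dvd b \<Longrightarrow> q \<le> p"
  shows "q ^ Defs.bigomega b \<le> b"
proof -
  have "q ^ size M \<le> prod_mset M" if "\<And>p. p \<in># M \<Longrightarrow> q \<le> p" for M :: "nat multiset"
    using that by (induction M) (auto intro: mult_mono)
  then have "q ^ size (prime_factorization b) \<le> prod_mset (prime_factorization b)"
    using assms(2) by (auto simp: in_prime_factors_iff)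
  also have "\<dots> = b" using assms(1) by (simp add: prod_mset_prime_factorization_nat)
  finally show ?thesis by (simp add: Defs.bigomega_def)
qed

context weighted_system
begin

definition vals :: "nat \<Rightarrow> nat list" where
  "vals n = map (\<lambda>P. nat \<bar>poly P (int n)\<bar>) Qs"

definition valuation :: "nat \<Rightarrow> nat \<Rightarrow> nat list" where
  "valuation n p = map (\<lambda>N. multiplicity p N) (vals n)"

lemma length_valuation [simp]: "length (valuation n p) = length Qs" "length (vals n) = length Qs"
  by (simp_all add: valuation_def vals_def)

lemma prod_list_vals: "prod_list (vals n) = nat \<bar>poly Q (int n)\<bar>"
proof -
  have "prod_list (map (\<lambda>P. nat \<bar>poly P x\<bar>) Ps) = nat \<bar>poly (prod_list Ps) x\<bar>" for Ps :: "int poly list" and x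
    by (induction Ps) (auto simp: abs_mult nat_mult_distrib)
  then show ?thesis by (simp add: vals_def Q_eq)
qed

lemma vals_pos:
  assumes "poly Q (int n) \<noteq> 0"
  shows "vals n \<in> pos_tuples (length Qs)"
proof -
  have "prod_list (vals n) \<noteq> 0" using assms by (simp add: prod_list_vals)
  then have "0 \<notin> set (vals n)" by (simp add: prod_list_zero_iff)
  then show ?thesis by (auto simp: pos_tuples_def intro!: gr0I)
qed

lemma nth_vals: "j < length Qs \<Longrightarrow> vals n ! j = nat \<bar>poly (Qs ! j) (int n)\<bar>"
  by (simp add: vals_def)

lemma event_valuation:
  assumes "prime p" "poly Q (int n) \<noteq> 0"
  shows "event p (valuation n p) n"
  unfolding event_def
proof (intro allI impI)
  fix j assume j: "j < length Qs"
  let ?N = "nat \<bar>poly (Qs ! j) (int n)\<bar>"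
  have pos: "?N > 0"
    using vals_pos[OF assms(2)] j by (auto simp: pos_tuples_def nth_vals[symmetric])
  have dv: "int p ^ a dvd poly (Qs ! j) (int n) \<longleftrightarrow> p ^ a dvd ?N" for a
    by (simp add: int_dvd_int_iff[symmetric] del: of_nat_power) (simp add: of_nat_power)
  have "valuation n p ! j = multiplicity p ?N"
    using j by (simp add: valuation_def nth_vals)
  moreover have "p ^ a dvd ?N \<longleftrightarrow> a \<le> multiplicity p ?N" for a
    using assms(1) pos by (intro power_dvd_iff_le_multiplicity) auto
  ultimately show "int p ^ (valuation n p ! j) dvd poly (Qs ! j) (int n)
      \<and> \<not> int p ^ Suc (valuation n p ! j) dvd poly (Qs ! j) (int n)"
    by (simp only: dv) auto
qed

lemma sum_list_valuation:
  assumes "prime p" "poly Q (int n) \<noteq> 0"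
  shows "sum_list (valuation n p) = multiplicity p (nat \<bar>poly Q (int n)\<bar>)"
proof -
  have "0 \<notin> set Ns \<Longrightarrow> sum_list (map (multiplicity p) Ns) = multiplicity p (prod_list Ns)" for Ns :: "nat list"
    using assms(1) by (induction Ns) (auto simp: prime_elem_multiplicity_mult_distrib prod_list_zero_iff)
  then show ?thesis
    using vals_pos[OF assms(2)] by (fastforce simp: valuation_def pos_tuples_def prod_list_vals)
qed

text \<open>The cofactor \<open>b\<close> of the part built from \<open>P\<close> is coprime to it,
  so the defining inequality of \<open>class_M\<close> applies with \<open>A ^ bigomega b\<close>.
  All prime factors of \<open>b\<close> are at least \<open>q\<close>, so
  \<open>q ^ bigomega b\<close> is at most \<open>|Q n|\<close>, which bounds
  \<open>bigomega b\<close> by \<open>ln |Q n| / ln q\<close>.\<close>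

lemma F_split:
  assumes n: "poly Q (int n) \<noteq> 0" and P: "finite P" "\<And>p. p \<in> P \<Longrightarrow> prime p"
    and q: "\<And>p. prime p \<Longrightarrow> p \<notin> P \<Longrightarrow> int p dvd poly Q (int n) \<Longrightarrow> q \<le> p"
  shows "\<exists>m. q ^ m \<le> nat \<bar>poly Q (int n)\<bar> \<and> F (vals n) \<le> A ^ m * (\<Prod>p\<in>P. f p (valuation n p))"
proof -
  let ?N = "vals n"
  let ?b = "map (\<lambda>N. N div prime_part P N) ?N"
  have Npos: "N > 0" if "N \<in> set ?N" for N using vals_pos[OF n] that by (auto simp: pos_tuples_def)
  have eqN: "N div prime_part P N * prime_part P N = N" for N
    using prime_part_dvd[OF P] by simp
  have bpos: "N div prime_part P N > 0" if "N > 0" for N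
    using eqN[of N] that by (metis mult_0 neq0_conv)
  have tup: "tuple P (valuation n) = map (prime_part P) ?N"
    by (rule nth_equalityI) (auto simp: nth_tuple prime_part_def valuation_def)
  have split: "?N = map2 (*) ?b (tuple P (valuation n))"
    unfolding tup by (rule nth_equalityI) (auto simp: eqN)
  have b: "?b \<in> pos_tuples (length Qs)"
    using Npos bpos by (auto simp: pos_tuples_def)
  have t: "tuple P (valuation n) \<in> pos_tuples (length Qs)" by (rule tuple_pos[OF P])
  have notdvd: "\<not> p dvd prod_list ?b" if p: "p \<in> P" for p
    using prime_dvd_prod_list[OF P(2)[OF p], of ?b] not_dvd_cofactor_prime_part[OF P _ p] Npos by auto
  have "coprime (prod_list ?b) (prod_list (tuple P (valuation n)))"
    unfolding prod_list_tuple[OF length_valuation(1)]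
  proof (rule prod_coprime_right)
    fix p assume p: "p \<in> P"
    then have "coprime p (prod_list ?b)" using P notdvd by (simp add: prime_imp_coprime)
    then show "coprime (prod_list ?b) (p ^ sum_list (valuation n p))"
      by (simp add: coprime_commute)
  qed
  then have "F ?N \<le> A ^ Defs.bigomega (prod_list ?b) * F (tuple P (valuation n))"
    by (subst split) (rule F_prod_le(1)[OF b t])
  then have 1: "F ?N \<le> A ^ Defs.bigomega (prod_list ?b) * (\<Prod>p\<in>P. f p (valuation n p))"
    by (simp only: F_tuple[OF P length_valuation(1)])
  have prodN: "prod_list ?N = prod_list ?b * prod_list (tuple P (valuation n))"
  proof -
    have "prod_list (map2 (*) as bs) = prod_list as * prod_list bs" if "length as = length bs" for as bs :: "nat list"
      using that by (induction as bs rule: list_induct2) (auto simp: mult_ac)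
    then show ?thesis by (subst split) simp
  qed
  have pos: "prod_list ?b > 0" "prod_list (tuple P (valuation n)) > 0"
    using b t by (auto simp only: pos_tuples_def mem_Collect_eq intro!: prod_list_pos_nat)
  have "q ^ Defs.bigomega (prod_list ?b) \<le> prod_list ?b"
  proof (rule power_bigomega_le[OF pos(1)])
    fix p assume p: "prime p" "p dvd prod_list ?b"
    have "p dvd nat \<bar>poly Q (int n)\<bar>" unfolding prod_list_vals[symmetric] prodN using p(2) by (rule dvd_mult2)
    then have "int p dvd poly Q (int n)" by (simp add: int_dvd_int_iff[symmetric])
    moreover have "p \<notin> P" using notdvd p by auto
    ultimately show "q \<le> p" using q p by blast
  qed
  also have "\<dots> \<le> prod_list ?N" unfolding prodN using pos by simp
  finally show ?thesis using 1 by (auto simp: prod_list_vals)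
qed

lemma F_vals_le:
  assumes "poly Q (int n) \<noteq> 0"
  shows "F (vals n) \<le> B * real (nat \<bar>poly Q (int n)\<bar>) powr \<epsilon>"
  using F_le(2)[OF vals_pos[OF assms]] by (simp add: prod_list_vals)

text \<open>The factor \<open>T powr (- \<beta>)\<close> comes from Rankin's device.\<close>

lemma class_sum_le:
  fixes x y z Z :: real
  assumes S: "S \<subseteq> {n. x < real n \<and> real n \<le> x + y}"
    and P: "P \<subseteq> primes_le W" "W \<ge> 1" and \<beta>: "0 \<le> \<beta>" "\<beta> * ln W \<le> K" "\<beta> + \<epsilon> \<le> 1 / (2 * real g)"
    and en: "\<And>n. n \<in> S \<Longrightarrow> en n \<in> bounded_choices sum_list (exponents L) P Z"
    and cp: "\<And>n. n \<in> S \<Longrightarrow> coupled z P (en n) n"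
    and Fn: "\<And>n. n \<in> S \<Longrightarrow> F (vals n) \<le> a * (\<Prod>p\<in>P. f p (en n p))" and a: "0 \<le> a"
    and T: "0 < T" "\<And>n. n \<in> S \<Longrightarrow> T \<le> (\<Prod>p\<in>P. real p ^ sum_list (en n p))"
    and x: "0 \<le> x" "Z \<le> x" and z: "z > 1" and size: "Z\<^sup>2 * z powr (4 * (real g + 1)) \<le> y * V z" and y: "0 \<le> y"
  shows "(\<Sum>n\<in>S. F (vals n)) \<le> a * (2 * sieve_const g * y * V z)
    * (T powr (- \<beta>) * (Delta_factor Qs F D * exp (excess_const K * (4 * K + 1)) * target_sum x))"
proof -
  let ?B = "bounded_choices sum_list (exponents L) P Z"
  let ?E = "en ` S"
  let ?val = "\<lambda>e. \<Prod>p\<in>P. real p ^ sum_list (e p)"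
  have finP: "finite P" using P finite_primes_le finite_subset by blast
  have pr: "prime p" if "p \<in> P" for p using that P by (auto simp: primes_le_def)
  have finX: "finite {n::nat. x < real n \<and> real n \<le> x + y}"
    using finite_interval_nat[of x "x + y" "\<lambda>_. True"] by simp
  have finS: "finite S" using S finX finite_subset by blast
  have finE: "finite ?E" "?E \<subseteq> ?B" using finS en by auto
  have ex: "e p \<in> exponents L" if "e \<in> ?E" "p \<in> P" for e p
    using that en by (auto simp: bounded_choices_def PiE_iff)
  have len: "length (e p) = length Qs" if "e \<in> ?E" "p \<in> P" for e p
    using ex[OF that] by (simp add: exponents_def)
  have f0: "0 \<le> (\<Prod>p\<in>P. f p (e p))" if "e \<in> ?E" for e
    using that f_bounds(1)[OF pr len] by (intro prod_nonneg) auto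
  have sz0: "0 \<le> y * V z"
    using size by (rule order_trans[rotated]) (auto intro!: mult_nonneg_nonneg)
  have "(\<Sum>n\<in>S. F (vals n)) \<le> (\<Sum>n\<in>S. a * (\<Prod>p\<in>P. f p (en n p)))"
    by (intro sum_mono Fn)
  also have "\<dots> = (\<Sum>e\<in>?E. \<Sum>n | n \<in> S \<and> en n = e. a * (\<Prod>p\<in>P. f p (en n p)))"
    by (rule sum.image_gen[OF finS])
  also have "\<dots> = (\<Sum>e\<in>?E. real (card {n. n \<in> S \<and> en n = e}) * (a * (\<Prod>p\<in>P. f p (e p))))"
    by (intro sum.cong refl) simp
  also have "\<dots> \<le> (\<Sum>e\<in>?E. (2 * sieve_const g * y * V z * (\<Prod>p\<in>support P e. h p * density (event p (e p)))) * (a * (\<Prod>p\<in>P. f p (e p))))"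
  proof (intro sum_mono mult_right_mono)
    fix e assume e: "e \<in> ?E"
    have "card {n. n \<in> S \<and> en n = e} \<le> card {n. x < real n \<and> real n \<le> x + y \<and> coupled z P e n}"
      using S cp by (intro card_mono) auto
    also have "real \<dots> \<le> 2 * sieve_const g * y * V z * (\<Prod>p\<in>support P e. h p * density (event p (e p)))"
      using e finE by (intro coupled_count[OF finP pr _ x(1) z size y]) auto
    finally show "real (card {n. n \<in> S \<and> en n = e}) \<le> 2 * sieve_const g * y * V z * (\<Prod>p\<in>support P e. h p * density (event p (e p)))"
      by simp
    show "0 \<le> a * (\<Prod>p\<in>P. f p (e p))" using f0[OF e] a by simp
  qed
  \<comment> \<open>The density and \<open>h\<close> delivered by the sieve combine with
    \<open>f\<close> to the untwisted weight; off the support \<open>f\<close> equals 1.\<close>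
  also have "\<dots> = (\<Sum>e\<in>?E. a * (2 * sieve_const g * y * V z) * (\<Prod>p\<in>P. twisted 0 p (e p)))"
  proof (intro sum.cong refl)
    fix e assume e: "e \<in> ?E"
    have "(\<Prod>p\<in>P. twisted 0 p (e p)) = (\<Prod>p\<in>P. (if e p \<noteq> zero_vec then h p * density (event p (e p)) else 1) * f p (e p))"
    proof (intro prod.cong refl)
      fix p assume p: "p \<in> P"
      have "f p zero_vec = 1" using F_one by (simp add: f_def zero_vec_def map_replicate)
      then show "twisted 0 p (e p) = (if e p \<noteq> zero_vec then h p * density (event p (e p)) else 1) * f p (e p)"
        using pr[OF p] by (auto simp: twisted_def prime_gt_0_nat)
    qed
    also have "\<dots> = (\<Prod>p\<in>support P e. h p * density (event p (e p))) * (\<Prod>p\<in>P. f p (e p))"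
    proof -
      have "(\<Prod>p\<in>P. if e p \<noteq> zero_vec then h p * density (event p (e p)) else 1) = (\<Prod>p\<in>support P e. h p * density (event p (e p)))"
        unfolding support_def by (rule prod.inter_filter[OF finP, symmetric])
      then show ?thesis by (simp only: prod.distrib[where g = "\<lambda>p. if e p \<noteq> zero_vec then h p * density (event p (e p)) else 1"])
    qed
    finally show "(2 * sieve_const g * y * V z * (\<Prod>p\<in>support P e. h p * density (event p (e p)))) * (a * (\<Prod>p\<in>P. f p (e p)))
        = a * (2 * sieve_const g * y * V z) * (\<Prod>p\<in>P. twisted 0 p (e p))"
      by (simp only: mult_ac)
  qed
  also have "\<dots> = a * (2 * sieve_const g * y * V z) * (\<Sum>e\<in>?E. \<Prod>p\<in>P. twisted 0 p (e p))"
    by (rule sum_distrib_left[symmetric])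
  also have "\<dots> \<le> a * (2 * sieve_const g * y * V z)
    * (T powr (- \<beta>) * (Delta_factor Qs F D * exp (excess_const K * (4 * K + 1)) * target_sum x))"
  proof (rule mult_left_mono)
    have tw0: "0 \<le> twisted b p \<nu>" if "prime p" "\<nu> \<in> exponents L" "0 \<le> b" for b p \<nu>
      using clean_nonneg[OF that(1,2)] clean_le_twisted[OF that] by linarith
    have "(\<Sum>e\<in>?E. \<Prod>p\<in>P. twisted 0 p (e p)) \<le> (\<Sum>e\<in>?E. T powr (- \<beta>) * (\<Prod>p\<in>P. twisted \<beta> p (e p)))"
    proof (rule sum_mono)
      fix e assume e: "e \<in> ?E"
      have v: "T \<le> ?val e" using e T by auto
      have "(\<Prod>p\<in>P. twisted \<beta> p (e p)) = (\<Prod>p\<in>P. (real p ^ sum_list (e p)) powr \<beta> * twisted 0 p (e p))"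
      proof (intro prod.cong refl)
        fix p assume p: "p \<in> P"
        have p0: "real p > 0" using pr[OF p] by (simp add: prime_gt_0_nat)
        have "(real p ^ sum_list (e p)) powr \<beta> = real p powr (\<beta> * real (sum_list (e p)))"
          using p0 by (simp add: powr_powr mult.commute flip: powr_realpow)
        then show "twisted \<beta> p (e p) = (real p ^ sum_list (e p)) powr \<beta> * twisted 0 p (e p)"
          using p0 by (simp add: twisted_def)
      qed
      also have "\<dots> = (?val e) powr \<beta> * (\<Prod>p\<in>P. twisted 0 p (e p))"
        by (simp add: prod.distrib prod_powr_distrib)
      finally have tw: "(\<Prod>p\<in>P. twisted \<beta> p (e p)) = (?val e) powr \<beta> * (\<Prod>p\<in>P. twisted 0 p (e p))" .
      have "T powr \<beta> \<le> (?val e) powr \<beta>"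
        using v T \<beta> by (intro powr_mono2) auto
      then have "T powr (- \<beta>) * T powr \<beta> \<le> T powr (- \<beta>) * (?val e) powr \<beta>"
        by (intro mult_left_mono) auto
      then have one: "1 \<le> T powr (- \<beta>) * (?val e) powr \<beta>"
        using T by (simp flip: powr_add)
      have "0 \<le> (\<Prod>p\<in>P. twisted 0 p (e p))"
        by (intro prod_nonneg ballI tw0 pr ex[OF e]) auto
      from mult_right_mono[OF one this]
      show "(\<Prod>p\<in>P. twisted 0 p (e p)) \<le> T powr (- \<beta>) * (\<Prod>p\<in>P. twisted \<beta> p (e p))"
        unfolding tw by (simp only: mult_1 mult.assoc)
    qed
    also have "\<dots> = T powr (- \<beta>) * (\<Sum>e\<in>?E. \<Prod>p\<in>P. twisted \<beta> p (e p))"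
      by (rule sum_distrib_left[symmetric])
    also have "\<dots> \<le> T powr (- \<beta>) * (Delta_factor Qs F D * exp (excess_const K * (4 * K + 1)) * target_sum x)"
    proof (rule mult_left_mono)
      have "(\<Sum>e\<in>?E. \<Prod>p\<in>P. twisted \<beta> p (e p)) \<le> choice_sum sum_list (exponents L) (twisted \<beta>) P Z"
        unfolding choice_sum_def using finE finP tw0[OF pr _ \<beta>(1)]
        by (intro sum_mono2 finite_bounded_choices prod_nonneg) (auto simp: bounded_choices_def PiE_iff)
      also have "\<dots> \<le> Delta_factor Qs F D * exp (excess_const K * (4 * K + 1)) * choice_sum sum_list (exponents L) clean P Z"
        by (rule twisted_sum_le[OF P \<beta>])
      also have "\<dots> \<le> Delta_factor Qs F D * exp (excess_const K * (4 * K + 1)) * target_sum x"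
        using Delta_factor_ge_1 by (intro mult_left_mono clean_sum_le_target finP pr x) auto
      finally show "(\<Sum>e\<in>?E. \<Prod>p\<in>P. twisted \<beta> p (e p)) \<le> Delta_factor Qs F D * exp (excess_const K * (4 * K + 1)) * target_sum x" .
    qed simp
    finally show "(\<Sum>e\<in>?E. \<Prod>p\<in>P. twisted 0 p (e p))
        \<le> T powr (- \<beta>) * (Delta_factor Qs F D * exp (excess_const K * (4 * K + 1)) * target_sum x)" .
    show "0 \<le> a * (2 * sieve_const g * y * V z)"
      using a sz0 sieve_const_ge_1[of g] by (simp add: mult.assoc)
  qed
  finally show ?thesis .
qed

end

section \<open>Exceptional integers\<close>

context poly_system
begin

lemma card_dvd_le:
  assumes "0 < d" "real d \<le> y" "0 \<le> x"
  shows "real (card {n. x < real n \<and> real n \<le> x + y \<and> int d dvd poly Q (int n)})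
    \<le> 2 * y * density (\<lambda>n. int d dvd poly Q (int n))"
proof -
  let ?\<delta> = "density (\<lambda>n. int d dvd poly Q (int n))"
  have y: "0 \<le> y" using assms by linarith
  have "real (card {n. x < real n \<and> real n \<le> x + y \<and> int d dvd poly Q (int n)}) - y * ?\<delta> \<le> real d * ?\<delta>"
    using card_periodic_interval[OF periodic_dvd_poly[OF assms(1)] assms(3) y, of Q] by linarith
  moreover have "real d * ?\<delta> \<le> y * ?\<delta>" using assms by (intro mult_right_mono) auto
  ultimately show ?thesis by linarith
qed

lemma card_dvd_family_le:
  assumes fin: "finite \<D>" and d: "\<And>d. d \<in> \<D> \<Longrightarrow> 0 < d" "\<And>d. d \<in> \<D> \<Longrightarrow> real d \<le> y"
    and dens: "\<And>d. d \<in> \<D> \<Longrightarrow> density (\<lambda>n. int d dvd poly Q (int n)) \<le> c"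
    and x: "0 \<le> x" "0 \<le> y"
  shows "real (card {n. x < real n \<and> real n \<le> x + y \<and> (\<exists>d\<in>\<D>. int d dvd poly Q (int n))})
    \<le> real (card \<D>) * (2 * y * c)"
proof -
  let ?A = "\<lambda>d. {n. x < real n \<and> real n \<le> x + y \<and> int d dvd poly Q (int n)}"
  have "{n. x < real n \<and> real n \<le> x + y \<and> (\<exists>d\<in>\<D>. int d dvd poly Q (int n))} = (\<Union>d\<in>\<D>. ?A d)" by auto
  then have "real (card {n. x < real n \<and> real n \<le> x + y \<and> (\<exists>d\<in>\<D>. int d dvd poly Q (int n))}) \<le> real (\<Sum>d\<in>\<D>. card (?A d))"
    using card_UN_le[OF fin, of ?A] by (simp only: of_nat_le_iff)
  also have "\<dots> = (\<Sum>d\<in>\<D>. real (card (?A d)))" by simp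
  also have "\<dots> \<le> (\<Sum>d\<in>\<D>. 2 * y * c)"
  proof (intro sum_mono)
    fix d assume dD: "d \<in> \<D>"
    have "real (card (?A d)) \<le> 2 * y * density (\<lambda>n. int d dvd poly Q (int n))"
      by (rule card_dvd_le[OF d(1)[OF dD] d(2)[OF dD] x(1)])
    also have "\<dots> \<le> 2 * y * c" using dens[OF dD] x by (intro mult_left_mono) auto
    finally show "real (card (?A d)) \<le> 2 * y * c" .
  qed
  finally show ?thesis by simp
qed

text \<open>In terms of the modulus \<open>p ^ m\<close> itself, so that the bounds for several
  primes multiply to a power of the whole modulus.\<close>

lemma density_prime_power_le:
  assumes p: "prime p"
  shows "density (\<lambda>n. int (p ^ m) dvd poly Q (int n)) \<le> real g * real (p ^ m) powr (- (1 / real g))"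
proof (cases "m = 0")
  case True
  then show ?thesis using g_pos by (simp add: density_True)
next
  case False
  have "real (p ^ m) powr (- (1 / real g)) = real p powr (- (real m / real g))"
    using prime_gt_0_nat[OF p] by (simp add: powr_powr flip: powr_realpow)
  then show ?thesis
    using density_Q_power_le[OF p, of m] False by simp
qed

text \<open>For each prime \<open>q\<close> the least power above \<open>sqrt Z\<close> suffices;
  since \<open>q <= sqrt Z\<close>, it does not exceed \<open>Z\<close>. There are at most
  \<open>Z powr (1 / (10 * g))\<close> such \<open>q\<close>, and each power divides
  \<open>Q n\<close> with density at most \<open>g * Z powr (- 1 / (2 * g))\<close>.\<close>

lemma prime_power_exceptions:
  fixes x y Z :: real
  assumes x: "0 \<le> x" and Z: "Z \<ge> 1" "Z \<le> y"
  shows "real (card {n. x < real n \<and> real n \<le> x + y \<and>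
      (\<exists>q l. prime q \<and> real q ^ (10 * g) \<le> Z \<and> sqrt Z < real (q ^ l) \<and> int (q ^ l) dvd poly Q (int n))})
    \<le> Z powr (1 / (10 * real g)) * (2 * y * (real g * Z powr (- (1 / (2 * real g)))))"
proof -
  let ?U = "{q. prime q \<and> real q ^ (10 * g) \<le> Z}"
  define l where "l q = (LEAST l. sqrt Z < real (q ^ l))" for q
  let ?D = "(\<lambda>q. q ^ l q) ` ?U"
  have g: "real g > 0" "g \<ge> 1" using g_pos by auto
  have qZ: "real q \<le> Z powr (1 / (10 * real g))" if "q \<in> ?U" for q
  proof -
    have "(real q ^ (10 * g)) powr (1 / (10 * real g)) \<le> Z powr (1 / (10 * real g))"
      using that by (intro powr_mono2) auto
    moreover have "(real q ^ (10 * g)) powr (1 / (10 * real g)) = real q"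
      using that g prime_gt_0_nat[of q] by (simp add: powr_powr flip: powr_realpow)
    ultimately show ?thesis by simp
  qed
  have U: "?U \<subseteq> {1..nat \<lfloor>Z powr (1 / (10 * real g))\<rfloor>}"
    using qZ prime_ge_1_nat by (auto intro!: le_nat_floor)
  then have finU: "finite ?U" by (rule finite_subset) simp
  have "card ?U \<le> nat \<lfloor>Z powr (1 / (10 * real g))\<rfloor>"
    using card_mono[OF _ U] by simp
  then have cardU: "real (card ?U) \<le> Z powr (1 / (10 * real g))"
    by (smt (verit) of_nat_mono of_nat_floor powr_ge_zero)
  have ex: "\<exists>l. sqrt Z < real (q ^ l)" if "q \<in> ?U" for q
    using real_arch_pow[of "real q" "sqrt Z"] prime_gt_1_nat[of q] that by auto
  have lq: "sqrt Z < real (q ^ l q)" if "q \<in> ?U" for q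
    unfolding l_def by (rule LeastI_ex[OF ex[OF that]])
  have lq_le: "l q \<le> i" if "sqrt Z < real (q ^ i)" for q i
    unfolding l_def using that by (rule Least_le)
  have s1: "sqrt Z \<ge> 1" using Z by simp
  have lpos: "l q \<noteq> 0" if "q \<in> ?U" for q
    using lq[OF that] s1 by (intro notI) simp
  have upper: "real (q ^ l q) \<le> Z" if q: "q \<in> ?U" for q
  proof -
    obtain i where i: "l q = Suc i" using lpos[OF q] by (cases "l q") auto
    have "\<not> sqrt Z < real (q ^ i)" using lq_le[of q i] i by auto
    then have "real (q ^ l q) \<le> sqrt Z * real q"
      using i mult_left_mono[of "real (q ^ i)" "sqrt Z" "real q"] by (simp add: mult.commute not_less)
    also have "real q \<le> sqrt Z"
    proof -
      have "real q ^ 2 \<le> real q ^ (10 * g)"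
        using prime_ge_1_nat[of q] q g by (intro power_increasing) auto
      then show ?thesis using q by (intro real_le_rsqrt) auto
    qed
    finally show ?thesis using Z s1 by simp
  qed
  have "{n. x < real n \<and> real n \<le> x + y \<and>
      (\<exists>q l. prime q \<and> real q ^ (10 * g) \<le> Z \<and> sqrt Z < real (q ^ l) \<and> int (q ^ l) dvd poly Q (int n))}
    \<subseteq> {n. x < real n \<and> real n \<le> x + y \<and> (\<exists>d\<in>?D. int d dvd poly Q (int n))}" (is "?L \<subseteq> ?R")
  proof
    fix n assume "n \<in> ?L"
    then obtain q i where n: "x < real n" "real n \<le> x + y" "q \<in> ?U" "sqrt Z < real (q ^ i)" "int (q ^ i) dvd poly Q (int n)"
      by blast
    have "int (q ^ l q) dvd int (q ^ i)"
      using lq_le[OF n(4)] by (simp add: le_imp_power_dvd)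
    then have "int (q ^ l q) dvd poly Q (int n)" using n(5) by (rule dvd_trans)
    then show "n \<in> ?R" using n by blast
  qed
  then have "real (card ?L) \<le> real (card ?R)"
    by (intro of_nat_mono card_mono) auto
  also have "\<dots> \<le> real (card ?D) * (2 * y * (real g * Z powr (- (1 / (2 * real g)))))"
  proof (rule card_dvd_family_le)
    fix d assume "d \<in> ?D"
    then obtain q where q: "q \<in> ?U" "d = q ^ l q" by blast
    show "0 < d" using q by (simp add: prime_gt_0_nat)
    show "real d \<le> y" using upper[OF q(1)] q Z by simp
    have "density (\<lambda>n. int d dvd poly Q (int n)) \<le> real g * real d powr (- (1 / real g))"
      unfolding q(2) by (rule density_prime_power_le) (use q in auto)
    also have "\<dots> \<le> real g * (sqrt Z) powr (- (1 / real g))"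
      using lq[OF q(1)] q s1 g by (intro mult_left_mono powr_mono2') auto
    also have "(sqrt Z) powr (- (1 / real g)) = Z powr (- (1 / (2 * real g)))"
      using Z by (simp add: powr_half_sqrt[symmetric] powr_powr)
    finally show "density (\<lambda>n. int d dvd poly Q (int n)) \<le> real g * Z powr (- (1 / (2 * real g)))" .
  qed (use finU x Z in auto)
  also have "\<dots> \<le> Z powr (1 / (10 * real g)) * (2 * y * (real g * Z powr (- (1 / (2 * real g)))))"
  proof (rule mult_right_mono)
    have "real (card ?D) \<le> real (card ?U)" using finU by (intro of_nat_mono card_image_le)
    then show "real (card ?D) \<le> Z powr (1 / (10 * real g))" using cardU by linarith
  qed (use Z in auto)
  finally show ?thesis .
qed

text \<open>At most \<open>W\<close> primes with exponents up to \<open>log 2 Z\<close> leave only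
  polylogarithmically many candidates for the prime part once \<open>W\<close> is fixed. Each
  candidate exceeds \<open>sqrt Z\<close> and therefore divides \<open>Q n\<close> with density at
  most a constant times \<open>Z powr (- 1 / (2 * g))\<close>.\<close>

lemma smooth_exceptions:
  fixes x y Z W :: real
  assumes x: "0 \<le> x" and Z: "Z \<ge> 1" "Z \<le> y" and W: "W \<ge> 1"
  shows "real (card {n. x < real n \<and> real n \<le> x + y \<and> poly Q (int n) \<noteq> 0 \<and>
      (\<exists>P\<subseteq>primes_le W. sqrt Z < real (prime_part P (nat \<bar>poly Q (int n)\<bar>)) \<and> real (prime_part P (nat \<bar>poly Q (int n)\<bar>)) \<le> Z)})
    \<le> (log 2 Z + 1) ^ nat \<lfloor>W\<rfloor> * (2 * y * (real g ^ nat \<lfloor>W\<rfloor> * Z powr (- (1 / (2 * real g)))))"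
proof -
  let ?P = "primes_le W"
  define L where "L = nat \<lfloor>log 2 Z\<rfloor>"
  define d where "d a = (\<Prod>p\<in>?P. p ^ a p)" for a :: "nat \<Rightarrow> nat"
  let ?I = "{a \<in> PiE ?P (\<lambda>_. {..L}). sqrt Z < real (d a) \<and> real (d a) \<le> Z}"
  let ?D = "d ` ?I"
  have g: "real g \<ge> 1" using g_pos by auto
  have logZ: "log 2 Z \<ge> 0" using Z by simp
  have s1: "sqrt Z \<ge> 1" using Z by simp
  have finP: "finite (PiE ?P (\<lambda>_. {..L}))" by (intro finite_PiE) auto
  then have finI: "finite ?I" by simp
  have cardP: "card ?P \<le> nat \<lfloor>W\<rfloor>"
  proof -
    have "?P \<subseteq> {1..nat \<lfloor>W\<rfloor>}" by (auto simp: primes_le_def le_nat_floor dest: prime_ge_1_nat)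
    then show ?thesis using card_mono[of "{1..nat \<lfloor>W\<rfloor>}" ?P] by simp
  qed
  have "card ?I \<le> card (PiE ?P (\<lambda>_. {..L}))" by (intro card_mono finP) auto
  also have "\<dots> = (L + 1) ^ card ?P" by (simp add: card_PiE)
  finally have "real (card ?D) \<le> real (L + 1) ^ card ?P"
    using card_image_le[OF finI, of d] by (metis (no_types, lifting) of_nat_le_iff of_nat_power order_trans)
  also have "\<dots> \<le> (log 2 Z + 1) ^ card ?P"
    using logZ by (intro power_mono) (auto simp: L_def)
  also have "\<dots> \<le> (log 2 Z + 1) ^ nat \<lfloor>W\<rfloor>"
    using logZ cardP by (intro power_increasing) auto
  finally have cardD: "real (card ?D) \<le> (log 2 Z + 1) ^ nat \<lfloor>W\<rfloor>" .
  have "{n. x < real n \<and> real n \<le> x + y \<and> poly Q (int n) \<noteq> 0 \<and>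
      (\<exists>P\<subseteq>primes_le W. sqrt Z < real (prime_part P (nat \<bar>poly Q (int n)\<bar>)) \<and> real (prime_part P (nat \<bar>poly Q (int n)\<bar>)) \<le> Z)}
    \<subseteq> {n. x < real n \<and> real n \<le> x + y \<and> (\<exists>d\<in>?D. int d dvd poly Q (int n))}" (is "?L \<subseteq> ?R")
  proof
    fix n assume "n \<in> ?L"
    then obtain P where n: "x < real n" "real n \<le> x + y" "poly Q (int n) \<noteq> 0" and P: "P \<subseteq> primes_le W"
      and s: "sqrt Z < real (prime_part P (nat \<bar>poly Q (int n)\<bar>))" "real (prime_part P (nat \<bar>poly Q (int n)\<bar>)) \<le> Z"
      by blast
    let ?N = "nat \<bar>poly Q (int n)\<bar>"
    define a where "a = (\<lambda>p\<in>?P. if p \<in> P then multiplicity p ?N else 0)"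
    have finP': "finite P" using P finite_primes_le finite_subset by blast
    have pr: "prime p" if "p \<in> P" for p using that P by (auto simp: primes_le_def)
    have da: "d a = prime_part P ?N"
    proof -
      have "d a = (\<Prod>p\<in>?P. if p \<in> P then p ^ multiplicity p ?N else 1)"
        unfolding d_def a_def by (intro prod.cong) auto
      also have "\<dots> = prime_part P ?N"
        unfolding prime_part_def using P by (simp add: prod.If_cases Int_absorb1)
      finally show ?thesis .
    qed
    have "multiplicity p ?N \<le> L" if p: "p \<in> P" for p
    proof -
      have "p ^ multiplicity p ?N dvd prime_part P ?N"
        unfolding prime_part_def by (rule dvd_prodI[OF finP' p])
      then have "p ^ multiplicity p ?N \<le> prime_part P ?N"
        by (intro dvd_imp_le prime_part_pos pr)
      moreover have "2 ^ multiplicity p ?N \<le> p ^ multiplicity p ?N"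
        using prime_ge_2_nat[OF pr[OF p]] by (intro power_mono) auto
      ultimately have "real (2 ^ multiplicity p ?N) \<le> Z" using s(2) by linarith
      then have "2 powr real (multiplicity p ?N) \<le> Z" by (simp add: powr_realpow)
      then have "real (multiplicity p ?N) \<le> log 2 Z"
        using Z by (simp add: le_log_iff)
      then show ?thesis unfolding L_def by (rule le_nat_floor)
    qed
    then have "a \<in> ?I" using s by (auto simp: da) (auto simp: a_def)
    moreover have "int (d a) dvd poly Q (int n)"
    proof -
      have "prime_part P ?N dvd ?N" by (rule prime_part_dvd[OF finP' pr])
      then show ?thesis by (simp add: da int_dvd_int_iff[symmetric])
    qed
    ultimately show "n \<in> ?R" using n by blast
  qed
  then have "real (card ?L) \<le> real (card ?R)"
    by (intro of_nat_mono card_mono) auto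
  also have "\<dots> \<le> real (card ?D) * (2 * y * (real g ^ nat \<lfloor>W\<rfloor> * Z powr (- (1 / (2 * real g)))))"
  proof (rule card_dvd_family_le)
    fix e assume "e \<in> ?D"
    then obtain a where a: "a \<in> ?I" "e = d a" by blast
    show "0 < e" unfolding a(2) d_def by (intro prod_pos) (auto simp: primes_le_def prime_gt_0_nat)
    show "real e \<le> y" using a Z by auto
    have pr: "prime p" if "p \<in> ?P" for p using that by (auto simp: primes_le_def)
    have dvd: "int (d a) dvd v \<longleftrightarrow> (\<forall>p\<in>?P. int (p ^ a p) dvd v)" for v
    proof
      assume "int (d a) dvd v"
      moreover have "int (p ^ a p) dvd int (d a)" if "p \<in> ?P" for p
        unfolding d_def int_dvd_int_iff by (rule dvd_prodI[OF finite_primes_le that])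
      ultimately show "\<forall>p\<in>?P. int (p ^ a p) dvd v" by (meson dvd_trans)
    next
      assume *: "\<forall>p\<in>?P. int (p ^ a p) dvd v"
      have "d a dvd nat \<bar>v\<bar>"
        unfolding d_def using * pr
        by (intro prod_coprime_dvd) (auto intro: primes_coprime simp: nat_abs_dvd_iff dvd_nat_abs_iff simp del: of_nat_power)
      then show "int (d a) dvd v" by (simp add: dvd_nat_abs_iff)
    qed
    have "density (\<lambda>n. int e dvd poly Q (int n)) = density (\<lambda>n. \<forall>p\<in>?P. int (p ^ a p) dvd poly Q (int n))"
      by (simp only: a(2) dvd)
    also have "\<dots> = (\<Prod>p\<in>?P. density (\<lambda>n. int (p ^ a p) dvd poly Q (int n)))"
      using pr periodic_dvd_poly
      by (intro density_Ball_prod[where m = "\<lambda>p. p ^ a p"]) (auto simp: prime_gt_0_nat primes_coprime simp del: of_nat_power)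
    also have "\<dots> \<le> (\<Prod>p\<in>?P. real g * real (p ^ a p) powr (- (1 / real g)))"
      by (intro prod_mono conjI density_prime_power_le pr density_nonneg)
    also have "\<dots> = real g ^ card ?P * real (d a) powr (- (1 / real g))"
      by (simp add: prod.distrib d_def of_nat_prod prod_powr_distrib)
    also have "\<dots> \<le> real g ^ nat \<lfloor>W\<rfloor> * (sqrt Z) powr (- (1 / real g))"
      using a s1 g cardP by (intro mult_mono power_increasing powr_mono2') auto
    also have "(sqrt Z) powr (- (1 / real g)) = Z powr (- (1 / (2 * real g)))"
      using Z by (simp add: powr_half_sqrt[symmetric] powr_powr)
    finally show "density (\<lambda>n. int e dvd poly Q (int n)) \<le> real g ^ nat \<lfloor>W\<rfloor> * Z powr (- (1 / (2 * real g)))" .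
  qed (use finI x Z in auto)
  also have "\<dots> \<le> (log 2 Z + 1) ^ nat \<lfloor>W\<rfloor> * (2 * y * (real g ^ nat \<lfloor>W\<rfloor> * Z powr (- (1 / (2 * real g)))))"
    using cardD Z by (intro mult_right_mono) auto
  finally show ?thesis .
qed

end

section \<open>Decomposition by smooth parts\<close>

context weighted_system
begin

lemma w_factor_bounds: "prime p \<Longrightarrow> 0 \<le> 1 - w p" "prime p \<Longrightarrow> 1 - w p \<le> 1"
  using w_bounds[of p] by auto

lemma V_nonneg: "0 \<le> V z"
  unfolding V_def by (intro prod_nonneg w_factor_bounds(1)) (rule prime_of_primes_le)

lemma prod_w_ge:
  assumes "finite P" "\<And>p. p \<in> P \<Longrightarrow> prime p" "(\<Sum>p\<in>P. 1 / real p) \<le> s"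
  shows "(1 / (2 * real g)) ^ (2 * g) * exp (- 2 * real g * s) \<le> (\<Prod>p\<in>P. 1 - w p)"
proof -
  have "(1 / (2 * real g)) ^ (2 * g) * exp (- 2 * real g * s)
      \<le> (1 / (2 * real g)) ^ (2 * g) * exp (- 2 * real g * (\<Sum>p\<in>P. 1 / real p))"
    using assms(3) by (intro mult_left_mono) (auto simp: mult_left_mono)
  also have "\<dots> \<le> (\<Prod>p\<in>P. 1 - w p)"
    unfolding w_def by (intro prod_one_minus_ge assms(1,2) g_pos prime_ge_2_nat rho_le_g rho_le_pred of_nat_0_le_iff)
  finally show ?thesis .
qed

text \<open>Crude, with an exponent far from the truth, but enough to compare the remainder of the
  sieve with its main term, where \<open>y >= Z ^ 10\<close> leaves ample room.\<close>

lemma V_lower: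
  assumes "z \<ge> 1"
  shows "(1 / (2 * real g)) ^ (2 * g) * z powr (- 16 * real g) \<le> V z"
proof -
  have "(\<Sum>p\<in>primes_le z. 1 / real p) \<le> (\<Sum>p\<in>primes_le z. 2 * (ln (real p) / real p))"
  proof (intro sum_mono)
    fix p assume "p \<in> primes_le z"
    then have p2: "real p \<ge> 2" using prime_ge_2_nat by (auto simp: primes_le_def)
    have "1 / 2 \<le> ln (2 :: real)" using ln_le_minus_one[of "1 / 2 :: real"] by (simp add: ln_div)
    also have "\<dots> \<le> ln (real p)" using p2 by simp
    finally show "1 / real p \<le> 2 * (ln (real p) / real p)" using p2 by (simp add: field_simps)
  qed
  also have "\<dots> \<le> 2 * (4 * ln z)"
    unfolding sum_distrib_left[symmetric] by (intro mult_left_mono sum_ln_prime_le assms) auto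
  finally have "(1 / (2 * real g)) ^ (2 * g) * exp (- 2 * real g * (8 * ln z)) \<le> V z"
    unfolding V_def by (intro prod_w_ge) (auto dest: prime_of_primes_le)
  moreover have "exp (- 2 * real g * (8 * ln z)) = z powr (- 16 * real g)"
    using assms by (simp add: powr_def)
  ultimately show ?thesis by simp
qed

text \<open>Lets the sieve run up to a \<open>z\<close> that shrinks with \<open>r\<close> and still
  be compared with \<open>V x\<close>; the loss is exponential in \<open>ln x / ln z\<close>, that
  is, in \<open>r + 1\<close>.\<close>

lemma V_ratio:
  assumes "1 < z" "z \<le> x"
  shows "V z \<le> (2 * real g) ^ (2 * g) * exp (8 * real g * (ln x / ln z)) * V x"
proof -
  let ?R = "{p. p \<in> primes_le x \<and> z < real p}"
  have finR: "finite ?R" by simp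
  have "V x = (\<Prod>p\<in>primes_le z \<union> ?R. 1 - w p)"
    unfolding V_def using assms by (intro prod.cong) (auto simp: primes_le_def)
  also have "\<dots> = V z * (\<Prod>p\<in>?R. 1 - w p)"
  proof -
    have disj: "primes_le z \<inter> ?R = {}" by (auto simp: primes_le_def)
    show ?thesis
      unfolding V_def by (rule prod.union_disjoint[OF finite_primes_le finR disj])
  qed
  finally have Vx: "V x = V z * (\<Prod>p\<in>?R. 1 - w p)" .
  have "(1 / (2 * real g)) ^ (2 * g) * exp (- 2 * real g * (4 * ln x / ln z)) \<le> (\<Prod>p\<in>?R. 1 - w p)"
    using assms by (intro prod_w_ge sum_inverse_prime_le) (auto dest: prime_of_primes_le)
  from mult_left_mono[OF this V_nonneg[of z]]
  have "V z * ((1 / (2 * real g)) ^ (2 * g) * exp (- 2 * real g * (4 * ln x / ln z))) \<le> V x"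
    by (simp only: Vx)
  then have le: "(2 * real g) ^ (2 * g) * exp (8 * real g * (ln x / ln z)) * (V z * ((1 / (2 * real g)) ^ (2 * g) * exp (- 2 * real g * (4 * ln x / ln z))))
      \<le> (2 * real g) ^ (2 * g) * exp (8 * real g * (ln x / ln z)) * V x"
    by (intro mult_left_mono) auto
  have eq: "(2 * real g) ^ (2 * g) * exp (8 * real g * (ln x / ln z)) * (V z * ((1 / (2 * real g)) ^ (2 * g) * exp (- 2 * real g * (4 * ln x / ln z)))) = V z"
  proof -
    have a: "(2 * real g) ^ (2 * g) * (1 / (2 * real g)) ^ (2 * g) = 1"
      unfolding power_mult_distrib[symmetric] using g_pos by simp
    have b: "exp (8 * real g * (ln x / ln z)) * exp (- 2 * real g * (4 * ln x / ln z)) = 1"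
      by (simp flip: exp_add)
    have "(2 * real g) ^ (2 * g) * exp (8 * real g * (ln x / ln z)) * (V z * ((1 / (2 * real g)) ^ (2 * g) * exp (- 2 * real g * (4 * ln x / ln z))))
      = V z * ((2 * real g) ^ (2 * g) * (1 / (2 * real g)) ^ (2 * g)) * (exp (8 * real g * (ln x / ln z)) * exp (- 2 * real g * (4 * ln x / ln z)))"
      by (simp only: mult_ac)
    then show ?thesis unfolding a b by simp
  qed
  show ?thesis using le unfolding eq .
qed

text \<open>The primes up to \<open>t\<close> contribute at most \<open>t\<close> to the sum of
  \<open>1 / p\<close>. What remains bounds \<open>V x\<close> below by a constant times
  \<open>x powr (- 8 * g / ln t)\<close>, whose exponent is as small as desired. The fixed exponent
  of \<open>V_lower\<close> would exceed the saving from the exceptional integers.\<close>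

lemma V_lower_small_power:
  assumes "t > 1" "x \<ge> 1"
  shows "(1 / (2 * real g)) ^ (2 * g) * exp (- 2 * real g * (t + 4 * ln x / ln t)) \<le> V x"
proof -
  have "(\<Sum>p\<in>primes_le x. 1 / real p) = (\<Sum>p | p \<in> primes_le x \<and> t < real p. 1 / real p) + (\<Sum>p | p \<in> primes_le x \<and> \<not> t < real p. 1 / real p)"
    by (subst sum.union_disjoint[symmetric]) (auto intro!: sum.cong)
  also have "(\<Sum>p | p \<in> primes_le x \<and> t < real p. 1 / real p) \<le> 4 * ln x / ln t"
    by (rule sum_inverse_prime_le[OF assms])
  also have "(\<Sum>p | p \<in> primes_le x \<and> \<not> t < real p. 1 / real p) \<le> t"
  proof -
    have sub: "{p. p \<in> primes_le x \<and> \<not> t < real p} \<subseteq> {1..nat \<lfloor>t\<rfloor>}"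
      by (auto simp: primes_le_def not_less le_nat_floor dest: prime_ge_1_nat)
    have "(\<Sum>p | p \<in> primes_le x \<and> \<not> t < real p. 1 / real p) \<le> (\<Sum>p | p \<in> primes_le x \<and> \<not> t < real p. 1)"
      by (intro sum_mono) (auto simp: primes_le_def divide_le_eq dest: prime_ge_1_nat)
    also have "\<dots> \<le> real (card {1..nat \<lfloor>t\<rfloor>})"
      using card_mono[OF _ sub] by simp
    also have "\<dots> \<le> t" using assms by simp
    finally show ?thesis .
  qed
  finally have "(\<Sum>p\<in>primes_le x. 1 / real p) \<le> t + 4 * ln x / ln t" by simp
  then show ?thesis
    unfolding V_def by (intro prod_w_ge) (auto dest: prime_of_primes_le)
qed

section \<open>Cutting an integer where its smooth part first exceeds \<open>Z\<close>\<close>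

definition primes_below :: "nat \<Rightarrow> nat set" where
  "primes_below q = {p. prime p \<and> p < q}"

lemma finite_primes_below [simp]: "finite (primes_below q)"
  by (rule finite_subset[of _ "{..<q}"]) (auto simp: primes_below_def)

text \<open>\<open>q\<close> is the first integer that exceeds \<open>Z\<close> or at which the part
  composed of primes up to it exceeds \<open>Z\<close>. If all primes up to \<open>Z\<close>
  together contribute at most \<open>Z\<close>, the cut is the first integer above \<open>Z\<close>,
  which need not be prime; this is the first alternative.\<close>

lemma cut_exists:
  fixes N :: nat and Z :: real
  assumes "2 \<le> Z"
  shows "\<exists>q. 2 \<le> q \<and> real q \<le> Z + 1 \<and> real (prime_part (primes_below q) N) \<le> Z
    \<and> (Z < real q \<or> prime q \<and> Z < real (prime_part (primes_below q) N) * real (q ^ multiplicity q N))"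
proof -
  let ?s = "\<lambda>t. prime_part (primes_below t) N"
  define q where "q = (LEAST t. Z < real t \<or> Z < real (?s (Suc t)))"
  have "\<exists>t. Z < real t \<or> Z < real (?s (Suc t))" using reals_Archimedean2[of Z] by blast
  then have q: "Z < real q \<or> Z < real (?s (Suc q))" unfolding q_def by (rule LeastI_ex)
  have less: "\<not> Z < real t \<and> \<not> Z < real (?s (Suc t))" if "t < q" for t
    using not_less_Least[of t "\<lambda>t. Z < real t \<or> Z < real (?s (Suc t))"] that by (auto simp: q_def)
  have step: "?s (Suc t) = (if prime t then ?s t * t ^ multiplicity t N else ?s t)" for t
  proof (cases "prime t")
    case True
    then have "primes_below (Suc t) = insert t (primes_below t)" by (auto simp: primes_below_def less_Suc_eq)
    moreover have "t \<notin> primes_below t" by (simp add: primes_below_def)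
    ultimately show ?thesis using True by (simp add: prime_part_def)
  next
    case False
    then have "primes_below (Suc t) = primes_below t" by (auto simp: primes_below_def less_Suc_eq)
    then show ?thesis using False by simp
  qed
  have sq: "real (?s q) \<le> Z"
  proof (cases q)
    case 0
    then show ?thesis using assms by (simp add: primes_below_def prime_part_def)
  next
    case (Suc t)
    then show ?thesis using less[of t] by simp
  qed
  have cond: "Z < real q \<or> prime q \<and> Z < real (?s q) * real (q ^ multiplicity q N)"
    using q sq by (auto simp: step split: if_splits)
  moreover have "2 \<le> q"
    using cond assms prime_ge_2_nat by (cases "Z < real q") auto
  moreover have "real q \<le> Z + 1"
  proof (cases q)
    case (Suc t)
    then show ?thesis using less[of t] by auto
  qed (use assms in simp)
  ultimately show ?thesis using sq by blast
qed

text \<open>The parameters: \<open>C1\<close> bounds \<open>ln \<bar>Q n\<bar> / ln Z\<close>, \<open>U\<close> is the growth per unit of \<open>r\<close> of the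
  trivial bound for the class \<open>r\<close>, and \<open>K\<close> is chosen such that Rankin's saving beats it.\<close>

lemma class_bound:
  fixes x y Z C1 \<alpha> U :: real and r :: nat
  assumes \<alpha>: "0 < \<alpha>" and x: "1 \<le> x" and Z: "2 \<le> Z" "Z \<le> x" "ln x = 10 / \<alpha> * ln Z" and y: "Z ^ 10 \<le> y"
    and big: "(2 * real g) ^ (2 * g) \<le> Z" and C1: "0 \<le> C1"
    and U: "U = A powr C1 * exp (8 * real g * (10 / \<alpha> * (16 * real g)))" and K: "K = 2 * ln (2 * U)"
    and eps: "\<epsilon> \<le> 1 / (4 * real g)"
    and S: "S \<subseteq> {n. x < real n \<and> real n \<le> x + y}"
    and nz: "\<And>n. n \<in> S \<Longrightarrow> poly Q (int n) \<noteq> 0"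
    and N: "\<And>n. n \<in> S \<Longrightarrow> real (nat \<bar>poly Q (int n)\<bar>) \<le> Z powr C1"
    and q: "\<And>n. n \<in> S \<Longrightarrow> 2 \<le> q n" "\<And>n. n \<in> S \<Longrightarrow> real (q n) \<le> Z + 1"
      "\<And>n. n \<in> S \<Longrightarrow> real (prime_part (primes_below (q n)) (nat \<bar>poly Q (int n)\<bar>)) \<le> Z"
    and r: "\<And>n. n \<in> S \<Longrightarrow> real (q n ^ r) \<le> Z" "\<And>n. n \<in> S \<Longrightarrow> Z < real (q n ^ Suc r)"
    and case_r: "\<And>n. n \<in> S \<Longrightarrow> 10 * g \<le> r \<Longrightarrow>
        sqrt Z < real (prime_part (primes_below (q n)) (nat \<bar>poly Q (int n)\<bar>)) \<and> exp (4 * real g * K) < real (q n)"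
  shows "(\<Sum>n\<in>S. F (vals n)) \<le> (1/2) ^ r * ((2 * U) ^ (10 * g) * (2 * real g) ^ (2 * g) * (2 * sieve_const g)
    * exp (excess_const K * (4 * K + 1)) * (Delta_factor Qs F D * y * V x * target_sum x))"
\<comment> \<open>In the nonempty case an element of \<open>S\<close> provides the relation between
  \<open>Z\<close>, \<open>r\<close> and \<open>K\<close> that keeps \<beta> small.\<close>
proof (cases "S = {}")
  case True
  have "1 \<le> A powr C1" using A_ge C1 by (intro ge_one_powr_ge_zero)
  then have "0 \<le> U" by (simp add: U)
  moreover have "0 \<le> y" using y Z by (auto intro: order_trans[OF _ y])
  ultimately show ?thesis
    using True sieve_const_ge_1[of g] Delta_factor_ge_1 V_nonneg[of x] target_sum_ge_1[OF x]
    by (auto intro!: mult_nonneg_nonneg)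
next
  case False
  let ?N = "\<lambda>n. nat \<bar>poly Q (int n)\<bar>"
  have g: "real g \<ge> 1" "real g > 0" using g_pos by auto
  have lnZ: "ln Z > 0" using Z by simp
  have y0: "0 \<le> y" using y Z by (auto intro: order_trans[OF _ y])
  have AC: "1 \<le> A powr C1" using A_ge C1 by (intro ge_one_powr_ge_zero)
  have U1: "1 \<le> U"
  proof -
    have "1 * 1 \<le> A powr C1 * exp (8 * real g * (10 / \<alpha> * (16 * real g)))"
      using AC \<alpha> by (intro mult_mono) auto
    then show ?thesis by (simp add: U)
  qed
  have K0: "0 < K" using U1 by (simp add: K)
  define big_r where "big_r = (10 * g \<le> r)"
  \<comment> \<open>For large \<open>r\<close> the primes below \<open>q n\<close> are at most
    \<open>Z powr (1 / r)\<close>, and \<beta> is chosen such that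
    \<open>\<beta> * ln W = K\<close>. With \<open>T = sqrt Z\<close> Rankin's factor becomes
    \<open>exp (- K * r / 2)\<close>, which is \<open>(2 * U) ^ r\<close> inverted. For small
    \<open>r\<close> the choices \<open>\<beta> = 0\<close> and \<open>T = 1\<close> make it
    trivial.\<close>
  define W where "W = (if big_r then Z powr (1 / real r) else Z)"
  define \<beta> where "\<beta> = (if big_r then K * real r / ln Z else 0)"
  define T where "T = (if big_r then sqrt Z else 1)"
  \<comment> \<open>\<open>Z < q n ^ Suc r\<close> puts \<open>z\<close> below \<open>q n\<close>,
    so the prescribed valuations determine all primes up to \<open>z\<close>. The further root of
    order \<open>16 * g\<close> makes \<open>z powr (- 16 * g)\<close> in \<open>V_lower\<close> at
    least \<open>1 / Z\<close>.\<close>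
  define z where "z = Z powr (1 / (16 * real g * real (Suc r)))"
  define P where "P = primes_le W"
  define L where "L = nat \<lfloor>log 2 Z\<rfloor>"
  define en where "en n = (\<lambda>p\<in>P. if p < q n then valuation n p else zero_vec)" for n
  have r0: "real r > 0" if big_r using that g_pos by (auto simp: big_r_def)
  have W1: "1 \<le> W" using Z by (auto simp: W_def intro: ge_one_powr_ge_zero)
  have finP: "finite P" by (simp add: P_def)
  have prP: "prime p" if "p \<in> P" for p using that by (auto simp: P_def primes_le_def)
  have belowP: "primes_below (q n) \<subseteq> P" if n: "n \<in> S" for n
  proof
    fix p assume p: "p \<in> primes_below (q n)"
    have "real p \<le> W"
    proof (cases big_r)
      case True
      have "real (q n) = (real (q n ^ r)) powr (1 / real r)"
        using r0[OF True] q(1)[OF n] by (simp add: powr_powr flip: powr_realpow)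
      also have "\<dots> \<le> Z powr (1 / real r)" using r(1)[OF n] by (intro powr_mono2) auto
      finally show ?thesis using p True by (simp add: W_def primes_below_def)
    next
      case False
      have "real p + 1 \<le> real (q n)" using p by (simp add: primes_below_def)
      then show ?thesis using q(2)[OF n] False by (simp add: W_def)
    qed
    then show "p \<in> P" using p by (simp add: P_def primes_le_def primes_below_def)
  qed
  have zq: "z < real (q n)" if n: "n \<in> S" for n
  proof -
    have "z \<le> Z powr (1 / real (Suc r))"
      unfolding z_def using Z g by (intro powr_mono divide_left_mono) (auto simp: mult_le_cancel_right1)
    also have "\<dots> < (real (q n ^ Suc r)) powr (1 / real (Suc r))"
      using r(2)[OF n] Z by (intro powr_less_mono2) auto
    also have "\<dots> = real (q n)"
      using q(1)[OF n] by (simp add: powr_powr del: of_nat_Suc power_Suc flip: powr_realpow)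
    finally show ?thesis .
  qed
  have val: "(\<Prod>p\<in>P. real p ^ sum_list (en n p)) = real (prime_part (primes_below (q n)) (?N n))" if n: "n \<in> S" for n
  proof -
    have "(\<Prod>p\<in>P. real p ^ sum_list (en n p)) = (\<Prod>p\<in>P. if p \<in> primes_below (q n) then real p ^ multiplicity p (?N n) else 1)"
      using prP nz[OF n] by (intro prod.cong) (auto simp: en_def primes_below_def sum_list_valuation)
    also have "\<dots> = (\<Prod>p\<in>primes_below (q n). real p ^ multiplicity p (?N n))"
      using finP belowP[OF n] by (simp add: prod.If_cases Int_absorb1)
    finally show ?thesis by (simp add: prime_part_def of_nat_prod)
  qed
  have en_in: "en n \<in> bounded_choices sum_list (exponents L) P Z" if n: "n \<in> S" for n
  proof -
    have "en n p \<in> exponents L" if p: "p \<in> P" for p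
    proof (cases "p < q n")
      case True
      have pb: "p \<in> primes_below (q n)" using prP[OF p] True by (simp add: primes_below_def)
      have "p ^ multiplicity p (?N n) dvd prime_part (primes_below (q n)) (?N n)"
        unfolding prime_part_def by (rule dvd_prodI[OF finite_primes_below pb])
      then have "p ^ multiplicity p (?N n) \<le> prime_part (primes_below (q n)) (?N n)"
        by (intro dvd_imp_le prime_part_pos) (auto simp: primes_below_def)
      moreover have "2 ^ multiplicity p (?N n) \<le> p ^ multiplicity p (?N n)"
        using prime_ge_2_nat[OF prP[OF p]] by (intro power_mono) auto
      ultimately have "real (2 ^ multiplicity p (?N n)) \<le> Z" using q(3)[OF n] by linarith
      then have "2 powr real (multiplicity p (?N n)) \<le> Z" by (simp add: powr_realpow)
      then have "real (multiplicity p (?N n)) \<le> log 2 Z" using Z by (simp add: le_log_iff)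
      then have "sum_list (valuation n p) \<le> L"
        unfolding L_def sum_list_valuation[OF prP[OF p] nz[OF n]] by (rule le_nat_floor)
      moreover have "a \<le> sum_list (valuation n p)" if "a \<in> set (valuation n p)" for a
        by (rule member_le_sum_list) (use that in auto)
      ultimately have "set (valuation n p) \<subseteq> {..L}" by (auto intro: order_trans)
      then show ?thesis using True p by (simp add: en_def exponents_def)
    qed (use p in \<open>simp add: en_def\<close>)
    moreover have "en n \<in> extensional P" by (simp add: en_def)
    ultimately show ?thesis
      using val[OF n] q(3)[OF n] by (simp add: bounded_choices_def PiE_iff)
  qed
  have cp: "coupled z P (en n) n" if n: "n \<in> S" for n
    unfolding coupled_def
  proof (intro conjI ballI)
    fix p assume "p \<in> support P (en n)"
    then have "p \<in> P" "en n p \<noteq> zero_vec" by (auto simp: support_def)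
    then have "en n p = valuation n p" by (auto simp: en_def split: if_splits)
    then show "event p (en n p) n" using event_valuation[OF prP[OF \<open>p \<in> P\<close>] nz[OF n]] by simp
  next
    fix p assume p: "p \<in> primes_le z - support P (en n)"
    then have pr: "prime p" by (simp add: primes_le_def)
    have "real p < real (q n)" using p zq[OF n] by (auto simp: primes_le_def)
    then have pq: "p < q n" by simp
    then have pP: "p \<in> P" using belowP[OF n] pr by (auto simp: primes_below_def)
    then have "valuation n p = zero_vec" using p pq by (auto simp: support_def en_def)
    then show "\<not> int p dvd poly Q (int n)"
      using event_valuation[OF pr nz[OF n]] event_zero_vec[OF pr] by simp
  qed
  define a where "a = A powr (C1 * real (Suc r))"
  have Fn: "F (vals n) \<le> a * (\<Prod>p\<in>P. f p (en n p))" if n: "n \<in> S" for n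
  proof -
    let ?Pq = "primes_below (q n)"
    have prq: "prime p" if "p \<in> ?Pq" for p using that by (simp add: primes_below_def)
    have "q n \<le> p" if "prime p" "p \<notin> ?Pq" for p using that by (auto simp: primes_below_def)
    then obtain m where m: "q n ^ m \<le> ?N n" "F (vals n) \<le> A ^ m * (\<Prod>p\<in>?Pq. f p (valuation n p))"
      using F_split[OF nz[OF n] finite_primes_below prq] by blast
    have q1: "real (q n) > 1" using q(1)[OF n] by simp
    have "real m * ln (real (q n)) = ln (real (q n ^ m))"
      using q1 by (simp add: ln_realpow)
    also have "\<dots> \<le> ln (Z powr C1)"
    proof -
      have "real (q n ^ m) \<le> real (?N n)" using m(1) by (rule of_nat_mono)
      also have "\<dots> \<le> Z powr C1" by (rule N[OF n])
      finally show ?thesis using q1 Z by (subst ln_le_cancel_iff) auto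
    qed
    also have "\<dots> = C1 * ln Z" using Z by (simp add: ln_powr)
    also have "\<dots> \<le> C1 * (real (Suc r) * ln (real (q n)))"
    proof (rule mult_left_mono[OF _ C1])
      have "ln Z \<le> ln (real (q n ^ Suc r))"
        using r(2)[OF n] Z by (subst ln_le_cancel_iff) auto
      also have "\<dots> = real (Suc r) * ln (real (q n))"
        using q1 by (simp only: of_nat_power ln_realpow)
      finally show "ln Z \<le> real (Suc r) * ln (real (q n))" .
    qed
    finally have "real m * ln (real (q n)) \<le> (C1 * real (Suc r)) * ln (real (q n))"
      by (simp only: mult.assoc)
    then have mC: "real m \<le> C1 * real (Suc r)"
      using q1 by (subst (asm) mult_le_cancel_right_pos) auto
    have "A ^ m = A powr real m" using A_ge by (simp add: powr_realpow)
    also have "\<dots> \<le> a" unfolding a_def using mC A_ge by (intro powr_mono)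
    finally have "A ^ m \<le> a" .
    have "(\<Prod>p\<in>P. f p (en n p)) = (\<Prod>p\<in>P. if p \<in> ?Pq then f p (valuation n p) else 1)"
    proof (intro prod.cong refl)
      fix p assume p: "p \<in> P"
      have "f p zero_vec = 1" using F_one by (simp add: f_def zero_vec_def map_replicate)
      then show "f p (en n p) = (if p \<in> ?Pq then f p (valuation n p) else 1)"
        using p prP[OF p] by (auto simp: en_def primes_below_def)
    qed
    also have "\<dots> = (\<Prod>p\<in>?Pq. f p (valuation n p))"
      using finP belowP[OF n] by (simp add: prod.If_cases Int_absorb1)
    finally have prodf: "(\<Prod>p\<in>P. f p (en n p)) = (\<Prod>p\<in>?Pq. f p (valuation n p))" .
    have "0 \<le> (\<Prod>p\<in>?Pq. f p (valuation n p))"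
      using f_bounds(1)[OF prq] by (intro prod_nonneg) auto
    then have "A ^ m * (\<Prod>p\<in>?Pq. f p (valuation n p)) \<le> a * (\<Prod>p\<in>?Pq. f p (valuation n p))"
      using \<open>A ^ m \<le> a\<close> by (rule mult_right_mono[rotated])
    then show ?thesis using m(2) prodf by simp
  qed
  have a0: "0 \<le> a" by (simp add: a_def)
  have \<beta>0: "0 \<le> \<beta>" using K0 lnZ by (simp add: \<beta>_def)
  have \<beta>K: "\<beta> * ln W \<le> K"
    using K0 Z r0 lnZ by (auto simp: \<beta>_def W_def ln_powr)
  have \<beta>\<epsilon>: "\<beta> + \<epsilon> \<le> 1 / (2 * real g)"
  proof -
    \<comment> \<open>From \<open>exp (4 * g * K) < q n\<close> and \<open>q n ^ r <= Z\<close>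
      follows \<open>4 * g * K * r <= ln Z\<close>. The bounded primes are excluded in
      \<open>case_r\<close> for this purpose.\<close>
    have "\<beta> \<le> 1 / (4 * real g)"
    proof (cases big_r)
      case True
      obtain n where n: "n \<in> S" using False by blast
      have "exp (4 * real g * K) ^ r \<le> real (q n) ^ r"
        using case_r[OF n] True by (intro power_mono) (auto simp: big_r_def)
      also have "\<dots> \<le> Z" using r(1)[OF n] by simp
      finally have "ln (exp (4 * real g * K) ^ r) \<le> ln Z" by (subst ln_le_cancel_iff) (use Z in auto)
      then have "real r * (4 * real g * K) \<le> ln Z" by (simp add: ln_realpow)
      then show ?thesis using True lnZ g by (simp add: \<beta>_def field_simps)
    qed (use g in \<open>simp add: \<beta>_def\<close>)
    then have "\<beta> + \<epsilon> \<le> 1 / (4 * real g) + 1 / (4 * real g)" using eps by linarith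
    then show ?thesis by simp
  qed
  have T0: "0 < T" using Z by (simp add: T_def)
  have Tv: "T \<le> (\<Prod>p\<in>P. real p ^ sum_list (en n p))" if n: "n \<in> S" for n
  proof -
    have "prime_part (primes_below (q n)) (?N n) > 0" by (rule prime_part_pos) (simp add: primes_below_def)
    then have "1 \<le> real (prime_part (primes_below (q n)) (?N n))" by linarith
    then show ?thesis using case_r[OF n] unfolding val[OF n] by (auto simp: T_def big_r_def)
  qed
  have z1: "1 < z" unfolding z_def using Z g by (intro gr_one_powr) auto
  have zz: "z \<le> Z powr (1 / (16 * real g))"
    unfolding z_def using Z g by (intro powr_mono divide_left_mono) auto
  have zx: "z \<le> x"
  proof -
    have "z \<le> Z powr 1" using zz Z g by (intro order_trans[OF zz] powr_mono) (auto simp: field_simps)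
    then show ?thesis using Z by simp
  qed
  have size: "Z\<^sup>2 * z powr (4 * (real g + 1)) \<le> y * V z"
  proof -
    have "z powr (4 * (real g + 1)) \<le> (Z powr (1 / (16 * real g))) powr (4 * (real g + 1))"
      using zz z1 g by (intro powr_mono2) auto
    also have "\<dots> = Z powr ((4 * (real g + 1)) / (16 * real g))" by (simp add: powr_powr)
    also have "\<dots> \<le> Z powr 1" using Z g by (intro powr_mono) (auto simp: field_simps)
    finally have "Z\<^sup>2 * z powr (4 * (real g + 1)) \<le> Z\<^sup>2 * Z"
      using Z by (intro mult_left_mono) auto
    \<comment> \<open>One factor \<open>1 / Z\<close> stands for the constant of
      \<open>V_lower\<close>, the other for its power of \<open>z\<close>;
      \<open>Z ^ 10 = x powr \<alpha>\<close> is the available length.\<close>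
    also have "\<dots> \<le> Z ^ 10 * ((1 / Z) * (1 / Z))"
    proof -
      have "Z ^ 10 * ((1 / Z) * (1 / Z)) = Z ^ 8" using Z by (simp add: field_simps eval_nat_numeral)
      moreover have "Z\<^sup>2 * Z = Z ^ 3" by (simp add: eval_nat_numeral)
      moreover have "Z ^ 3 \<le> Z ^ 8" using Z by (intro power_increasing) auto
      ultimately show ?thesis by simp
    qed
    also have "\<dots> \<le> y * V z"
    proof (rule mult_mono[OF y])
      have "1 / Z \<le> 1 / (2 * real g) ^ (2 * g)"
        using big g Z by (intro divide_left_mono) auto
      then have c: "1 / Z \<le> (1 / (2 * real g)) ^ (2 * g)" by (simp add: power_one_over)
      have "1 / Z = (Z powr (1 / (16 * real g))) powr (- 16 * real g)"
        using Z g by (simp add: powr_powr powr_minus_divide)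
      also have "\<dots> \<le> z powr (- 16 * real g)"
        using zz z1 g by (intro powr_mono2') auto
      finally have "1 / Z \<le> z powr (- 16 * real g)" .
      with c have "(1 / Z) * (1 / Z) \<le> (1 / (2 * real g)) ^ (2 * g) * z powr (- 16 * real g)"
        using Z by (intro mult_mono) auto
      also have "\<dots> \<le> V z" using z1 by (intro V_lower) auto
      finally show "(1 / Z) * (1 / Z) \<le> V z" .
    qed (use y0 Z in auto)
    finally show ?thesis .
  qed
  let ?M = "2 * sieve_const g * exp (excess_const K * (4 * K + 1)) * (Delta_factor Qs F D * y * target_sum x)"
  have M0: "0 \<le> ?M"
    using sieve_const_ge_1[of g] Delta_factor_ge_1 target_sum_ge_1[OF x] y0 by (auto intro!: mult_nonneg_nonneg)
  have "(\<Sum>n\<in>S. F (vals n)) \<le> a * (2 * sieve_const g * y * V z)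
    * (T powr (- \<beta>) * (Delta_factor Qs F D * exp (excess_const K * (4 * K + 1)) * target_sum x))"
    by (rule class_sum_le[where W = W and P = P and en = en and Z = Z and L = L, OF S _ W1 \<beta>0 \<beta>K \<beta>\<epsilon> en_in cp Fn a0 T0 Tv _ Z(2) z1 size y0])
       (use x in \<open>simp_all add: P_def\<close>)
  also have "\<dots> = ?M * (a * V z * T powr (- \<beta>))"
    by (simp only: mult_ac)
  also have "\<dots> \<le> ?M * ((1/2) ^ r * (2 * U) ^ (10 * g) * (2 * real g) ^ (2 * g) * V x)"
  proof (rule mult_left_mono[OF _ M0])
    have lnz: "ln x / ln z = 10 / \<alpha> * (16 * real g) * real (Suc r)"
      using Z lnZ g by (simp add: z_def ln_powr field_simps del: of_nat_Suc)
    have "V z \<le> (2 * real g) ^ (2 * g) * exp (8 * real g * (10 / \<alpha> * (16 * real g) * real (Suc r))) * V x"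
      using V_ratio[OF z1 zx] unfolding lnz .
    then have "a * V z \<le> a * ((2 * real g) ^ (2 * g) * exp (8 * real g * (10 / \<alpha> * (16 * real g) * real (Suc r))) * V x)"
      using a0 by (rule mult_left_mono)
    also have "\<dots> = (a * exp (8 * real g * (10 / \<alpha> * (16 * real g) * real (Suc r)))) * ((2 * real g) ^ (2 * g) * V x)"
      by (simp only: mult_ac)
    also have "a * exp (8 * real g * (10 / \<alpha> * (16 * real g) * real (Suc r))) = U ^ Suc r"
    proof -
      have "a = (A powr C1) ^ Suc r"
        unfolding a_def using A_ge by (subst powr_realpow[symmetric]) (auto simp: powr_powr)
      moreover have "exp (8 * real g * (10 / \<alpha> * (16 * real g) * real (Suc r))) = exp (8 * real g * (10 / \<alpha> * (16 * real g))) ^ Suc r"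
        unfolding exp_of_nat_mult[symmetric] by (simp only: mult_ac)
      ultimately show ?thesis unfolding U by (simp only: power_mult_distrib)
    qed
    finally have "a * V z \<le> U ^ Suc r * ((2 * real g) ^ (2 * g) * V x)" .
    then have "a * V z * T powr (- \<beta>) \<le> U ^ Suc r * ((2 * real g) ^ (2 * g) * V x) * T powr (- \<beta>)"
      by (rule mult_right_mono) simp
    also have "\<dots> = (U ^ Suc r * T powr (- \<beta>)) * ((2 * real g) ^ (2 * g) * V x)"
      by (simp only: mult_ac)
    also have "\<dots> \<le> ((1/2) ^ r * (2 * U) ^ (10 * g)) * ((2 * real g) ^ (2 * g) * V x)"
    proof (rule mult_right_mono)
      \<comment> \<open>For large \<open>r\<close> the left side is exactly
        \<open>(1/2) ^ r * U\<close>. For \<open>r < 10 * g\<close> nothing is saved, and the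
        trivial bound \<open>U ^ Suc r\<close> is absorbed by the constant.\<close>
      show "U ^ Suc r * T powr (- \<beta>) \<le> (1/2) ^ r * (2 * U) ^ (10 * g)"
      proof (cases big_r)
        case True
        have "T powr (- \<beta>) = exp (- (real r * ln (2 * U)))"
          using True Z lnZ by (simp add: T_def \<beta>_def K powr_def ln_sqrt field_simps)
        also have "\<dots> = 1 / (2 * U) ^ r"
          using U1 by (simp add: exp_minus exp_of_nat_mult divide_inverse)
        finally have "U ^ Suc r * T powr (- \<beta>) = (1/2) ^ r * U"
          using U1 by (simp add: power_mult_distrib field_simps)
        also have "U \<le> (2 * U) ^ 1" using U1 by simp
        also have "(2 * U) ^ 1 \<le> (2 * U) ^ (10 * g)"
          using U1 g_pos by (intro power_increasing) auto
        finally show ?thesis by (simp add: mult_left_mono)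
      next
        case False
        then have rg: "Suc r \<le> 10 * g" by (simp add: big_r_def)
        have "U ^ Suc r * T powr (- \<beta>) = U ^ Suc r" using False by (simp add: T_def)
        also have "\<dots> \<le> U ^ (10 * g)" using U1 rg by (intro power_increasing) auto
        also have "\<dots> = 1 * U ^ (10 * g)" by simp
        also have "\<dots> \<le> ((1/2) ^ r * 2 ^ (10 * g)) * U ^ (10 * g)"
        proof (rule mult_right_mono)
          have "(2 :: real) ^ r \<le> 2 ^ (10 * g)" using rg by (intro power_increasing) auto
          then show "(1 :: real) \<le> (1/2) ^ r * 2 ^ (10 * g)" by (simp add: power_one_over field_simps)
        qed (use U1 in auto)
        also have "\<dots> = (1/2) ^ r * (2 * U) ^ (10 * g)" by (simp only: power_mult_distrib mult.assoc)
        finally show ?thesis .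
      qed
    qed (use V_nonneg[of x] in auto)
    finally show "a * V z * T powr (- \<beta>) \<le> (1/2) ^ r * (2 * U) ^ (10 * g) * (2 * real g) ^ (2 * g) * V x"
      by (simp only: mult.assoc)
  qed
  finally show ?thesis by (simp only: mult_ac)
qed

end

section \<open>Size of polynomial values\<close>

lemma abs_poly_le_poly_norm:
  fixes P :: "int poly"
  assumes "1 \<le> n"
  shows "\<bar>poly P n\<bar> \<le> poly_norm P * n ^ degree P"
proof (cases "P = 0")
  case False
  have norm: "poly_norm P = (\<Sum>i\<le>degree P. \<bar>coeff P i\<bar>)"
  proof -
    have "sum_list (map u [0..<m]) = (\<Sum>i<m. u i)" for u :: "nat \<Rightarrow> int" and m
      by (induction m) auto
    then show ?thesis
      using False by (simp add: poly_norm_def coeffs_def o_def lessThan_Suc_atMost del: upt_Suc)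
  qed
  have "\<bar>poly P n\<bar> \<le> (\<Sum>i\<le>degree P. \<bar>coeff P i * n ^ i\<bar>)"
    unfolding poly_altdef by (rule sum_abs)
  also have "\<dots> \<le> (\<Sum>i\<le>degree P. \<bar>coeff P i\<bar> * n ^ degree P)"
    using assms by (intro sum_mono) (auto simp: abs_mult intro!: mult_left_mono power_increasing)
  also have "\<dots> = poly_norm P * n ^ degree P"
    by (simp add: norm sum_distrib_right)
  finally show ?thesis .
qed (simp add: poly_norm_def)

lemma poly_norm_ge_1: "P \<noteq> 0 \<Longrightarrow> 1 \<le> poly_norm P"
proof -
  assume "P \<noteq> 0"
  then have "lead_coeff P \<in> set (coeffs P)" by (metis coeff_in_coeffs le_refl)
  then have "\<bar>lead_coeff P\<bar> \<le> poly_norm P"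
    unfolding poly_norm_def by (intro member_le_sum_list) auto
  moreover have "1 \<le> \<bar>lead_coeff P\<bar>" using \<open>P \<noteq> 0\<close> leading_coeff_0_iff[of P] by linarith
  ultimately show ?thesis by linarith
qed

section \<open>Summation over the classes and the exceptional integers\<close>

context weighted_system
begin

lemma floor_log_exists:
  fixes Z :: real and q :: nat
  assumes "1 \<le> Z" "2 \<le> q"
  shows "\<exists>r. real (q ^ r) \<le> Z \<and> Z < real (q ^ Suc r)"
proof -
  define r where "r = (LEAST r. Z < real (q ^ Suc r))"
  obtain k where k: "Z < real q ^ k" using real_arch_pow[of "real q" Z] assms by auto
  have "real (q ^ k) \<le> real (q ^ Suc k)" using assms by (intro of_nat_mono power_increasing) auto
  then have "\<exists>r. Z < real (q ^ Suc r)" using k by (intro exI[of _ k]) auto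
  then have 1: "Z < real (q ^ Suc r)" unfolding r_def by (rule LeastI_ex)
  moreover have "real (q ^ r) \<le> Z"
  proof (cases r)
    case (Suc t)
    then have "\<not> Z < real (q ^ Suc t)"
      using not_less_Least[of t "\<lambda>r. Z < real (q ^ Suc r)"] by (simp add: r_def)
    then show ?thesis using Suc by simp
  qed (use assms in simp)
  ultimately show ?thesis by blast
qed

lemma sum_over_interval_le:
  fixes x y Z C1 \<alpha> U t :: real
  assumes \<alpha>: "0 < \<alpha>" and x: "1 \<le> x" and Z: "2 \<le> Z" "Z \<le> x" "ln x = 10 / \<alpha> * ln Z" and y: "Z ^ 10 \<le> y"
    and big: "(2 * real g) ^ (2 * g) \<le> Z" and C1: "0 \<le> C1" "\<epsilon> * C1 \<le> 1 / (5 * real g)"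
    and U: "U = A powr C1 * exp (8 * real g * (10 / \<alpha> * (16 * real g)))" and K: "K = 2 * ln (2 * U)"
    and eps: "\<epsilon> \<le> 1 / (4 * real g)" and W: "W = exp (4 * real g * K)"
    and polylog: "((log 2 Z + 1) * real g) ^ nat \<lfloor>W\<rfloor> \<le> Z powr (1 / (10 * real g))"
    and t: "ln t = 800 * (real g)\<^sup>2 / \<alpha>" "1 < t"
    and N: "\<And>n. x < real n \<Longrightarrow> real n \<le> x + y \<Longrightarrow> real (nat \<bar>poly Q (int n)\<bar>) \<le> Z powr C1"
  shows "(\<Sum>n | x < real n \<and> real n \<le> x + y \<and> poly Q (int n) \<noteq> 0. F (vals n))
    \<le> (4 * real g * B * ((2 * real g) ^ (2 * g) * exp (2 * real g * t))
       + 2 * ((2 * U) ^ (10 * g) * (2 * real g) ^ (2 * g) * (2 * sieve_const g) * exp (excess_const K * (4 * K + 1))))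
      * (Delta_factor Qs F D * y * V x * target_sum x)"
proof -
  let ?X = "{n. x < real n \<and> real n \<le> x + y \<and> poly Q (int n) \<noteq> 0}"
  let ?N = "\<lambda>n. nat \<bar>poly Q (int n)\<bar>"
  let ?M = "Delta_factor Qs F D * y * V x * target_sum x"
  let ?G = "(2 * U) ^ (10 * g) * (2 * real g) ^ (2 * g) * (2 * sieve_const g) * exp (excess_const K * (4 * K + 1))"
  let ?A1 = "{n. x < real n \<and> real n \<le> x + y \<and>
      (\<exists>q l. prime q \<and> real q ^ (10 * g) \<le> Z \<and> sqrt Z < real (q ^ l) \<and> int (q ^ l) dvd poly Q (int n))}"
  let ?A2 = "{n. x < real n \<and> real n \<le> x + y \<and> poly Q (int n) \<noteq> 0 \<and>
      (\<exists>P\<subseteq>primes_le W. sqrt Z < real (prime_part P (?N n)) \<and> real (prime_part P (?N n)) \<le> Z)}"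
  have g: "real g \<ge> 1" "real g > 0" using g_pos by auto
  have y0: "0 \<le> y" using y Z by (auto intro: order_trans[OF _ y])
  have Zy: "Z \<le> y"
  proof -
    have "Z ^ 1 \<le> Z ^ 10" using Z by (intro power_increasing) auto
    then show ?thesis using y by simp
  qed
  have AC: "1 \<le> A powr C1" using A_ge C1 by (intro ge_one_powr_ge_zero)
  have U1: "1 \<le> U"
  proof -
    have "1 * 1 \<le> A powr C1 * exp (8 * real g * (10 / \<alpha> * (16 * real g)))"
      using AC \<alpha> by (intro mult_mono) auto
    then show ?thesis by (simp add: U)
  qed
  have K0: "0 < K" using U1 by (simp add: K)
  have W1: "1 \<le> W" using K0 g by (simp add: W)
  have fin: "finite ?X" "finite ?A1" "finite ?A2" by auto
  have Fnn: "0 \<le> F (vals n)" if "poly Q (int n) \<noteq> 0" for n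
    by (rule F_nonneg[OF vals_pos[OF that]])

  have exc: "(\<Sum>n\<in>?X \<inter> (?A1 \<union> ?A2). F (vals n)) \<le> 4 * real g * B * ((2 * real g) ^ (2 * g) * exp (2 * real g * t)) * ?M"
  proof -
    have Fexc: "F (vals n) \<le> B * Z powr (1 / (5 * real g))" if n: "n \<in> ?X" for n
    proof -
      have "F (vals n) \<le> B * real (?N n) powr \<epsilon>" using n by (intro F_vals_le) auto
      also have "\<dots> \<le> B * (Z powr C1) powr \<epsilon>"
        using n eps_pos B_ge N[of n] by (intro mult_left_mono powr_mono2) auto
      also have "\<dots> = B * Z powr (\<epsilon> * C1)" by (simp add: powr_powr mult.commute)
      also have "\<dots> \<le> B * Z powr (1 / (5 * real g))"
        using B_ge C1 Z by (intro mult_left_mono powr_mono) auto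
      finally show ?thesis .
    qed
    let ?k = "Z powr (1 / (10 * real g)) * (2 * y * (real g * Z powr (- (1 / (2 * real g)))))"
    have c1: "real (card ?A1) \<le> ?k"
      using prime_power_exceptions[of x Z y] x Z Zy by simp
    have c2: "real (card ?A2) \<le> ?k"
    proof -
      have "real (card ?A2) \<le> (log 2 Z + 1) ^ nat \<lfloor>W\<rfloor> * (2 * y * (real g ^ nat \<lfloor>W\<rfloor> * Z powr (- (1 / (2 * real g)))))"
        using smooth_exceptions[of x Z y W] x Z Zy W1 by simp
      also have "\<dots> = ((log 2 Z + 1) * real g) ^ nat \<lfloor>W\<rfloor> * (2 * y * (1 * Z powr (- (1 / (2 * real g)))))"
        by (simp only: power_mult_distrib mult_ac mult_1)
      also have "\<dots> \<le> ?k"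
        using polylog y0 g by (intro mult_mono mult_left_mono mult_right_mono) auto
      finally show ?thesis .
    qed
    have "(\<Sum>n\<in>?X \<inter> (?A1 \<union> ?A2). F (vals n)) \<le> real (card (?X \<inter> (?A1 \<union> ?A2))) * (B * Z powr (1 / (5 * real g)))"
      by (rule sum_bounded_above) (use Fexc in auto)
    also have "\<dots> \<le> (?k + ?k) * (B * Z powr (1 / (5 * real g)))"
    proof (rule mult_right_mono)
      have "card (?X \<inter> (?A1 \<union> ?A2)) \<le> card (?A1 \<union> ?A2)" using fin by (intro card_mono) auto
      also have "\<dots> \<le> card ?A1 + card ?A2" by (rule card_Un_le)
      finally show "real (card (?X \<inter> (?A1 \<union> ?A2))) \<le> ?k + ?k" using c1 c2 by linarith
    qed (use B_ge in auto)
    also have "\<dots> = 4 * real g * B * y * (Z powr (1 / (10 * real g)) * Z powr (- (1 / (2 * real g))) * Z powr (1 / (5 * real g)))"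
      by (simp add: algebra_simps)
    also have "Z powr (1 / (10 * real g)) * Z powr (- (1 / (2 * real g))) * Z powr (1 / (5 * real g)) = Z powr (- (1 / (5 * real g)))"
    proof -
      have "1 / (10 * real g) + - (1 / (2 * real g)) + 1 / (5 * real g) = - (1 / (5 * real g))"
        using g by (simp add: field_simps)
      then show ?thesis by (simp only: powr_add[symmetric])
    qed
    also have "4 * real g * B * y * Z powr (- (1 / (5 * real g)))
        \<le> 4 * real g * B * y * ((2 * real g) ^ (2 * g) * exp (2 * real g * t) * V x)"
    proof (rule mult_left_mono)
      \<comment> \<open>\<open>t\<close> is chosen such that the power of \<open>x\<close> in
        \<open>V_lower_small_power\<close> is exactly \<open>Z powr (- 1 / (10 * g))\<close>, so
        half of the saved exponent already suffices.\<close>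
      have "Z powr (- (1 / (5 * real g))) \<le> Z powr (- (1 / (10 * real g)))"
        using Z g by (intro powr_mono) (auto simp: field_simps)
      also have "\<dots> = exp (- 2 * real g * (4 * ln x / ln t))"
      proof -
        have "4 * ln x / ln t = ln Z / (20 * (real g)\<^sup>2)"
          unfolding Z(3) t(1) using \<alpha> g by (simp add: field_simps)
        then have "- 2 * real g * (4 * ln x / ln t) = - (1 / (10 * real g)) * ln Z"
          using g by (simp add: power2_eq_square)
        then show ?thesis using Z(1) by (simp only: powr_def) simp
      qed
      also have "\<dots> = (2 * real g) ^ (2 * g) * exp (2 * real g * t) * ((1 / (2 * real g)) ^ (2 * g) * exp (- 2 * real g * (t + 4 * ln x / ln t)))"
      proof -
        have a: "(2 * real g) ^ (2 * g) * (1 / (2 * real g)) ^ (2 * g) = 1"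
          unfolding power_mult_distrib[symmetric] using g_pos by simp
        have b: "exp (2 * real g * t) * exp (- 2 * real g * (t + 4 * ln x / ln t)) = exp (- 2 * real g * (4 * ln x / ln t))"
          by (simp add: algebra_simps flip: exp_add)
        have "(2 * real g) ^ (2 * g) * exp (2 * real g * t) * ((1 / (2 * real g)) ^ (2 * g) * exp (- 2 * real g * (t + 4 * ln x / ln t)))
          = ((2 * real g) ^ (2 * g) * (1 / (2 * real g)) ^ (2 * g)) * (exp (2 * real g * t) * exp (- 2 * real g * (t + 4 * ln x / ln t)))"
          by (simp only: mult_ac)
        then show ?thesis unfolding a b by simp
      qed
      also have "\<dots> \<le> (2 * real g) ^ (2 * g) * exp (2 * real g * t) * V x"
        using V_lower_small_power[OF t(2) x] by (intro mult_left_mono) auto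
      finally show "Z powr (- (1 / (5 * real g))) \<le> (2 * real g) ^ (2 * g) * exp (2 * real g * t) * V x" .
    qed (use y0 B_ge in auto)
    also have "\<dots> = 4 * real g * B * ((2 * real g) ^ (2 * g) * exp (2 * real g * t)) * (1 * y * V x * 1)"
      by (simp only: mult_ac mult_1 mult_1_right)
    \<comment> \<open>\<open>Delta_factor\<close> and the main sum are at least 1 and may be
      inserted.\<close>
    also have "\<dots> \<le> 4 * real g * B * ((2 * real g) ^ (2 * g) * exp (2 * real g * t)) * ?M"
      using Delta_factor_ge_1 target_sum_ge_1[OF x] y0 V_nonneg[of x] B_ge
      by (intro mult_left_mono mult_mono mult_right_mono) auto
    finally show ?thesis .
  qed

  have "\<exists>q r. 2 \<le> q \<and> real q \<le> Z + 1 \<and> real (prime_part (primes_below q) (?N n)) \<le> Z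
      \<and> (Z < real q \<or> prime q \<and> Z < real (prime_part (primes_below q) (?N n)) * real (q ^ multiplicity q (?N n)))
      \<and> real (q ^ r) \<le> Z \<and> Z < real (q ^ Suc r)" for n
  proof -
    obtain q where q: "2 \<le> q" "real q \<le> Z + 1" "real (prime_part (primes_below q) (?N n)) \<le> Z"
      "Z < real q \<or> prime q \<and> Z < real (prime_part (primes_below q) (?N n)) * real (q ^ multiplicity q (?N n))"
      using cut_exists[OF Z(1), of "?N n"] by blast
    have "1 \<le> Z" using Z by simp
    from floor_log_exists[OF this q(1)] obtain r where "real (q ^ r) \<le> Z" "Z < real (q ^ Suc r)" by blast
    with q show ?thesis by blast
  qed
  then have "\<forall>n. \<exists>q r. 2 \<le> q \<and> real q \<le> Z + 1 \<and> real (prime_part (primes_below q) (?N n)) \<le> Z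
      \<and> (Z < real q \<or> prime q \<and> Z < real (prime_part (primes_below q) (?N n)) * real (q ^ multiplicity q (?N n)))
      \<and> real (q ^ r) \<le> Z \<and> Z < real (q ^ Suc r)" by blast
  then obtain q r where qr: "\<And>n. 2 \<le> q n" "\<And>n. real (q n) \<le> Z + 1"
      "\<And>n. real (prime_part (primes_below (q n)) (?N n)) \<le> Z"
      "\<And>n. Z < real (q n) \<or> prime (q n) \<and> Z < real (prime_part (primes_below (q n)) (?N n)) * real (q n ^ multiplicity (q n) (?N n))"
      "\<And>n. real (q n ^ r n) \<le> Z" "\<And>n. Z < real (q n ^ Suc (r n))"
    unfolding choice_iff by blast
  let ?Y = "?X - (?A1 \<union> ?A2)"
  \<comment> \<open>Since \<open>q n >= 2\<close>, no larger \<open>r\<close> occurs; the geometric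
    series makes the total independent of \<open>R\<close>.\<close>
  define R where "R = nat \<lfloor>log 2 Z\<rfloor>"
  have rR: "r n \<le> R" for n
  proof -
    have "(2 :: nat) ^ r n \<le> q n ^ r n" using qr(1) by (intro power_mono) auto
    then have "real (2 ^ r n) \<le> Z" using qr(5)[of n] by linarith
    then have "2 powr real (r n) \<le> Z" by (simp add: powr_realpow)
    then have "real (r n) \<le> log 2 Z" using Z by (simp add: le_log_iff)
    then show ?thesis unfolding R_def by (rule le_nat_floor)
  qed
  \<comment> \<open>\<open>10 * g <= r\<close> forces \<open>q n ^ (10 * g) <= Z\<close>, so the cut
    falls at a prime. If the part below it were at most \<open>sqrt Z\<close>, a power of
    \<open>q n\<close> above \<open>sqrt Z\<close> would divide \<open>Q n\<close>, as in
    \<open>?A1\<close>; if \<open>q n <= W\<close>, that part would consist of bounded primes, as in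
    \<open>?A2\<close>.\<close>
  have case_r: "sqrt Z < real (prime_part (primes_below (q n)) (?N n)) \<and> W < real (q n)"
    if n: "n \<in> ?Y" and rn: "10 * g \<le> r n" for n
  proof -
    have pow: "real (q n) ^ (10 * g) \<le> Z"
    proof -
      have "real (q n ^ (10 * g)) \<le> real (q n ^ r n)"
        using qr(1)[of n] rn by (intro of_nat_mono power_increasing) auto
      then show ?thesis using qr(5)[of n] by simp
    qed
    have "real (q n) ^ 1 \<le> real (q n) ^ (10 * g)"
      using qr(1)[of n] g_pos by (intro power_increasing) auto
    then have "\<not> Z < real (q n)" using pow by (simp only: power_one_right)
    then have pr: "prime (q n)" and lt: "Z < real (prime_part (primes_below (q n)) (?N n)) * real (q n ^ multiplicity (q n) (?N n))"
      using qr(4)[of n] by auto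
    have s: "sqrt Z < real (prime_part (primes_below (q n)) (?N n))"
    proof (rule ccontr)
      assume "\<not> ?thesis"
      then have "real (prime_part (primes_below (q n)) (?N n)) * real (q n ^ multiplicity (q n) (?N n))
          \<le> sqrt Z * real (q n ^ multiplicity (q n) (?N n))"
        by (intro mult_right_mono) auto
      then have "sqrt Z * sqrt Z < sqrt Z * real (q n ^ multiplicity (q n) (?N n))"
        using lt Z by simp
      then have big_q: "sqrt Z < real (q n ^ multiplicity (q n) (?N n))"
        by (rule mult_left_less_imp_less) (use Z in auto)
      have "q n ^ multiplicity (q n) (?N n) dvd ?N n" by (rule multiplicity_dvd)
      then have "int (q n ^ multiplicity (q n) (?N n)) dvd poly Q (int n)"
        by (simp add: dvd_nat_abs_iff del: of_nat_power)
      then have "n \<in> ?A1" using n pr pow big_q by blast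
      then show False using n by blast
    qed
    moreover have "W < real (q n)"
    proof (rule ccontr)
      assume "\<not> W < real (q n)"
      then have "primes_below (q n) \<subseteq> primes_le W"
        by (auto simp: primes_below_def primes_le_def)
      then have "n \<in> ?A2" using n s qr(3)[of n] by blast
      then show False using n by blast
    qed
    ultimately show ?thesis by blast
  qed
  have "(\<Sum>n\<in>?Y. F (vals n)) = (\<Sum>j\<in>{..R}. \<Sum>n | n \<in> ?Y \<and> r n = j. F (vals n))"
    by (rule sum.group[symmetric]) (use fin rR in auto)
  also have "\<dots> \<le> (\<Sum>j\<in>{..R}. (1/2) ^ j * (?G * ?M))"
  proof (rule sum_mono)
    fix j
    let ?S = "{n. n \<in> ?Y \<and> r n = j}"
    have 1: "?S \<subseteq> {n. x < real n \<and> real n \<le> x + y}" by blast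
    have 2: "poly Q (int n) \<noteq> 0" if "n \<in> ?S" for n using that by blast
    have 3: "real (?N n) \<le> Z powr C1" if "n \<in> ?S" for n
      by (rule N) (use that in blast)+
    have 4: "real (q n ^ j) \<le> Z" "Z < real (q n ^ Suc j)" if "n \<in> ?S" for n
      using qr(5,6)[of n] that by blast+
    have 5: "sqrt Z < real (prime_part (primes_below (q n)) (?N n)) \<and> exp (4 * real g * K) < real (q n)"
      if "n \<in> ?S" "10 * g \<le> j" for n
      unfolding W[symmetric] by (rule case_r) (use that in blast)+
    show "(\<Sum>n\<in>?S. F (vals n)) \<le> (1/2) ^ j * (?G * ?M)"
      by (rule class_bound[where q = q and S = ?S, OF \<alpha> x Z y big C1(1) U K eps 1 2 3 _ _ _ 4 5]) (rule qr | assumption)+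
  qed
  also have "\<dots> = (\<Sum>j\<in>{..R}. (1/2) ^ j) * (?G * ?M)"
    by (rule sum_distrib_right[symmetric])
  also have "\<dots> \<le> 2 * (?G * ?M)"
  proof (rule mult_right_mono)
    have "(\<Sum>j\<in>{..R}. (1/2 :: real) ^ j) = 2 - (1/2) ^ R"
      by (induction R) (auto simp: field_simps)
    then show "(\<Sum>j\<in>{..R}. (1/2 :: real) ^ j) \<le> 2" by simp
    show "0 \<le> ?G * ?M"
      using U1 sieve_const_ge_1[of g] Delta_factor_ge_1 target_sum_ge_1[OF x] y0 V_nonneg[of x]
      by (auto intro!: mult_nonneg_nonneg)
  qed
  finally have main: "(\<Sum>n\<in>?Y. F (vals n)) \<le> 2 * (?G * ?M)" .
  have "(\<Sum>n\<in>?X. F (vals n)) = (\<Sum>n\<in>?X \<inter> (?A1 \<union> ?A2). F (vals n)) + (\<Sum>n\<in>?Y. F (vals n))"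
    by (rule sum.Int_Diff[OF fin(1)])
  also have "\<dots> \<le> 4 * real g * B * ((2 * real g) ^ (2 * g) * exp (2 * real g * t)) * ?M + 2 * (?G * ?M)"
    by (rule add_mono[OF exc main])
  also have "\<dots> = (4 * real g * B * ((2 * real g) ^ (2 * g) * exp (2 * real g * t)) + 2 * ?G) * ?M"
    by (simp only: distrib_right mult.assoc)
  finally show ?thesis .
qed

end

section \<open>Choice of the constants and reduction to normalised F\<close>

lemma eventually_polylog_le:
  fixes c \<kappa> :: real
  assumes "0 < \<kappa>"
  shows "eventually (\<lambda>Z. ((log 2 Z + 1) * c) ^ m \<le> Z powr \<kappa>) at_top"
proof (cases m)
  case 0
  show ?thesis
    by (rule eventually_mono[OF eventually_ge_at_top[of 1]]) (use assms 0 in \<open>simp add: ge_one_powr_ge_zero\<close>)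
next
  case (Suc k)
  have "((\<lambda>Z. (log 2 Z + 1) * c / Z powr (\<kappa> / real m)) \<longlongrightarrow> 0) at_top"
    using assms Suc unfolding log_def by real_asymp
  from tendstoD[OF this, of 1]
  have "eventually (\<lambda>Z. \<bar>(log 2 Z + 1) * c / Z powr (\<kappa> / real m)\<bar> < 1) at_top"
    by (simp add: dist_real_def)
  then show ?thesis
    using eventually_gt_at_top[of 0]
  proof eventually_elim
    case (elim Z)
    then have "\<bar>(log 2 Z + 1) * c\<bar> \<le> Z powr (\<kappa> / real m)"
      by (simp add: abs_mult field_simps)
    then have "\<bar>(log 2 Z + 1) * c\<bar> ^ m \<le> (Z powr (\<kappa> / real m)) ^ m"
      by (intro power_mono) auto
    also have "\<dots> = (Z powr (\<kappa> / real m)) powr real m"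
      by (rule powr_realpow[symmetric]) (use elim in simp)
    also have "\<dots> = Z powr \<kappa>"
      unfolding powr_powr using Suc by simp
    finally show ?case by (simp flip: power_abs)
  qed
qed

theorem theorem3:
  fixes g :: nat and \<alpha> \<delta> A B :: real
  assumes "0 < \<alpha>" "\<alpha> < 1" "0 < \<delta>" "\<delta> < 1" "1 \<le> A" "1 \<le> B"
  shows "\<exists>c0 > 0. \<exists>C > 0. \<forall>(k::nat) (Qs :: int poly list) (Q :: int poly) (D :: int)
           (\<epsilon>::real) (F :: nat list \<Rightarrow> real) (x::real) (y::real).
    1 \<le> k \<longrightarrow> length Qs = k \<longrightarrow>
    (\<forall>j < k. irreducible (Qs ! j)) \<longrightarrow>
    (\<forall>i < k. \<forall>j < k. i \<noteq> j \<longrightarrow> coprime (Qs ! i) (Qs ! j)) \<longrightarrow>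
    Q = prod_list Qs \<longrightarrow> degree Q = g \<longrightarrow> D = poly_discriminant Q \<longrightarrow>
    (\<nexists>p. fixed_prime_divisor p Q) \<longrightarrow>
    0 < \<epsilon> \<longrightarrow> \<epsilon> \<le> \<alpha> / (50 * real g * (real g + 1 / \<delta>)) \<longrightarrow>
    F \<in> class_M k A B \<epsilon> \<longrightarrow> multiplicative_fun k F \<longrightarrow>
    c0 * real_of_int (poly_norm Q) powr \<delta> \<le> x \<longrightarrow> x powr \<alpha> < y \<longrightarrow> y \<le> x \<longrightarrow>
    (\<Sum>n | x < real n \<and> real n \<le> x + y \<and> poly Q (int n) \<noteq> 0.
        F (map (\<lambda>P. nat \<bar>poly P (int n)\<bar>) Qs))
    \<le> C * Delta_factor Qs F D * y
        * (\<Prod>p | prime p \<and> real p \<le> x. 1 - real (rho Q p) / real p)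
        * (\<Sum>ns | ns \<in> pos_tuples k \<and> real (prod_list ns) \<le> x \<and>
                 coprime (int (prod_list ns)) D.
             F ns * (\<Prod>j<k. real (rho (Qs ! j) (ns ! j))) / real (prod_list ns))"
proof -
  \<comment> \<open>\<open>|Q n|\<close> is at most \<open>x powr (g + 1 / \<delta>)\<close> on the
    range of summation, and \<open>x = Z powr (10 / \<alpha>)\<close>.\<close>
  define C1 where "C1 = 10 * (real g + 1 / \<delta>) / \<alpha>"
  define U where "U = A powr C1 * exp (8 * real g * (10 / \<alpha> * (16 * real g)))"
  define K where "K = 2 * ln (2 * U)"
  define W where "W = exp (4 * real g * K)"
  \<comment> \<open>Makes \<open>x powr (- 8 * g / ln t)\<close> equal to
    \<open>Z powr (- 1 / (10 * g))\<close>.\<close>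
  define t where "t = exp (800 * (real g)\<^sup>2 / \<alpha>)"
  \<comment> \<open>Outside its locale \<open>excess_const\<close> takes only \<open>g\<close>,
    \<open>A\<close>, \<open>B\<close> and \<open>K\<close>, so \<open>C\<close> is fixed before the
    polynomials and \<open>F\<close>.\<close>
  define C where "C = 4 * real g * B * ((2 * real g) ^ (2 * g) * exp (2 * real g * t))
       + 2 * ((2 * U) ^ (10 * g) * (2 * real g) ^ (2 * g) * (2 * sieve_const g)
         * exp (weighted_system.excess_const g A B K * (4 * K + 1)))"
  have U0: "U > 0" using assms by (simp add: U_def)
  have C0: "C > 0"
  proof -
    have "(2 * real g) ^ (2 * g) > 0" by (cases "g = 0") auto
    then have "2 * ((2 * U) ^ (10 * g) * (2 * real g) ^ (2 * g) * (2 * sieve_const g)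
         * exp (weighted_system.excess_const g A B K * (4 * K + 1))) > 0"
      using U0 sieve_const_ge_1[of g] by (auto intro!: mult_pos_pos)
    moreover have "0 \<le> 4 * real g * B * ((2 * real g) ^ (2 * g) * exp (2 * real g * t))"
      using assms by (auto intro!: mult_nonneg_nonneg)
    ultimately show ?thesis unfolding C_def by linarith
  qed
  \<comment> \<open>The polynomials are not given yet and \<open>g = 0\<close> is still possible;
    the guard \<open>0 < g\<close> defers this question.\<close>
  have "eventually (\<lambda>Z. 2 \<le> Z \<and> (2 * real g) ^ (2 * g) \<le> Z
      \<and> (0 < g \<longrightarrow> ((log 2 Z + 1) * real g) ^ nat \<lfloor>W\<rfloor> \<le> Z powr (1 / (10 * real g)))) at_top"
  proof (intro eventually_conj eventually_ge_at_top)
    show "eventually (\<lambda>Z. 0 < g \<longrightarrow> ((log 2 Z + 1) * real g) ^ nat \<lfloor>W\<rfloor> \<le> Z powr (1 / (10 * real g))) at_top"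
      using eventually_polylog_le[of "1 / (10 * real g)" "real g" "nat \<lfloor>W\<rfloor>"] by (cases "g = 0") auto
  qed
  then obtain Z0 where Z0: "\<And>Z. Z0 \<le> Z \<Longrightarrow> 2 \<le> Z \<and> (2 * real g) ^ (2 * g) \<le> Z
      \<and> (0 < g \<longrightarrow> ((log 2 Z + 1) * real g) ^ nat \<lfloor>W\<rfloor> \<le> Z powr (1 / (10 * real g)))"
    unfolding eventually_at_top_linorder by blast
  have Z0_ge: "2 \<le> Z0" using Z0[of Z0] by simp
  \<comment> \<open>The first entry absorbs the \<open>2 ^ g\<close> arising from
    \<open>n <= 2 * x\<close>, since \<open>poly_norm Q\<close> is at most
    \<open>(x / c0) powr (1 / \<delta>)\<close>. The second ensures \<open>Z0 <= Z\<close>.\<close>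
  define c0 where "c0 = max (2 ^ g) (Z0 powr (10 / \<alpha>))"
  have c0: "1 \<le> c0" "2 ^ g \<le> c0" "Z0 powr (10 / \<alpha>) \<le> c0"
    by (auto simp: c0_def le_max_iff_disj)
  have c0_pos: "0 < c0" using c0 by linarith
  show ?thesis
  proof (rule exI[of _ c0], rule conjI[OF c0_pos],
      rule exI[of _ C], rule conjI[OF C0], intro allI impI)
    fix k :: nat and Qs :: "int poly list" and Q :: "int poly" and D :: int
      and \<epsilon> :: real and F :: "nat list \<Rightarrow> real" and x y :: real
    assume k: "1 \<le> k" and len: "length Qs = k" and irr: "\<forall>j < k. irreducible (Qs ! j)"
      and cop: "\<forall>i < k. \<forall>j < k. i \<noteq> j \<longrightarrow> coprime (Qs ! i) (Qs ! j)"
      and Q: "Q = prod_list Qs" and deg: "degree Q = g" and D: "D = poly_discriminant Q"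
      and nofix: "\<nexists>p. fixed_prime_divisor p Q"
      and eps: "0 < \<epsilon>" "\<epsilon> \<le> \<alpha> / (50 * real g * (real g + 1 / \<delta>))"
      and FM: "F \<in> class_M k A B \<epsilon>" and Fm: "multiplicative_fun k F"
      and xn: "c0 * real_of_int (poly_norm Q) powr \<delta> \<le> x" and y: "x powr \<alpha> < y" "y \<le> x"
    have ne: "Qs \<noteq> []" using k len by auto
    \<comment> \<open>A constant irreducible polynomial is divisible by a prime, which would be a
      fixed prime divisor of \<open>Q\<close>.\<close>
    have degpos: "degree (Qs ! j) > 0" if j: "j < k" for j
    proof (rule ccontr)
      assume "\<not> degree (Qs ! j) > 0"
      then obtain c where c: "Qs ! j = [:c:]" using degree_eq_zeroE by blast
      have "\<not> is_unit (Qs ! j)" using irr j by (simp add: irreducible_def)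
      then have "nat \<bar>c\<bar> \<noteq> 1" by (auto simp: c is_unit_const_poly_iff)
      then obtain p where p: "prime p" "p dvd nat \<bar>c\<bar>" using prime_factor_nat by blast
      then have "int p dvd c" by (simp add: dvd_nat_abs_iff)
      moreover have "poly (Qs ! j) z dvd poly Q z" for z
        unfolding Q poly_prod_list using j len by (intro mem_dvd_prod_list) auto
      ultimately have "int p dvd poly Q z" for z
        using c by (metis dvd_trans poly_const_conv)
      then show False using nofix p by (auto simp: fixed_prime_divisor_def)
    qed
    have D0: "D \<noteq> 0"
      unfolding D Q by (rule discriminant_nonzero) (use irr cop degpos len ne in auto)
    interpret ps: poly_system Qs Q g D
      by unfold_locales (use Q deg D nofix degpos len ne D0 in \<open>auto simp: in_set_conv_nth\<close>)
    have Q0: "Q \<noteq> 0" using ps.g_pos deg by auto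
    have norm1: "1 \<le> real_of_int (poly_norm Q)" using poly_norm_ge_1[OF Q0] by linarith
    have "c0 * 1 \<le> c0 * real_of_int (poly_norm Q) powr \<delta>"
      using c0 norm1 assms by (intro mult_left_mono ge_one_powr_ge_zero) auto
    then have xc: "c0 \<le> x" using xn by linarith
    then have x1: "1 \<le> x" using c0 by linarith
    have y0: "0 \<le> y" using y(1) by (rule order_trans[OF _ less_imp_le, rotated]) simp
    let ?one = "replicate k (1::nat)"
    have one: "?one \<in> pos_tuples k" by (simp add: pos_tuples_def)
    have mult_one: "map2 (*) a ?one = a" if "a \<in> pos_tuples k" for a
      using that by (intro nth_equalityI) (auto simp: pos_tuples_def)
    have F_ones: "F a = F a * F ?one" if a: "a \<in> pos_tuples k" for a
    proof -
      have "coprime (prod_list a) (prod_list ?one)" by simp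
      then have "F (map2 (*) a ?one) = F a * F ?one"
        using Fm a one unfolding multiplicative_fun_def by blast
      then show ?thesis by (simp only: mult_one[OF a])
    qed
    show "(\<Sum>n | x < real n \<and> real n \<le> x + y \<and> poly Q (int n) \<noteq> 0.
        F (map (\<lambda>P. nat \<bar>poly P (int n)\<bar>) Qs))
      \<le> C * Delta_factor Qs F D * y
        * (\<Prod>p | prime p \<and> real p \<le> x. 1 - real (rho Q p) / real p)
        * (\<Sum>ns | ns \<in> pos_tuples k \<and> real (prod_list ns) \<le> x \<and> coprime (int (prod_list ns)) D.
             F ns * (\<Prod>j<k. real (rho (Qs ! j) (ns ! j))) / real (prod_list ns))"
    \<comment> \<open>By multiplicativity \<open>F ?one\<close> is idempotent. If it is 0,
      \<open>F\<close> vanishes on all positive tuples and both sides are 0; otherwise it is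
      1.\<close>
    proof (cases "F ?one = 0")
      case True
      then have F0: "F a = 0" if "a \<in> pos_tuples k" for a using F_ones[OF that] unfolding True by simp
      have "map (\<lambda>P. nat \<bar>poly P (int n)\<bar>) Qs \<in> pos_tuples k" if "poly Q (int n) \<noteq> 0" for n
      proof -
        have "poly P (int n) dvd poly Q (int n)" if "P \<in> set Qs" for P
          using mem_dvd_prod_list[OF that] unfolding Q by (auto elim!: dvdE)
        then have "poly P (int n) \<noteq> 0" if "P \<in> set Qs" for P
          using that \<open>poly Q (int n) \<noteq> 0\<close> by (metis dvd_0_left)
        then show ?thesis using len by (auto simp: pos_tuples_def)
      qed
      then show ?thesis using F0 by simp
    next
      case False
      then have F1: "F ?one = 1" using F_ones[OF one] by simp
      interpret ws: weighted_system Qs Q g D F A B \<epsilon>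
        by unfold_locales (use FM Fm F1 len assms eps in auto)
      define Z where "Z = x powr (\<alpha> / 10)"
      have g: "0 < g" "1 \<le> real g" using ps.g_pos by auto
      have "Z0 = (Z0 powr (10 / \<alpha>)) powr (\<alpha> / 10)"
        using Z0_ge assms by (simp add: powr_powr)
      also have "\<dots> \<le> Z"
        unfolding Z_def using c0 xc assms by (intro powr_mono2) auto
      finally have ZZ0: "Z0 \<le> Z" .
      note Zc = Z0[OF ZZ0]
      have Zx: "Z \<le> x"
      proof -
        have "Z \<le> x powr 1" unfolding Z_def using x1 assms by (intro powr_mono) auto
        then show ?thesis using x1 by simp
      qed
      have lnx: "ln x = 10 / \<alpha> * ln Z"
        unfolding Z_def using x1 assms by (simp add: ln_powr)
      have Z10: "Z ^ 10 \<le> y"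
      proof -
        have "Z ^ 10 = Z powr real 10" using Zc by (intro powr_realpow[symmetric]) auto
        also have "\<dots> = x powr \<alpha>" by (simp add: Z_def powr_powr)
        finally show ?thesis using y by simp
      qed
      have gd: "real g + 1 / \<delta> \<ge> 1" using g assms by (simp add: add_increasing2)
      have C1: "0 \<le> C1" using assms gd by (simp add: C1_def)
      have epsC1: "\<epsilon> * C1 \<le> 1 / (5 * real g)"
      proof -
        have "\<epsilon> * C1 \<le> \<alpha> / (50 * real g * (real g + 1 / \<delta>)) * C1"
          using eps C1 by (intro mult_right_mono)
        also have "\<dots> = 1 / (5 * real g)"
        proof -
          define u where "u = real g + 1 / \<delta>"
          have "u > 0" using gd by (simp add: u_def)
          then show ?thesis unfolding C1_def u_def[symmetric] using assms g by (simp add: field_simps)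
        qed
        finally show ?thesis .
      qed
      have eps4: "\<epsilon> \<le> 1 / (4 * real g)"
      proof -
        have "\<alpha> / (50 * real g * (real g + 1 / \<delta>)) \<le> 1 / (4 * real g)"
        proof (rule frac_le)
          have "4 * real g \<le> 50 * real g" by simp
          also have "\<dots> \<le> 50 * real g * (real g + 1 / \<delta>)"
            using gd g mult_left_mono[of 1 "real g + 1 / \<delta>" "50 * real g"] by simp
          finally show "4 * real g \<le> 50 * real g * (real g + 1 / \<delta>)" .
        qed (use assms g in auto)
        then show ?thesis using eps by linarith
      qed
      have bound: "real (nat \<bar>poly Q (int n)\<bar>) \<le> Z powr C1" if n: "x < real n" "real n \<le> x + y" for n
      proof -
        have n1: "1 \<le> int n" using n x1 by linarith
        have "real (nat \<bar>poly Q (int n)\<bar>) = real_of_int \<bar>poly Q (int n)\<bar>" by simp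
        also have "\<dots> \<le> real_of_int (poly_norm Q * int n ^ g)"
          using abs_poly_le_poly_norm[OF n1, of Q] deg by (simp only: of_int_le_iff)
        also have "\<dots> = real_of_int (poly_norm Q) * real n ^ g" by simp
        also have "\<dots> \<le> (x / c0) powr (1 / \<delta>) * (2 * x) ^ g"
        proof (intro mult_mono power_mono)
          have "real_of_int (poly_norm Q) = (real_of_int (poly_norm Q) powr \<delta>) powr (1 / \<delta>)"
            using norm1 assms by (simp add: powr_powr)
          also have "\<dots> \<le> (x / c0) powr (1 / \<delta>)"
            using xn c0 assms by (intro powr_mono2) (auto simp: field_simps)
          finally show "real_of_int (poly_norm Q) \<le> (x / c0) powr (1 / \<delta>)" .
          show "real n \<le> 2 * x" using n y by linarith
        qed auto
        also have "(x / c0) powr (1 / \<delta>) = x powr (1 / \<delta>) / c0 powr (1 / \<delta>)"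
          by (rule powr_divide)
        also have "\<dots> * (2 * x) ^ g = (2 ^ g / c0 powr (1 / \<delta>)) * (x powr (1 / \<delta>) * x ^ g)"
          by (simp add: power_mult_distrib)
        also have "\<dots> \<le> 1 * (x powr (1 / \<delta>) * x ^ g)"
        proof (rule mult_right_mono)
          have "c0 powr 1 \<le> c0 powr (1 / \<delta>)" using c0 assms by (intro powr_mono) auto
          then have "2 ^ g \<le> c0 powr (1 / \<delta>)" using c0 by simp
          then show "2 ^ g / c0 powr (1 / \<delta>) \<le> 1" using c0 by (simp add: divide_le_eq)
        qed (use x1 in auto)
        also have "\<dots> = x powr (real g + 1 / \<delta>)"
          using x1 by (simp add: powr_add powr_realpow)
        also have "\<dots> = Z powr C1"
        proof -
          have "\<alpha> / 10 * (10 * u / \<alpha>) = u" for u using assms(1) by simp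
          then show ?thesis by (simp only: Z_def C1_def powr_powr)
        qed
        finally show ?thesis .
      qed
      have t: "ln t = 800 * (real g)\<^sup>2 / \<alpha>" "1 < t"
        using assms g by (auto simp: t_def)
      have "(\<Sum>n | x < real n \<and> real n \<le> x + y \<and> poly Q (int n) \<noteq> 0. F (ws.vals n))
        \<le> C * (Delta_factor Qs F D * y * ws.V x * ws.target_sum x)"
        unfolding C_def
        by (rule ws.sum_over_interval_le[OF assms(1) x1 _ Zx lnx Z10 _ C1 epsC1 U_def K_def eps4 W_def _ t bound])
           (use Zc g in auto)
      then show ?thesis
        by (simp only: ws.vals_def ws.V_def ps.w_def primes_le_def ws.target_sum_def len mult.assoc)
    qed
  qed
qed

end
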